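(* Let $\varepsilon>0$. Let $W:\mathbb{R}^6\to\mathbb{R}_{\geq 0}$ be any smooth weight function that is compactly supported on $\{(\mathbf{x},\mathbf{y})\in\mathbb{R}^3\times\mathbb{R}^3: y_1y_2y_3\neq 0\}$. Then, as $B\to\infty$, $$N(B)=\frac{\sigma_\infty}{\zeta(3)}B^3\log B+O\left(B^3(\log B)^{\varepsilon}\right),$$ where the implied constant may depend on $W$ and $\varepsilon$.
   Context: Let $F(\mathbf{x},\mathbf{y})=x_1y_1^2+x_2y_2^2+x_3y_3^2$ for $\mathbf{x}=(x_1,x_2,x_3)$ and $\mathbf{y}=(y_1,y_2,y_3)$. The counting function is $$N(B)=\sum_{\substack{\mathbf{x},\mathbf{y}\in\mathbb{Z}^3\\ F(\mathbf{x},\mathbf{y})=0}}W\left(\frac{(\mathbf{x},\mathbf{y})}{B}\right),$$ and the weighted real density is $$\sigma_\infty=\lim_{\epsilon\to0}(2\epsilon)^{-1}\int_{|F(\mathbf{x},\mathbf{y})|\le\epsilon}W(\mathbf{x},\mathbf{y})\,\mathrm{d}\mathbf{x}\,\mathrm{d}\mathbf{y}.$$ "Compactly supported on $U$" means that the support of $W$ is a compact subset of the open set $U$. $\zeta$ is the Riemann zeta function. *)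

theory Defs
  imports "HOL-Analysis.Analysis" "HOL-Library.Landau_Symbols"
begin

definition F :: "'a::comm_ring_1 ^ 3 \<Rightarrow> 'a ^ 3 \<Rightarrow> 'a" where
  "F x y = x $ 1 * (y $ 1)\<^sup>2 + x $ 2 * (y $ 2)\<^sup>2 + x $ 3 * (y $ 3)\<^sup>2"

text \<open>
  A function is \<open>C\<^sup>n\<close> if it is \<open>n\<close> times Frechet differentiable with continuous iterated
  directional derivatives, in all directions.
\<close>

primrec Cn :: "nat \<Rightarrow> ('a::real_normed_vector \<Rightarrow> 'b::real_normed_vector) \<Rightarrow> bool" where
  "Cn 0 f \<longleftrightarrow> continuous_on UNIV f"
| "Cn (Suc n) f \<longleftrightarrow> (\<forall>x. f differentiable (at x)) \<and>
     (\<forall>v. Cn n (\<lambda>x. frechet_derivative f (at x) v))"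

definition smooth :: "('a::real_normed_vector \<Rightarrow> 'b::real_normed_vector) \<Rightarrow> bool" where
  "smooth f \<longleftrightarrow> (\<forall>n. Cn n f)"

definition compactly_supported_on ::
    "('a::topological_space \<Rightarrow> 'b::zero) \<Rightarrow> 'a set \<Rightarrow> bool" where
  "compactly_supported_on f U \<longleftrightarrow>
     compact (closure {x. f x \<noteq> 0}) \<and> closure {x. f x \<noteq> 0} \<subseteq> U"

definition real_vec :: "int ^ 'n \<Rightarrow> real ^ 'n" where
  "real_vec x = (\<chi> i. real_of_int (x $ i))"

text \<open>
  For \<open>B > 0\<close> and compactly supported \<open>W\<close> only finitely many terms of this sum are nonzero.
\<close>

definition counting_function :: "((real ^ 3) \<times> (real ^ 3) \<Rightarrow> real) \<Rightarrow> real \<Rightarrow> real" where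
  "counting_function W B =
     (\<Sum>\<^sub>\<infinity>(x, y) \<in> {(x, y). F x y = 0}. W ((1 / B) *\<^sub>R (real_vec x, real_vec y)))"

definition density_approx :: "((real ^ 3) \<times> (real ^ 3) \<Rightarrow> real) \<Rightarrow> real \<Rightarrow> real" where
  "density_approx W \<epsilon> =
     inverse (2 * \<epsilon>) * (LINT p : {(x, y). \<bar>F x y\<bar> \<le> \<epsilon>} | lborel. W p)"

text \<open>
  The limit is one-sided. \<^const>\<open>Lim\<close> carries information only when the limit exists.
\<close>

definition real_density :: "((real ^ 3) \<times> (real ^ 3) \<Rightarrow> real) \<Rightarrow> real" where
  "real_density W = Lim (at_right 0) (density_approx W)"

text \<open>The Riemann zeta function at real \<open>s > 1\<close>, where its Dirichlet series converges.\<close>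

definition zeta :: "real \<Rightarrow> real" where
  "zeta s = (\<Sum>n. 1 / real (Suc n) powr s)"

end

theory Submission
  imports Defs "HOL-Number_Theory.Number_Theory"
begin

text \<open>
  Fix \<open>y\<close> and write \<open>y = d y'\<close> with \<open>y'\<close> primitive. The solutions \<open>x\<close> form a plane lattice of
  determinant about \<open>(B / d)\<^sup>2\<close>, so that the sum over \<open>x\<close> is an integral of size about \<open>d\<^sup>2\<close> up to an error
  \<open>O(1 + B / \<lambda>(y'))\<close>, where \<open>\<lambda>(y')\<close> is the length of the shortest vector.

  The main terms are summed by writing \<open>d\<^sup>2\<close> as a sum of Jordan's totient over the divisors of \<open>d\<close>:
  the sum over \<open>y\<close> divisible by \<open>e\<close> is a Riemann sum for the real density, and the sum of
  \<open>J(e) / e\<^sup>3\<close> over \<open>e \<le> B\<close> is \<open>log B / \<zeta>(3) + O(1)\<close>.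

  For the error it suffices that the sum of \<open>1 / \<lambda>(y')\<close> over \<open>y'\<close> of size \<open>Y\<close> is \<open>O(Y\<^sup>2)\<close>. This follows
  from a bound \<open>O(X\<^sup>2 Y (Y / X)\<^bsup>1/4\<^esup>)\<close> for the number of primitive pairs \<open>(x, y')\<close> on the variety with
  \<open>x\<close> of size \<open>X \<le> Y\<close>. Modulo \<open>n = y1\<^sup>2\<close> (in the coprime case) the ratio \<open>y2 / y3\<close> is a square root of
  \<open>- x3 / x2\<close>, and each root carries \<open>O(1)\<close> solutions, all other solutions in its class being parallel
  or far apart. The number of roots is controlled on average over \<open>x3\<close> by reducing modulo a
  squarefree divisor \<open>q \<le> X\<close> of \<open>n\<close> that contains all but a few of the primes of \<open>n\<close>. All errors
  together are \<open>O(B\<^sup>3)\<close>.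
\<close>

text \<open>For primitive \<open>y'\<close> of size \<open>Y\<close> the lattice has index of order
  \<open>Y^2\<close>, so its shortest vector typically has length about \<open>Y\<close>: the bound
  \<open>O(Y^2)\<close> for the sum of reciprocals is of the expected order, and a count of short
  vectors that loses a logarithm at \<open>X = Y\<close> would not give it. The expected number of
  pairs is about \<open>X^2 Y\<close>; bounding the number of square roots by a divisor function
  loses too much. The loss \<open>(Y / X)^(1/4)\<close> is harmless: it disappears at
  \<open>X = Y\<close>, and the count enters with weight \<open>X^(-2)\<close>, so that large
  \<open>X\<close> dominate. The exponent 1/4 is tied to dropping the primes below 16: each prime
  left out of \<open>q\<close> doubles the number of classes, and \<open>2 <= p^(1/4)\<close> once
  \<open>p >= 16\<close>. It is smaller than 1/2, so the sums over the common factors of the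
  coordinates converge. Shortest vectors with a zero coordinate escape this argument; they force two
  coordinates of \<open>y'\<close> to have a large common divisor, and such \<open>y'\<close> are
  counted directly.\<close>

section \<open>Prime products and classes of solutions of a binary congruence\<close>

text \<open>Elements are kept as long as the product stays at most \<open>W\<close>. The element
  that crosses \<open>W\<close> accounts for the leading 2; each later one doubles the left side and
  multiplies the product by at least 16, hence the right side by at least
  \<open>16 powr (1/4) = 2\<close>.\<close>

lemma exists_subset_small_prod:
  fixes P :: "int set" and W :: real
  assumes "finite P" and "\<And>p. p \<in> P \<Longrightarrow> 16 \<le> p" and W: "1 \<le> W"
  shows "\<exists>Q\<subseteq>P. real_of_int (\<Prod>Q) \<le> W \<and>
    2 ^ card (P - Q) \<le> 2 * (max 1 (real_of_int (\<Prod>P) / W)) powr (1/4)"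
  using assms(1,2)
proof (induction P rule: finite_induct)
  case empty
  then show ?case using W by auto
next
  case (insert p P)
  let ?M = "\<lambda>P. max 1 (real_of_int (\<Prod>P) / W) powr (1/4)"
  have p: "16 \<le> p" using insert by auto
  have pos: "\<Prod>P > 0" using insert by (intro prod_pos) (smt (verit, best) insertCI)
  show ?case
  proof (cases "real_of_int (\<Prod>P) \<le> W")
    case True
    have "insert p P - P = {p}" using insert by auto
    moreover have "1 \<le> ?M (insert p P)" by (intro ge_one_powr_ge_zero) auto
    ultimately show ?thesis using True by (intro exI[of _ P]) auto
  next
    case False
    obtain Q where Q: "Q \<subseteq> P" "real_of_int (\<Prod>Q) \<le> W" "2 ^ card (P - Q) \<le> 2 * ?M P"
      using insert by auto
    have 1: "insert p P - Q = insert p (P - Q)" "p \<notin> P - Q" using insert Q by auto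
    have r: "1 \<le> real_of_int (\<Prod>P) / W" using False W by (simp add: field_simps)
    have "2 ^ card (insert p P - Q) = 2 * (2::real) ^ card (P - Q)"
      using 1 insert by simp
    also have "\<dots> \<le> 2 * (2 * ?M P)" using Q by simp
    also have "?M P = (real_of_int (\<Prod>P) / W) powr (1/4)" using r by (simp add: max_def)
    also have "2 \<le> real_of_int p powr (1/4)"
    proof -
      have "(2::real) = (2 powr 4) powr (1/4)" by (simp only: powr_powr) simp
      also have "\<dots> = 16 powr (1/4)" by simp
      also have "\<dots> \<le> real_of_int p powr (1/4)" using p by (intro powr_mono2) auto
      finally show ?thesis .
    qed
    hence "2 * (2 * (real_of_int (\<Prod>P) / W) powr (1/4)) \<le>
        2 * (real_of_int p powr (1/4) * (real_of_int (\<Prod>P) / W) powr (1/4))"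
      by (intro mult_left_mono mult_right_mono) auto
    also have "\<dots> = 2 * (real_of_int p * (real_of_int (\<Prod>P) / W)) powr (1/4)"
      using p pos W r by (subst powr_mult) auto
    also have "\<dots> \<le> 2 * ?M (insert p P)"
    proof -
      have 1: "real_of_int (\<Prod>(insert p P)) = real_of_int p * real_of_int (\<Prod>P)"
        using insert.hyps by simp
      have "0 \<le> real_of_int p * (real_of_int (\<Prod>P) / W)" using r p by (intro mult_nonneg_nonneg) auto
      moreover have "real_of_int p * (real_of_int (\<Prod>P) / W) = real_of_int (\<Prod>(insert p P)) / W"
        unfolding 1 by simp
      ultimately show ?thesis by (intro mult_left_mono powr_mono2) (linarith | simp)+
    qed
    finally show ?thesis using Q by (intro exI[of _ Q]) auto
  qed
qed

text \<open>The primes below 16 are left out of \<open>Q\<close> from the start, which also keeps 2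
  out. They lie among the 16 integers of \<open>{0..15}\<close> and cost at most
  \<open>2 ^ 16\<close>; the leading 2 of the preceding lemma makes it
  \<open>2 ^ 17\<close>.\<close>

lemma exists_odd_subset_small_prod:
  fixes P :: "int set" and W Z :: real
  assumes fin: "finite P" and P: "\<And>p. p \<in> P \<Longrightarrow> prime p"
    and W: "1 \<le> W" and Z: "real_of_int (\<Prod>P) \<le> Z"
  shows "\<exists>Q\<subseteq>P. 2 \<notin> Q \<and> real_of_int (\<Prod>Q) \<le> W \<and>
    2 ^ card (P - Q) \<le> 2 ^ 17 * (max 1 (Z / W)) powr (1/4)"
proof -
  define P' where "P' = {p \<in> P. 16 \<le> p}"
  have ge: "p \<ge> 2" if "p \<in> P" for p using P[OF that] prime_ge_2_int by blast
  have "\<exists>Q\<subseteq>P'. real_of_int (\<Prod>Q) \<le> W \<and>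
    2 ^ card (P' - Q) \<le> 2 * (max 1 (real_of_int (\<Prod>P') / W)) powr (1/4)"
    by (intro exists_subset_small_prod) (use fin W in \<open>auto simp: P'_def\<close>)
  then obtain Q where Q: "Q \<subseteq> P'" "real_of_int (\<Prod>Q) \<le> W"
    "2 ^ card (P' - Q) \<le> 2 * (max 1 (real_of_int (\<Prod>P') / W)) powr (1/4)" by blast
  have "P - Q \<subseteq> (P' - Q) \<union> {0..15}" using ge by (force simp: P'_def)
  hence "card (P - Q) \<le> card ((P' - Q) \<union> {0..15})" using fin by (intro card_mono) (auto simp: P'_def)
  also have "\<dots> \<le> card (P' - Q) + 16" by (rule order.trans[OF card_Un_le]) simp
  finally have "(2::real) ^ card (P - Q) \<le> 2 ^ (card (P' - Q) + 16)" by (intro power_increasing) auto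
  also have "\<dots> = 2 ^ 16 * 2 ^ card (P' - Q)" by (simp add: power_add)
  also have "\<dots> \<le> 2 ^ 16 * (2 * (max 1 (real_of_int (\<Prod>P') / W)) powr (1/4))"
    using Q by (intro mult_left_mono) auto
  also have "\<dots> \<le> 2 ^ 16 * (2 * (max 1 (Z / W)) powr (1/4))"
  proof -
    have "\<Prod>P' dvd \<Prod>P" using fin by (intro prod_dvd_prod_subset) (auto simp: P'_def)
    moreover have "\<Prod>P > 0" by (intro prod_pos) (use ge in force)
    ultimately have "\<Prod>P' \<le> \<Prod>P" by (intro zdvd_imp_le) auto
    hence "real_of_int (\<Prod>P') \<le> Z" using Z by linarith
    thus ?thesis using W by (intro mult_left_mono powr_mono2 max.mono divide_right_mono) auto
  qed
  finally show ?thesis using Q by (intro exI[of _ Q]) (auto simp: P'_def)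
qed

lemma card_int_interval_le:
  fixes x y :: real assumes "x \<le> y + 1"
  shows "finite {k::int. x \<le> of_int k \<and> of_int k \<le> y}"
    "real (card {k::int. x \<le> of_int k \<and> of_int k \<le> y}) \<le> y - x + 1"
proof -
  have eq: "{k::int. x \<le> of_int k \<and> of_int k \<le> y} = {\<lceil>x\<rceil>..\<lfloor>y\<rfloor>}"
    by (auto simp: ceiling_le_iff le_floor_iff)
  show "finite {k::int. x \<le> of_int k \<and> of_int k \<le> y}" unfolding eq by simp
  show "real (card {k::int. x \<le> of_int k \<and> of_int k \<le> y}) \<le> y - x + 1"
    unfolding eq using assms by simp linarith
qed

text \<open>Fix one element \<open>(u, v)\<close>. Elements with the same determinant against it
  differ by a multiple of \<open>(u, v)\<close>, because \<open>u\<close> and \<open>v\<close> are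
  coprime, and the lower bound for \<open>\<bar>u\<bar>\<close> leaves only
  \<open>O(1 / c + 1)\<close> of them. The size of the determinants and their divisibility by
  \<open>n\<close> bound the number of values.\<close>

lemma card_pairwise_det_dvd:
  fixes P :: "(int \<times> int) set" and n :: int and Z2 Z3 c :: real
  assumes n: "n > 0" and c: "c > 0" and Z: "Z2 > 0" "Z3 > 0"
    and P: "\<And>u v. (u, v) \<in> P \<Longrightarrow> coprime u v \<and> c * Z2 \<le> \<bar>u\<bar> \<and> \<bar>u\<bar> \<le> Z2 \<and> \<bar>v\<bar> \<le> Z3"
    and det: "\<And>u v u' v'. (u, v) \<in> P \<Longrightarrow> (u', v') \<in> P \<Longrightarrow> n dvd 2 * (u * v' - v * u')"
  shows "finite P" "card P \<le> (8 * Z2 * Z3 / n + 1) * (2 / c + 2)"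
proof -
  have "finite P \<and> card P \<le> (8 * Z2 * Z3 / n + 1) * (2 / c + 2)"
  proof (cases "P = {}")
    case True
    then show ?thesis using assms by simp
  next
    case False
    then obtain u v where uv: "(u, v) \<in> P" by auto
    \<comment> \<open>The second entry separates the points of one line: two of them with the same
      floor differ by less than \<open>\<bar>u\<bar>\<close> in the first coordinate, hence
      coincide.\<close>
    define f where "f = (\<lambda>(u', v'). (2 * (u * v' - v * u') div n, \<lfloor>of_int u' / of_int \<bar>u\<bar> :: real\<rfloor>))"
    have u0: "\<bar>u\<bar> > 0" using P[OF uv] mult_pos_pos[OF c Z(1)] by linarith
    define K where "K = {k::int. - (4 * Z2 * Z3 / n) \<le> k \<and> k \<le> 4 * Z2 * Z3 / n}"
    define L where "L = {k::int. - (1 / c) - 1 \<le> k \<and> k \<le> 1 / c}"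
    have K: "finite K" "real (card K) \<le> 4 * Z2 * Z3 / n - (- (4 * Z2 * Z3 / n)) + 1"
      unfolding K_def by (rule card_int_interval_le; use Z n in simp)+
    have L: "finite L" "real (card L) \<le> 1/c - (- (1/c) - 1) + 1"
      unfolding L_def by (rule card_int_interval_le; use c in simp)+
    have inj: "inj_on f P"
    proof (rule inj_onI, clarify)
      fix a b a' b' assume ab: "(a, b) \<in> P" "(a', b') \<in> P" and eq: "f (a, b) = f (a', b')"
      have "2 * (u * b - v * a) = 2 * (u * b' - v * a')"
        proof -
        have "2 * (u * b - v * a) div n = 2 * (u * b' - v * a') div n" using eq by (simp add: f_def)
        thus ?thesis using dvd_mult_div_cancel[OF det[OF uv ab(1)]] dvd_mult_div_cancel[OF det[OF uv ab(2)]] by simp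
      qed
      hence e: "u * (b - b') = v * (a - a')" by (simp add: algebra_simps)
      have "u dvd v * (a - a')" unfolding e[symmetric] by simp
      hence "u dvd a - a'" using P[OF uv] coprime_dvd_mult_right_iff by blast
      then obtain s where s: "a - a' = u * s" by auto
      have fl: "\<lfloor>of_int a / of_int \<bar>u\<bar> :: real\<rfloor> = \<lfloor>of_int a' / of_int \<bar>u\<bar> :: real\<rfloor>"
        using eq by (simp add: f_def)
      hence "\<bar>of_int a / of_int \<bar>u\<bar> - of_int a' / of_int \<bar>u\<bar>\<bar> < (1::real)" by linarith
      also have "of_int a / of_int \<bar>u\<bar> - of_int a' / of_int \<bar>u\<bar> = (of_int (a - a') / of_int \<bar>u\<bar> :: real)"
        by (simp add: diff_divide_distrib)
      also have "\<bar>\<dots>\<bar> = \<bar>of_int s\<bar>" using u0 by (simp add: s abs_mult)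
      finally have "s = 0" by linarith
      hence "a = a'" using s by simp
      moreover from this e have "b = b'" using u0 by auto
      ultimately show "a = a' \<and> b = b'" by simp
    qed
    have sub: "f ` P \<subseteq> K \<times> L"
    proof (rule image_subsetI)
      fix x assume "x \<in> P"
      then obtain a b where x: "x = (a, b)" and ab: "(a, b) \<in> P" by (cases x) auto
      note P1 = P[OF ab] and P0 = P[OF uv]
      define k where "k = 2 * (u * b - v * a) div n"
      have "of_int (n * k) = (of_int (2 * (u * b - v * a)) :: real)"
        using det[OF uv ab] by (simp add: k_def)
      hence "real_of_int n * \<bar>k\<bar> = \<bar>2 * (of_int u * of_int b - of_int v * of_int a)\<bar>"
      proof -
        have "\<bar>real_of_int n * k\<bar> = \<bar>2 * (of_int u * of_int b - of_int v * of_int a)\<bar>"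
          using \<open>of_int (n * k) = _\<close> by simp
        thus ?thesis using n by (simp add: abs_mult)
      qed
      also have "\<dots> \<le> 2 * (\<bar>of_int u\<bar> * \<bar>of_int b\<bar> + \<bar>of_int v\<bar> * \<bar>of_int a\<bar>)"
      proof -
        have "\<bar>2 * (p - q)\<bar> \<le> 2 * (\<bar>p\<bar> + \<bar>q\<bar>)" for p q :: real
          using abs_triangle_ineq4[of p q] by (simp add: abs_mult)
        from this[of "of_int u * of_int b" "of_int v * of_int a"] show ?thesis by (simp only: abs_mult)
      qed
      also have "\<dots> \<le> 2 * (Z2 * Z3 + Z3 * Z2)"
        using P1 P0 Z by (intro mult_left_mono add_mono mult_mono) auto
      finally have "\<bar>k\<bar> \<le> 4 * Z2 * Z3 / n" using n by (simp add: field_simps)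
      hence kK: "k \<in> K" by (auto simp: K_def)
      define r where "r = (of_int a / of_int \<bar>u\<bar> :: real)"
      have "\<bar>r\<bar> = \<bar>of_int a\<bar> / of_int \<bar>u\<bar>" by (simp add: r_def)
      also have "\<dots> \<le> Z2 / (c * Z2)"
        using P1 P0 Z c by (intro frac_le) auto
      also have "\<dots> = 1 / c" using Z by simp
      finally have "\<lfloor>r\<rfloor> \<in> L" unfolding L_def by simp linarith
      with kK show "f x \<in> K \<times> L" by (auto simp: x f_def k_def r_def)
    qed
    have fin: "finite (K \<times> L)" using K L by auto
    have finP: "finite P" using inj sub fin by (meson finite_imageD finite_subset)
    have "card P = card (f ` P)" using inj by (simp add: card_image)
    also have "\<dots> \<le> card (K \<times> L)" using sub fin by (rule card_mono[rotated])
    also have "\<dots> = card K * card L" by (rule card_cartesian_product)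
    finally have "real (card P) \<le> real (card K) * real (card L)" by (metis of_nat_le_iff of_nat_mult)
    also have "\<dots> \<le> (8 * Z2 * Z3 / n + 1) * (2 / c + 2)"
      using K L c Z n by (intro mult_mono) (auto simp: field_simps)
    finally show ?thesis using finP by simp
  qed
  thus "finite P" "card P \<le> (8 * Z2 * Z3 / n + 1) * (2 / c + 2)" by auto
qed

text \<open>If \<open>p\<close> divides both factors it divides \<open>2 * s\<close>, so
  \<open>p = 2\<close>. Halving both factors then gives an odd sum, so one half is odd and all
  factors 2 of the product except one sit in the other factor. This is the source of the factor 2 in
  the determinant congruences.\<close>

lemma prime_power_dvd_prod_sum:
  fixes p x y s :: int
  assumes p: "prime p" and dvd: "p ^ a dvd x * y" and sum: "x + y = 2 * s" and s: "\<not> p dvd s"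
  shows "p ^ a dvd 2 * x \<or> p ^ a dvd 2 * y"
proof (cases "p dvd x \<and> p dvd y")
  case False
  have "p ^ a dvd y" if "\<not> p dvd x"
    using that dvd p by (metis coprime_commute coprime_dvd_mult_right_iff coprime_power_left_iff prime_imp_coprime)
  moreover have "p ^ a dvd x" if "\<not> p dvd y"
    using that dvd p by (metis coprime_commute coprime_dvd_mult_left_iff coprime_power_left_iff prime_imp_coprime)
  ultimately show ?thesis using False by (meson dvd_mult)
next
  case True
  hence "p dvd 2 * s" using sum by (metis dvd_add)
  hence "p dvd 2" using s p by (simp add: prime_dvd_mult_iff)
  hence p2: "p = 2" using primes_dvd_imp_eq[OF p, of 2] by simp
  obtain x' y' where xy: "x = 2 * x'" "y = 2 * y'" using True p2 by (auto elim!: dvdE)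
  have "x' + y' = s" using sum xy by simp
  hence "odd (x' + y')" using s p2 by simp
  hence "odd x' \<or> odd y'" by auto
  moreover have "2 ^ a dvd 2 * y" if "odd x'"
  proof -
    have "2 ^ a dvd x' * (2 * y)" using dvd xy p2 by (simp add: ac_simps)
    thus ?thesis using that by (metis coprime_dvd_mult_right_iff coprime_left_2_iff_odd coprime_power_left_iff)
  qed
  moreover have "2 ^ a dvd 2 * x" if "odd y'"
  proof -
    have "2 ^ a dvd y' * (2 * x)" using dvd xy p2 by (simp add: ac_simps)
    thus ?thesis using that by (metis coprime_dvd_mult_right_iff coprime_left_2_iff_odd coprime_power_left_iff)
  qed
  ultimately show ?thesis using p2 by auto
qed

lemma dvd_if_prime_powers_dvd:
  fixes n m :: int
  assumes n: "n \<noteq> 0" and "\<And>p. prime p \<Longrightarrow> p dvd n \<Longrightarrow> p ^ multiplicity p n dvd m"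
  shows "n dvd m"
proof (cases "m = 0")
  case False
  show ?thesis
  proof (rule multiplicity_le_imp_dvd[OF n])
    fix p :: int assume p: "prime p"
    show "multiplicity p n \<le> multiplicity p m"
    proof (cases "p dvd n")
      case True
      thus ?thesis using assms(2)[OF p True] False p by (intro multiplicity_geI) auto
    qed (simp add: not_dvd_imp_multiplicity_0)
  qed
qed auto

text \<open>
  Relative to a fixed solution \<open>(u, v)\<close>, the ratio of a solution \<open>(u', v')\<close> agrees with
  \<open>\<plusminus> u / v\<close> modulo each prime power dividing \<open>n\<close> (up to a factor 2); the congruence modulo the
  primes in \<open>Q\<close> fixes the sign there, so the solutions fall into \<open>2 ^ card (primes of n - Q)\<close>
  classes.
\<close>

lemma card_quadratic_solutions_in_class:
  fixes P :: "(int \<times> int) set" and n w2 w3 t :: int and Z2 Z3 c :: real and Q :: "int set"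
  assumes n: "n > 0" and c: "c > 0" and Z: "Z2 > 0" "Z3 > 0"
    and w: "coprime w2 n" "coprime w3 n"
    and Q: "Q \<subseteq> prime_factors n" "2 \<notin> Q"
    and P: "\<And>u v. (u, v) \<in> P \<Longrightarrow> coprime u v \<and> c * Z2 \<le> \<bar>u\<bar> \<and> \<bar>u\<bar> \<le> Z2 \<and> \<bar>v\<bar> \<le> Z3 \<and>
       coprime u n \<and> coprime v n \<and> n dvd w2 * u\<^sup>2 + w3 * v\<^sup>2 \<and> \<Prod>Q dvd u - t * v"
  shows "finite P"
    "card P \<le> 2 ^ card (prime_factors n - Q) * ((8 * Z2 * Z3 / n + 1) * (2 / c + 2))"
proof -
  let ?b = "(8 * Z2 * Z3 / n + 1) * (2 / c + 2)"
  have b0: "?b \<ge> 0" using n c Z by simp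
  have "finite P \<and> card P \<le> 2 ^ card (prime_factors n - Q) * ?b"
  proof (cases "P = {}")
    case True
    then show ?thesis using b0 by simp
  next
    case False
    then obtain u v where uv: "(u, v) \<in> P" by auto
    note P0 = P[OF uv]
    define \<sigma> where "\<sigma> = (\<lambda>(u', v'). {p \<in> prime_factors n - Q. p ^ multiplicity p n dvd 2 * (u * v' - v * u')})"
    have unit: "\<not> p dvd u'" "\<not> p dvd v'" if "(u', v') \<in> P" "p \<in> prime_factors n" for p u' v'
      using P[OF that(1)] that(2) by (metis coprime_common_divisor in_prime_factors_iff not_prime_unit)+
    have alt: "p ^ multiplicity p n dvd 2 * (u * v' - v * u') \<or> p ^ multiplicity p n dvd 2 * (u * v' + v * u')"
      if uv': "(u', v') \<in> P" and p: "p \<in> prime_factors n" for p u' v'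
    proof (rule prime_power_dvd_prod_sum)
      show pp: "prime p" using p by auto
      \<comment> \<open>Eliminating \<open>w3\<close> from the two congruences leaves a difference
        of squares times the unit \<open>w2\<close>.\<close>
      have "n dvd (w2 * u\<^sup>2 + w3 * v\<^sup>2) * v'\<^sup>2 - (w2 * u'\<^sup>2 + w3 * v'\<^sup>2) * v\<^sup>2"
        using P0 P[OF uv'] by (intro dvd_diff dvd_mult2) auto
      also have "\<dots> = w2 * ((u * v' - v * u') * (u * v' + v * u'))" by (simp add: algebra_simps power2_eq_square)
      finally have "n dvd (u * v' - v * u') * (u * v' + v * u')"
        using w by (metis coprime_commute coprime_dvd_mult_right_iff)
      thus "p ^ multiplicity p n dvd (u * v' - v * u') * (u * v' + v * u')"
        using multiplicity_dvd dvd_trans by blast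
      show "\<not> p dvd u * v'" using unit[OF uv p] unit[OF uv' p] pp by (simp add: prime_dvd_mult_iff)
    qed auto
    \<comment> \<open>At \<open>p\<close> in \<open>Q\<close> both ratios equal \<open>t\<close>
      modulo \<open>p\<close>. The other sign would give \<open>p dvd 4 * u * v'\<close>, impossible
      for an odd \<open>p\<close> that divides neither factor.\<close>
    have Qp: "p ^ multiplicity p n dvd 2 * (u * v' - v * u')" if uv': "(u', v') \<in> P" and p: "p \<in> Q" for p u' v'
    proof (rule ccontr)
      assume neg: "\<not> ?thesis"
      have pn: "p \<in> prime_factors n" and pp: "prime p" and p2: "p \<noteq> 2" using p Q by auto
      have finQ: "finite Q" using Q finite_subset by blast
      have "p ^ multiplicity p n dvd 2 * (u * v' + v * u')" using alt[OF uv' pn] neg by blast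
      moreover have "multiplicity p n > 0" using pn n by (simp add: prime_factors_multiplicity)
      ultimately have 1: "p dvd 2 * (u * v' + v * u')" by (metis dvd_power dvd_trans)
      have pQ: "p dvd \<Prod>Q" using dvd_prod_eqI[OF finQ p, of p id] by simp
      have a1: "p dvd u - t * v" and a2: "p dvd u' - t * v'" using P0 P[OF uv'] pQ dvd_trans by blast+
      have "p dvd (u - t * v) * v' - (u' - t * v') * v"
        using dvd_diff[OF dvd_mult2[OF a1] dvd_mult2[OF a2]] .
      hence 2: "p dvd u * v' - v * u'" by (simp add: algebra_simps)
      have "p dvd 2 * (u * v' + v * u') + 2 * (u * v' - v * u')" by (rule dvd_add[OF 1 dvd_mult[OF 2]])
      also have "\<dots> = 2 * (2 * (u * v'))" by (simp add: algebra_simps)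
      finally have "p dvd 2 * (2 * (u * v'))" .
      moreover have "\<not> p dvd 2" using primes_dvd_imp_eq[OF pp, of 2] p2 by auto
      ultimately show False using pp unit[OF uv pn] unit[OF uv' pn] prime_dvd_multD by blast
    qed
    have det: "n dvd 2 * (u1 * v2 - v1 * u2)"
      if 1: "(u1, v1) \<in> P" and 2: "(u2, v2) \<in> P" and eq: "\<sigma> (u1, v1) = \<sigma> (u2, v2)" for u1 v1 u2 v2
    proof (rule dvd_if_prime_powers_dvd)
      show "n \<noteq> 0" using n by simp
      fix p :: int assume p: "prime p" "p dvd n"
      hence pn: "p \<in> prime_factors n" using n by (simp add: in_prime_factors_iff)
      let ?q = "p ^ multiplicity p n"
      have cop: "coprime ?q u" using unit[OF uv pn] p by (simp add: prime_imp_coprime)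
      have "?q dvd u * (2 * (u1 * v2 - v1 * u2))"
      proof (cases "?q dvd 2 * (u * v1 - v * u1) \<and> ?q dvd 2 * (u * v2 - v * u2)")
        case True
        hence d: "?q dvd 2 * (u * v1 - v * u1)" "?q dvd 2 * (u * v2 - v * u2)" by blast+
        have "?q dvd (2 * (u * v2 - v * u2)) * u1 - (2 * (u * v1 - v * u1)) * u2"
          by (rule dvd_diff[OF dvd_mult2[OF d(2)] dvd_mult2[OF d(1)]])
        thus ?thesis by (simp add: algebra_simps)
      next
        case False
        \<comment> \<open>If one of the two signs is not plus, then \<open>p\<close> lies outside
          \<open>Q\<close>, and equality of the values of \<open>\<sigma>\<close> makes both signs
          minus.\<close>
        hence "p \<notin> Q" using Qp 1 2 by blast
        hence "?q dvd 2 * (u * v1 - v * u1) \<longleftrightarrow> ?q dvd 2 * (u * v2 - v * u2)"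
          using eq pn unfolding \<sigma>_def by auto
        hence d: "?q dvd 2 * (u * v1 + v * u1)" "?q dvd 2 * (u * v2 + v * u2)"
          using False alt[OF 1 pn] alt[OF 2 pn] by auto
        have "?q dvd (2 * (u * v2 + v * u2)) * u1 - (2 * (u * v1 + v * u1)) * u2"
          by (rule dvd_diff[OF dvd_mult2[OF d(2)] dvd_mult2[OF d(1)]])
        thus ?thesis by (simp add: algebra_simps)
      qed
      thus "?q dvd 2 * (u1 * v2 - v1 * u2)" using cop coprime_dvd_mult_right_iff by blast
    qed
    define I where "I = Pow (prime_factors n - Q)"
    have finI: "finite I" and cI: "card I = 2 ^ card (prime_factors n - Q)"
      by (auto simp: I_def card_Pow)
    have fib: "finite {z \<in> P. \<sigma> z = A} \<and> card {z \<in> P. \<sigma> z = A} \<le> ?b" for A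
    proof -
      have 1: "coprime u v \<and> c * Z2 \<le> \<bar>u\<bar> \<and> \<bar>u\<bar> \<le> Z2 \<and> \<bar>v\<bar> \<le> Z3" if "(u, v) \<in> {z \<in> P. \<sigma> z = A}" for u v
        using P[of u v] that by blast
      have 2: "n dvd 2 * (u * v' - v * u')"
        if "(u, v) \<in> {z \<in> P. \<sigma> z = A}" "(u', v') \<in> {z \<in> P. \<sigma> z = A}" for u v u' v'
        by (rule det) (use that in auto)
      show ?thesis by (rule conjI[OF card_pairwise_det_dvd[OF n c Z 1 2]])
    qed
    let ?U = "\<Union>A\<in>I. {z \<in> P. \<sigma> z = A}"
    have "\<sigma> z \<in> I" for z unfolding \<sigma>_def I_def by (cases z) blast
    hence sub: "P \<subseteq> ?U" by blast
    have finU: "finite ?U" using finI fib by blast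
    have "card P \<le> card ?U" using finU sub by (rule card_mono)
    also have "\<dots> \<le> (\<Sum>A\<in>I. card {z \<in> P. \<sigma> z = A})" by (rule card_UN_le[OF finI])
    finally have "real (card P) \<le> real (\<Sum>A\<in>I. card {z \<in> P. \<sigma> z = A})" by (rule of_nat_mono)
    also have "\<dots> \<le> (\<Sum>A\<in>I. ?b)" unfolding of_nat_sum by (intro sum_mono conjunct2[OF fib])
    finally show ?thesis using finite_subset[OF sub finU] by (simp add: cI)
  qed
  thus "finite P" "card P \<le> 2 ^ card (prime_factors n - Q) * ?b" by auto
qed

section \<open>Averaging over one coefficient of the congruence\<close>

lemma prod_distinct_primes_dvd:
  fixes n :: int
  assumes "finite Q" and "\<And>p. p \<in> Q \<Longrightarrow> prime p \<and> p dvd n"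
  shows "\<Prod>Q dvd n"
  using assms
proof (induction Q rule: finite_induct)
  case (insert p Q)
  have "coprime p (\<Prod>Q)"
  proof (rule prod_coprime_right)
    fix r assume "r \<in> Q"
    thus "coprime p r" using insert primes_coprime[of p r] by auto
  qed
  thus ?case using insert by (simp add: divides_mult)
qed auto

lemma card_residue_class_interval:
  fixes q r :: int and W :: real
  assumes q: "q > 0" and W: "W \<ge> 0"
  shows "finite {w. \<bar>of_int w\<bar> \<le> W \<and> q dvd r + w}"
    "real (card {w. \<bar>of_int w\<bar> \<le> W \<and> q dvd r + w}) \<le> 2 * W / q + 1"
proof -
  let ?S = "{w::int. \<bar>of_int w\<bar> \<le> W \<and> q dvd r + w}"
  let ?K = "{k::int. (r - W) / q \<le> k \<and> k \<le> (r + W) / q}"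
  have K: "finite ?K" "real (card ?K) \<le> (r + W) / q - (r - W) / q + 1"
    by (rule card_int_interval_le; use q W in \<open>simp add: field_simps\<close>)+
  have inj: "inj_on (\<lambda>w. (r + w) div q) ?S"
    by (rule inj_onI) (metis (no_types, lifting) add_left_imp_eq dvd_mult_div_cancel mem_Collect_eq)
  have sub: "(\<lambda>w. (r + w) div q) ` ?S \<subseteq> ?K"
  proof (rule image_subsetI)
    fix w assume w: "w \<in> ?S"
    then obtain k where k: "r + w = q * k" by auto
    have "real_of_int r + w = q * k" using k by (metis of_int_add of_int_mult)
    hence "of_int k = (r + of_int w) / (q :: real)" using q by (simp add: field_simps)
    moreover have "(r - W) / q \<le> (r + w) / q" "(r + w) / q \<le> (r + W) / q"
      using w q by (auto intro!: divide_right_mono)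
    ultimately show "(r + w) div q \<in> ?K" using k q by simp
  qed
  show "finite ?S" using inj sub K by (meson finite_imageD finite_subset)
  have "card ?S = card ((\<lambda>w. (r + w) div q) ` ?S)" using inj by (simp add: card_image)
  also have "\<dots> \<le> card ?K" using sub K by (intro card_mono) auto
  finally have "real (card ?S) \<le> real (card ?K)" by simp
  also have "\<dots> \<le> 2 * W / q + 1" using K(2) by (simp add: diff_divide_distrib add_divide_distrib)
  finally show "real (card ?S) \<le> 2 * W / q + 1" .
qed

text \<open>
  Counting the coefficients \<open>w\<close> together with a root \<open>t\<close> modulo \<open>q = \<Prod>Q \<le> W\<close> costs only \<open>3 W\<close>,
  since every \<open>t\<close> determines \<open>w\<close> modulo \<open>q\<close>. Choosing \<open>Q\<close> to contain almost all primes of \<open>n\<close>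
  keeps the number of remaining sign choices small, so no equidistribution of quadratic
  characters is needed.
\<close>

lemma card_coefficient_solutions:
  fixes T :: "(int \<times> int \<times> int) set" and n w2 :: int and W Z Z2 Z3 c :: real
  assumes n: "n > 0" and c: "c > 0" and Z: "Z2 > 0" "Z3 > 0" and w2: "coprime w2 n"
    and rad: "real_of_int (\<Prod>(prime_factors n)) \<le> Z"
    and T: "\<And>w u v. (w, u, v) \<in> T \<Longrightarrow> w \<noteq> 0 \<and> \<bar>w\<bar> \<le> W \<and> coprime w n \<and>
       coprime u v \<and> c * Z2 \<le> \<bar>u\<bar> \<and> \<bar>u\<bar> \<le> Z2 \<and> \<bar>v\<bar> \<le> Z3 \<and>
       coprime u n \<and> coprime v n \<and> n dvd w2 * u\<^sup>2 + w * v\<^sup>2"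
  shows "finite T \<and> card T \<le>
    3 * \<bar>W\<bar> * (2 ^ 17 * max 1 (Z / W) powr (1/4)) * ((8 * Z2 * Z3 / n + 1) * (2 / c + 2))"
proof (cases "W < 1")
  \<comment> \<open>A nonzero integer \<open>w\<close> cannot satisfy
    \<open>\<bar>w\<bar> <= W < 1\<close>; the absolute value in the bound keeps it nonnegative for
    negative \<open>W\<close>.\<close>
  case True
  have "T = {}"
  proof (rule ccontr)
    assume "T \<noteq> {}"
    then obtain w u v where "(w, u, v) \<in> T" by auto
    from T[OF this] True show False by linarith
  qed
  thus ?thesis using c Z n by simp
next
  case False
  hence W: "1 \<le> W" by simp
  let ?b = "(8 * Z2 * Z3 / n + 1) * (2 / c + 2)"
  have b0: "?b \<ge> 0" using c Z n by simp
  obtain Q where Q: "Q \<subseteq> prime_factors n" "2 \<notin> Q" "real_of_int (\<Prod>Q) \<le> W"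
    "2 ^ card (prime_factors n - Q) \<le> 2 ^ 17 * max 1 (Z / W) powr (1/4)"
    using exists_odd_subset_small_prod[OF _ _ W rad] by auto
  define q where "q = \<Prod>Q"
  have finQ: "finite Q" using Q finite_subset by blast
  have Qp: "prime p \<and> p dvd n" if "p \<in> Q" for p using that Q by auto
  have q0: "q > 0" unfolding q_def by (intro prod_pos) (use Qp prime_gt_0_int in blast)
  have qn: "q dvd n" unfolding q_def by (rule prod_distinct_primes_dvd[OF finQ Qp])
  define R where "R = (\<lambda>t. {w::int. \<bar>of_int w\<bar> \<le> W \<and> q dvd w2 * t\<^sup>2 + w})"
  define S where "S = (\<lambda>t w. {(u, v). (w, u, v) \<in> T \<and> q dvd u - t * v})"
  have R: "finite (R t)" "real (card (R t)) \<le> 2 * W / q + 1" for t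
    unfolding R_def by (rule card_residue_class_interval[OF q0]; use W in simp)+
  have S: "finite (S t w) \<and> card (S t w) \<le> 2 ^ card (prime_factors n - Q) * ?b" for t w
  proof (cases "S t w = {}")
    case True
    thus ?thesis using b0 by simp
  next
    case False
    hence "coprime w n" using T unfolding S_def by blast
    note * = card_quadratic_solutions_in_class[OF n c Z w2 this Q(1,2), of "S t w" t]
    show ?thesis by (intro conjI *) (use T in \<open>auto simp: S_def q_def\<close>)
  qed
  define I where "I = Sigma {0..<q} R"
  have finI: "finite I" using R by (auto simp: I_def)
  have "real (card I) = (\<Sum>t\<in>{0..<q}. real (card (R t)))" unfolding I_def using R by (subst card_SigmaI) auto
  also have "\<dots> \<le> (\<Sum>t\<in>{0..<q}. 2 * W / q + 1)" by (intro sum_mono R)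
  also have "\<dots> = 2 * W + q" using q0 by (simp add: field_simps)
  also have "\<dots> \<le> 3 * W" using Q by (simp add: q_def)
  finally have cI: "real (card I) \<le> 3 * W" .
  have sub: "T \<subseteq> (\<Union>(t, w)\<in>I. Pair w ` S t w)"
  proof
    fix x assume "x \<in> T"
    then obtain w u v where x: "x = (w, u, v)" and wT: "(w, u, v) \<in> T" by (cases x) auto
    note t = T[OF wT]
    have cop: "coprime v q" using t qn by (metis coprime_divisors dvd_refl)
    then obtain v' where v': "[v * v' = 1] (mod q)" using cong_solve_coprime_int by blast
    define t where "t = (u * v') mod q"
    have "[t * v = u * v' * v] (mod q)" unfolding t_def by (intro cong_mult) (auto simp: cong_def)
    also have "u * v' * v = u * (v * v')" by simp
    also have "[\<dots> = u * 1] (mod q)" by (intro cong_mult v' cong_refl)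
    finally have tv: "q dvd u - t * v" by (metis cong_iff_dvd_diff cong_sym mult.right_neutral)
    have "q dvd w2 * u\<^sup>2 + w * v\<^sup>2" using T[OF wT] qn dvd_trans by blast
    \<comment> \<open>Inserting \<open>u = t * v\<close> modulo \<open>q\<close> turns the quadratic
      form into \<open>v^2 * (w2 * t^2 + w)\<close>, and \<open>v\<close> is a unit: so
      \<open>t\<close> fixes the class of \<open>w\<close>.\<close>
    hence "q dvd (w2 * u\<^sup>2 + w * v\<^sup>2) - (u - t * v) * (w2 * (u + t * v))"
      using dvd_diff[OF _ dvd_mult2[OF tv]] by blast
    also have "\<dots> = v\<^sup>2 * (w2 * t\<^sup>2 + w)" by (simp add: algebra_simps power2_eq_square)
    finally have "q dvd w2 * t\<^sup>2 + w" using cop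
      by (metis coprime_commute coprime_dvd_mult_right_iff coprime_power_right_iff)
    hence "(t, w) \<in> I" using q0 T[OF wT] by (auto simp: I_def R_def t_def)
    moreover have "(u, v) \<in> S t w" using wT tv by (simp add: S_def)
    ultimately show "x \<in> (\<Union>(t, w)\<in>I. Pair w ` S t w)" unfolding x by blast
  qed
  have fin: "finite (\<Union>(t, w)\<in>I. Pair w ` S t w)" using finI S by auto
  have "real (card T) \<le> real (card (\<Union>(t, w)\<in>I. Pair w ` S t w))" using card_mono[OF fin sub] by simp
  also have "\<dots> \<le> real (\<Sum>(t, w)\<in>I. card (Pair w ` S t w))"
    using card_UN_le[OF finI, of "\<lambda>(t, w). Pair w ` S t w"] by (simp add: case_prod_unfold del: of_nat_sum)
  also have "\<dots> \<le> (\<Sum>i\<in>I. 2 ^ card (prime_factors n - Q) * ?b)"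
    unfolding of_nat_sum by (intro sum_mono) (use S in \<open>auto simp: card_image inj_on_def\<close>)
  also have "\<dots> = card I * (2 ^ card (prime_factors n - Q) * ?b)" by simp
  also have "\<dots> \<le> (3 * W) * ((2 ^ 17 * max 1 (Z / W) powr (1/4)) * ?b)"
    by (intro mult_mono cI Q(4) mult_right_mono b0) (use W b0 in auto)
  finally show ?thesis using finite_subset[OF sub fin] W by (simp add: mult.assoc)
qed

text \<open>Primitivity of \<open>y\<close> makes \<open>a\<close>, \<open>b\<close>,
  \<open>g\<close> pairwise coprime, and each is coprime to the coordinate it does not involve. So
  \<open>b^2\<close>, which divides two terms of the equation, divides \<open>x2\<close>, and
  likewise \<open>a^2\<close> divides \<open>x3\<close>. What the reduced coefficients have in
  common is \<open>h\<close>; it is coprime to \<open>x1\<close> by primitivity of \<open>x\<close>,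
  hence divides \<open>z1^2\<close>. The quotient \<open>z1^2 div h\<close> is the modulus of the
  remaining binary congruence, whose coefficients and variables are all units.\<close>

lemma primitive_solution_decomposition:
  fixes x1 x2 x3 y1 y2 y3 :: int
  assumes nz: "y1 \<noteq> 0" "y2 \<noteq> 0" "y3 \<noteq> 0" "x2 \<noteq> 0" "x3 \<noteq> 0"
    and px: "gcd x1 (gcd x2 x3) = 1" and py: "gcd y1 (gcd y2 y3) = 1"
    and eq: "x1 * y1\<^sup>2 + x2 * y2\<^sup>2 + x3 * y3\<^sup>2 = 0"
    and abg: "a = gcd y1 y2" "b = gcd y1 y3" "g = gcd y2 y3"
  obtains w2 w3 z1 z2 z3 h where "h > 0" "x2 = b\<^sup>2 * h * w2" "x3 = a\<^sup>2 * h * w3"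
    "y1 = a * b * z1" "y2 = a * g * z2" "y3 = b * g * z3" "h dvd z1\<^sup>2"
    "coprime z2 z3" "coprime z2 (z1\<^sup>2 div h)" "coprime z3 (z1\<^sup>2 div h)"
    "z1\<^sup>2 div h dvd w2 * z2\<^sup>2 + w3 * z3\<^sup>2" "coprime w2 (z1\<^sup>2 div h)" "coprime w3 (z1\<^sup>2 div h)"
proof -
  have cop3: "coprime u v" if "\<And>d. d dvd u \<Longrightarrow> d dvd v \<Longrightarrow> d dvd y1 \<and> d dvd y2 \<and> d dvd y3" for u v
    by (rule coprimeI) (metis that py gcd_greatest)
  have cop: "coprime a b" "coprime a g" "coprime b g" "coprime a y3" "coprime b y2" "coprime g y1"
    unfolding abg by (rule cop3; auto)+
  have pos: "a > 0" "b > 0" "g > 0" unfolding abg using nz by auto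
  have "a * b dvd y1" using cop(1) by (intro divides_mult) (auto simp: abg)
  then obtain z1 where z1: "y1 = a * b * z1" by auto
  have "a * g dvd y2" using cop(2) by (intro divides_mult) (auto simp: abg)
  then obtain z2 where z2: "y2 = a * g * z2" by auto
  have "b * g dvd y3" using cop(3) by (intro divides_mult) (auto simp: abg)
  then obtain z3 where z3: "y3 = b * g * z3" by auto
  have red: "coprime (u div d) (v div d)" if "d = gcd u v" "d \<noteq> 0" for u v d :: int
    using that by (simp add: div_gcd_coprime)
  have "coprime (y2 div g) (y3 div g)" using red abg pos by simp
  hence "coprime (a * z2) (b * z3)" using pos by (simp add: z2 z3 mult.assoc mult.left_commute[of _ g])
  hence c23: "coprime z2 z3" by simp
  have "coprime (y1 div a) (y2 div a)" using red abg pos by simp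
  hence "coprime (b * z1) (g * z2)" using pos by (simp add: z1 z2 mult.assoc)
  hence c12: "coprime z1 z2" by simp
  have "coprime (y1 div b) (y3 div b)" using red abg pos by simp
  hence "coprime (a * z1) (g * z3)" using pos by (simp add: z1 z3 mult.assoc mult.left_commute[of _ b])
  hence c13: "coprime z1 z3" by simp
  have "b\<^sup>2 dvd x1 * y1\<^sup>2 + x3 * y3\<^sup>2" unfolding z1 z3 by (intro dvd_add) (auto simp: power_mult_distrib)
  moreover have "x2 * y2\<^sup>2 = - (x1 * y1\<^sup>2 + x3 * y3\<^sup>2)" using eq by simp
  ultimately have "b\<^sup>2 dvd x2 * y2\<^sup>2" by (metis dvd_minus_iff)
  hence "b\<^sup>2 dvd x2" using cop(5) coprime_dvd_mult_left_iff[of "b\<^sup>2" "y2\<^sup>2"] by simp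
  then obtain v2 where v2: "x2 = b\<^sup>2 * v2" by auto
  have "a\<^sup>2 dvd x1 * y1\<^sup>2 + x2 * y2\<^sup>2" unfolding z1 z2 by (intro dvd_add) (auto simp: power_mult_distrib)
  moreover have "x3 * y3\<^sup>2 = - (x1 * y1\<^sup>2 + x2 * y2\<^sup>2)" using eq by simp
  ultimately have "a\<^sup>2 dvd x3 * y3\<^sup>2" by (metis dvd_minus_iff)
  hence "a\<^sup>2 dvd x3" using cop(4) coprime_dvd_mult_left_iff[of "a\<^sup>2" "y3\<^sup>2"] by simp
  then obtain v3 where v3: "x3 = a\<^sup>2 * v3" by auto
  define h where "h = gcd v2 v3"
  have h0: "h > 0" using nz v2 by (simp add: h_def)
  obtain w2 where w2: "v2 = h * w2" using h_def by (metis dvd_def gcd_dvd1)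
  obtain w3 where w3: "v3 = h * w3" using h_def by (metis dvd_def gcd_dvd2)
  have "coprime (v2 div h) (v3 div h)" using red h_def h0 by simp
  hence cw: "coprime w2 w3" using h0 by (simp add: w2 w3)
  have "(a * b)\<^sup>2 * (x1 * z1\<^sup>2 + h * (g\<^sup>2 * (w2 * z2\<^sup>2 + w3 * z3\<^sup>2))) = 0"
    using eq unfolding v2 v3 w2 w3 z1 z2 z3 by (simp add: algebra_simps power2_eq_square)
  hence e: "x1 * z1\<^sup>2 = h * (- (g\<^sup>2 * (w2 * z2\<^sup>2 + w3 * z3\<^sup>2)))" using pos by simp
  have "coprime h x1"
  proof (rule coprimeI)
    fix d assume "d dvd h" "d dvd x1"
    moreover from this have "d dvd x2" "d dvd x3" by (auto simp: v2 v3 w2 w3)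
    ultimately show "is_unit d" using px by (metis gcd_greatest)
  qed
  moreover have "h dvd x1 * z1\<^sup>2" unfolding e by simp
  ultimately have hz: "h dvd z1\<^sup>2" using coprime_dvd_mult_right_iff by blast
  define n where "n = z1\<^sup>2 div h"
  have n: "z1\<^sup>2 = h * n" using hz by (simp add: n_def)
  have nz1: "coprime u n" if "coprime u z1" for u
  proof -
    have "coprime u (z1\<^sup>2)" using that by simp
    thus ?thesis unfolding n by simp
  qed
  have "h * (x1 * n) = h * (- (g\<^sup>2 * (w2 * z2\<^sup>2 + w3 * z3\<^sup>2)))"
    unfolding e[symmetric] n by (simp only: ac_simps)
  hence "x1 * n = - (g\<^sup>2 * (w2 * z2\<^sup>2 + w3 * z3\<^sup>2))" using h0 mult_left_cancel[of h] by blast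
  hence "n dvd g\<^sup>2 * (w2 * z2\<^sup>2 + w3 * z3\<^sup>2)" by (metis dvd_minus_iff dvd_triv_right)
  moreover have "coprime g z1" using cop(6) by (simp add: z1)
  hence "coprime n (g\<^sup>2)" using nz1 by (simp add: coprime_commute)
  ultimately have dv: "n dvd w2 * z2\<^sup>2 + w3 * z3\<^sup>2" using coprime_dvd_mult_right_iff by blast
  have cz: "coprime z2 n" "coprime z3 n" using nz1[of z2] nz1[of z3] c12 c13 coprime_commute by blast+
  \<comment> \<open>A common divisor of one coefficient and \<open>n\<close> would divide the other
    coefficient as well, because \<open>z\<close> is a unit modulo \<open>n\<close>; but the two
    coefficients are coprime.\<close>
  have unit: "coprime w n" if "coprime w w'" "coprime z n" "n dvd w * y + w' * z\<^sup>2" for w w' z y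
  proof (rule coprimeI)
    fix d assume d: "d dvd w" "d dvd n"
    have "d dvd (w * y + w' * z\<^sup>2) - w * y" using d that(3) dvd_trans by (intro dvd_diff) auto
    hence "d dvd w' * z\<^sup>2" by simp
    moreover have "coprime d (z\<^sup>2)" using that(2) d(2) by (metis coprime_commute coprime_divisors coprime_power_right_iff dvd_refl)
    ultimately have "d dvd w'" using coprime_dvd_mult_left_iff by blast
    thus "is_unit d" using that(1) d(1) coprime_common_divisor by blast
  qed
  have "coprime w2 n" by (rule unit[OF cw cz(2)]) (use dv in auto)
  moreover have "coprime w3 n" by (rule unit[OF _ cz(1), of w3 w2 "z3\<^sup>2"]) (use dv cw in \<open>auto simp: coprime_commute add.commute\<close>)
  ultimately show thesis using that[of h w2 w3 z1 z2 z3] h0 v2 v3 w2 w3 z1 z2 z3 hz c23 cz dv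
    by (simp add: n_def mult.assoc)
qed

section \<open>Counting solutions with small coefficients\<close>

lemma card_nonzero_interval:
  fixes w :: real assumes "w \<ge> 0"
  shows "finite {k::int. k \<noteq> 0 \<and> \<bar>of_int k\<bar> \<le> w}" "real (card {k::int. k \<noteq> 0 \<and> \<bar>of_int k\<bar> \<le> w}) \<le> 2 * w"
proof -
  let ?m = "\<lfloor>w\<rfloor>"
  have m: "?m \<ge> 0" using assms by simp
  have eq: "{k::int. k \<noteq> 0 \<and> \<bar>of_int k\<bar> \<le> w} = {-?m..-1} \<union> {1..?m}"
    by (auto simp: abs_le_iff le_floor_iff minus_le_iff)
  show "finite {k::int. k \<noteq> 0 \<and> \<bar>of_int k\<bar> \<le> w}" unfolding eq by simp
  have "card ({-?m..-1} \<union> {1..?m}) = card {-?m..-1} + card {1..?m}" by (intro card_Un_disjoint) auto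
  also have "\<dots> = nat ?m + nat ?m" by simp
  finally show "real (card {k::int. k \<noteq> 0 \<and> \<bar>of_int k\<bar> \<le> w}) \<le> 2 * w" unfolding eq using m by simp
qed

text \<open>The three factors on the left count \<open>w2\<close>, \<open>z1\<close> and
  \<open>(w3, z2, z3)\<close>. What matters is that each of the five parameters ends up with the
  summable exponent -5/4. The constant is \<open>108 = 2 * 2 * 3 * 9\<close>.\<close>

lemma fiber_bound_arith:
  fixes a b g s r h X Y c n W Z Z2 Z3 :: real
  assumes ge: "1 \<le> a" "1 \<le> b" "1 \<le> g" "1 \<le> s" "1 \<le> r" and le: "r \<le> s" "g \<le> a" "g \<le> b"
    and h: "h = s * r" and XY: "0 < X" "X \<le> Y" and c: "0 < c" "c \<le> 1"
    and n: "(c * (Y / (a * b)))\<^sup>2 / h \<le> n"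
    and W: "W = X / (a\<^sup>2 * h)" and Z: "Z = Y / (a * b)" "Z2 = Y / (a * g)" "Z3 = Y / (b * g)"
  shows "(2 * (X / (b\<^sup>2 * h))) * (2 * (Y / (a * b * s))) *
      (3 * W * (2 ^ 17 * max 1 (Z / W) powr (1/4)) * ((8 * Z2 * Z3 / n + 1) * (2 / c + 2))) \<le>
    108 * 2 ^ 17 / c\<^sup>2 * (2 / c + 2) * (X powr (7/4) * Y powr (5/4)) *
      (a powr (-5/4) * b powr (-5/4) * g powr (-5/4) * s powr (-5/4) * r powr (-5/4))"
proof -
  have Y0: "0 < Y" using XY by simp
  have h1: "1 \<le> h" unfolding h using ge mult_mono[of 1 s 1 r] by simp
  have pos: "0 < a" "0 < b" "0 < g" "0 < s" "0 < r" "0 < h" using ge h1 by auto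
  have W0: "W > 0" unfolding W using XY pos by simp
  have n0: "0 < (c * (Y / (a * b)))\<^sup>2 / h" using pos Y0 c by simp
  have q: "Z / W = (Y / X) * (a * h / b)" unfolding W Z using pos XY by (simp add: field_simps power2_eq_square)
  have ah: "1 \<le> a * h" using ge h1 mult_mono[of 1 a 1 h] by simp
  have YX: "1 \<le> Y / X" using XY by simp
  have "a * h / b \<le> a * h" using pos ge mult_mono[of 1 b 1 1] by (simp add: divide_le_eq)
  hence "Z / W \<le> (Y / X) * (a * h)" unfolding q using YX by (intro mult_left_mono) auto
  moreover have "1 \<le> (Y / X) * (a * h)" using YX ah mult_mono[of 1 "Y / X" 1 "a * h"] by simp
  ultimately have m: "max 1 (Z / W) \<le> (Y / X) * (a * h)" by simp
  have gg: "g\<^sup>2 \<le> a * b" unfolding power2_eq_square using le ge by (intro mult_mono) auto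
  have cc: "c\<^sup>2 \<le> 1" using c by (simp add: power_le_one)
  have np: "0 < n" using n n0 by linarith
  have "8 * Z2 * Z3 / n + 1 \<le> 8 * Z2 * Z3 / ((c * (Y / (a * b)))\<^sup>2 / h) + 1"
    using n Y0 pos mult_pos_pos[OF np n0] unfolding Z by (intro add_right_mono divide_left_mono) auto
  also have "8 * Z2 * Z3 / ((c * (Y / (a * b)))\<^sup>2 / h) = 8 * (h * a * b / (c\<^sup>2 * g\<^sup>2))"
    unfolding Z using pos Y0 c by (simp add: field_simps power2_eq_square)
  \<comment> \<open>Here \<open>g <= a\<close> and \<open>g <= b\<close> enter, through
    \<open>g^2 <= a * b\<close>: they make the quantity at least 1, so that the additive 1 is
    absorbed.\<close>
  also have "\<dots> + 1 \<le> 9 * (h * a * b / (c\<^sup>2 * g\<^sup>2))"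
  proof -
    have "c\<^sup>2 * g\<^sup>2 \<le> 1 * (a * b)" using cc gg by (intro mult_mono) auto
    also have "\<dots> \<le> h * (a * b)" using h1 pos by (intro mult_right_mono) auto
    finally have "1 \<le> h * a * b / (c\<^sup>2 * g\<^sup>2)" using pos c by (simp add: mult.assoc)
    moreover have "8 * t + 1 \<le> 9 * t" if "1 \<le> t" for t :: real using that by simp
    ultimately show ?thesis by blast
  qed
  finally have e: "8 * Z2 * Z3 / n + 1 \<le> 9 * (h * a * b / (c\<^sup>2 * g\<^sup>2))" .
  let ?Q = "(Y / X) * (a * h)"
  have "(2 * (X / (b\<^sup>2 * h))) * (2 * (Y / (a * b * s))) *
      (3 * W * (2 ^ 17 * max 1 (Z / W) powr (1/4)) * ((8 * Z2 * Z3 / n + 1) * (2 / c + 2))) \<le>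
    (2 * (X / (b\<^sup>2 * h))) * (2 * (Y / (a * b * s))) *
      (3 * W * (2 ^ 17 * ?Q powr (1/4)) * ((9 * (h * a * b / (c\<^sup>2 * g\<^sup>2))) * (2 / c + 2)))"
    using pos XY W0 c Y0 np by (intro mult_mono mult_left_mono powr_mono2 m e) (auto simp: Z intro!: mult_nonneg_nonneg add_nonneg_nonneg)
  also have "\<dots> = 108 * 2 ^ 17 / c\<^sup>2 * (2 / c + 2) * (X\<^sup>2 * Y * ?Q powr (1/4) / (a\<^sup>2 * b\<^sup>2 * g\<^sup>2 * (h * s)))"
  proof -
    have alg: "(2 * (X / (b\<^sup>2 * h))) * (2 * (Y / (a * b * s))) * (3 * (X / (a\<^sup>2 * h)) * (t * p) * ((9 * (h * a * b / (c\<^sup>2 * g\<^sup>2))) * d))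
      = 108 * t / c\<^sup>2 * d * (X\<^sup>2 * Y * p / (a\<^sup>2 * b\<^sup>2 * g\<^sup>2 * (h * s)))" for t p d
      using pos c by (simp add: field_simps power2_eq_square)
    show ?thesis unfolding W by (rule alg)
  qed
  also have "\<dots> \<le> 108 * 2 ^ 17 / c\<^sup>2 * (2 / c + 2) * ((X powr (7/4) * Y powr (5/4)) *
      (a powr (-5/4) * b powr (-5/4) * g powr (-5/4) * (s powr (-5/4) * r powr (-5/4))))"
  proof (rule mult_left_mono)
  have "X\<^sup>2 * Y * ?Q powr (1/4) / (a\<^sup>2 * b\<^sup>2 * g\<^sup>2 * (h * s)) =
      (X powr (7/4) * Y powr (5/4)) * (a powr (-7/4) * b powr (-2) * g powr (-2) * s powr (-7/4) * r powr (-3/4))"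
  proof -
    have e2: "exp (ln x * 2) = x * x" if "x > 0" for x :: real
      using that exp_double[of "ln x"] by (simp add: power2_eq_square mult.commute)
    have "X\<^sup>2 * Y * ?Q powr (1/4) / (a\<^sup>2 * b\<^sup>2 * g\<^sup>2 * (h * s)) =
      exp (2 * ln X + ln Y + (1/4) * (ln Y - ln X + ln a + ln s + ln r) - 2 * ln a - 2 * ln b - 2 * ln g - 2 * ln s - ln r)"
      using pos XY Y0 unfolding h
      by (simp add: exp_add exp_diff powr_def ln_mult ln_div exp_double power2_eq_square mult_ac flip: exp_double)
        (simp add: exp_add exp_diff field_simps e2)
    also have "\<dots> = (X powr (7/4) * Y powr (5/4)) * (a powr (-7/4) * b powr (-2) * g powr (-2) * s powr (-7/4) * r powr (-3/4))"
      using pos XY Y0 unfolding powr_def by (simp add: field_simps flip: exp_add)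
    finally show ?thesis .
  qed
  also have "\<dots> \<le> (X powr (7/4) * Y powr (5/4)) *
      (a powr (-5/4) * b powr (-5/4) * g powr (-5/4) * (s powr (-5/4) * r powr (-5/4)))"
  proof -
    \<comment> \<open>The exponent of \<open>r\<close> alone would not be summable;
      \<open>r <= s\<close> moves half a power from \<open>s\<close> to \<open>r\<close>.\<close>
    have sr: "s powr (-7/4) * r powr (-3/4) \<le> s powr (-5/4) * r powr (-5/4)"
    proof -
      have "s powr (-7/4) * r powr (-3/4) = s powr (-7/4) * (r powr (1/2) * r powr (-5/4))"
        by (simp flip: powr_add)
      also have "\<dots> \<le> s powr (-7/4) * (s powr (1/2) * r powr (-5/4))"
        using le pos by (intro mult_left_mono mult_right_mono powr_mono2) auto
      also have "\<dots> = (s powr (-7/4) * s powr (1/2)) * r powr (-5/4)" by simp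
      also have "s powr (-7/4) * s powr (1/2) = s powr (-5/4)" by (simp flip: powr_add)
      finally show ?thesis .
    qed
    have "a powr (-7/4) * b powr (-2) * g powr (-2) * (s powr (-7/4) * r powr (-3/4)) \<le>
      a powr (-5/4) * b powr (-5/4) * g powr (-5/4) * (s powr (-5/4) * r powr (-5/4))"
      using ge by (intro mult_mono sr powr_mono) auto
    thus ?thesis by (intro mult_left_mono) (auto simp: mult.assoc)
  qed
  finally show "X\<^sup>2 * Y * ?Q powr (1/4) / (a\<^sup>2 * b\<^sup>2 * g\<^sup>2 * (h * s)) \<le> (X powr (7/4) * Y powr (5/4)) *
      (a powr (-5/4) * b powr (-5/4) * g powr (-5/4) * (s powr (-5/4) * r powr (-5/4)))" .
  qed (use c in simp)
  finally show ?thesis by (simp only: mult.assoc)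
qed

definition primitive_solutions :: "real \<Rightarrow> real \<Rightarrow> real \<Rightarrow> (int \<times> int \<times> int \<times> int \<times> int \<times> int) set" where
  "primitive_solutions c X Y = {(x1, x2, x3, y1, y2, y3).
     x1 \<noteq> 0 \<and> x2 \<noteq> 0 \<and> x3 \<noteq> 0 \<and> gcd x1 (gcd x2 x3) = 1 \<and> gcd y1 (gcd y2 y3) = 1 \<and>
     \<bar>real_of_int x1\<bar> \<le> X \<and> \<bar>real_of_int x2\<bar> \<le> X \<and> \<bar>real_of_int x3\<bar> \<le> X \<and>
     c * Y \<le> \<bar>real_of_int y1\<bar> \<and> \<bar>real_of_int y1\<bar> \<le> Y \<and> c * Y \<le> \<bar>real_of_int y2\<bar> \<and> \<bar>real_of_int y2\<bar> \<le> Y \<and> c * Y \<le> \<bar>real_of_int y3\<bar> \<and> \<bar>real_of_int y3\<bar> \<le> Y \<and>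
     x1 * y1\<^sup>2 + x2 * y2\<^sup>2 + x3 * y3\<^sup>2 = 0}"

text \<open>
  Here \<open>a, b, g\<close> are the gcds of the pairs \<open>(y1, y2)\<close>, \<open>(y1, y3)\<close>, \<open>(y2, y3)\<close>. The common factor \<open>h\<close> of
  the reduced coefficients divides \<open>z1\<^sup>2\<close>, and \<open>s = gcd z1 h\<close> satisfies \<open>h dvd s\<^sup>2\<close>, so that \<open>z1\<close> runs
  over multiples of an integer of size at least \<open>sqrt h\<close>.
\<close>

definition decomposed_solutions ::
    "real \<Rightarrow> real \<Rightarrow> real \<Rightarrow> int \<Rightarrow> int \<Rightarrow> int \<Rightarrow> int \<Rightarrow> int \<Rightarrow> (int \<times> int \<times> int \<times> int \<times> int \<times> int) set" where
  "decomposed_solutions c X Y a b g s r = {(x1, x2, x3, y1, y2, y3) \<in> primitive_solutions c X Y.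
     \<exists>w2 w3 z1 z2 z3 h. h = s * r \<and> s = gcd z1 h \<and> h dvd z1\<^sup>2 \<and>
       x2 = b\<^sup>2 * h * w2 \<and> x3 = a\<^sup>2 * h * w3 \<and> y1 = a * b * z1 \<and> y2 = a * g * z2 \<and> y3 = b * g * z3 \<and>
       coprime z2 z3 \<and> coprime z2 (z1\<^sup>2 div h) \<and> coprime z3 (z1\<^sup>2 div h) \<and>
       z1\<^sup>2 div h dvd w2 * z2\<^sup>2 + w3 * z3\<^sup>2 \<and> coprime w2 (z1\<^sup>2 div h) \<and> coprime w3 (z1\<^sup>2 div h)}"

text \<open>\<open>n\<close> itself can be as large as \<open>z^2\<close>, but its radical divides
  \<open>z\<close>. Only the radical competes with the range \<open>W\<close> of the coefficient, so
  that the loss is a power of \<open>Y / X\<close>, up to common factors, and not of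
  \<open>Y^2 / X\<close>.\<close>

lemma prod_prime_factors_le:
  fixes n z :: int
  assumes "n dvd z\<^sup>2" "z \<noteq> 0"
  shows "\<Prod>(prime_factors n) \<le> \<bar>z\<bar>"
proof -
  have "p dvd z" if "p \<in> prime_factors n" for p
    using that assms by (meson dvd_trans in_prime_factors_iff prime_dvd_power)
  hence "\<Prod>(prime_factors n) dvd z" by (intro prod_distinct_primes_dvd) auto
  from dvd_imp_le_int[OF assms(2) this] show ?thesis by simp
qed

text \<open>The coordinate \<open>x1\<close> is determined by the others. The pair
  \<open>(w2, z1)\<close> is counted trivially, \<open>z1\<close> through the multiples of
  \<open>s\<close>; it fixes the modulus \<open>z1^2 div h\<close>, and then
  \<open>card_coefficient_solutions\<close> counts \<open>(w3, z2, z3)\<close>.\<close>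

lemma card_decomposed_solutions:
  fixes a b g s r :: int and c X Y :: real
  assumes ge: "1 \<le> a" "1 \<le> b" "1 \<le> g" "1 \<le> s" "1 \<le> r" and le: "r \<le> s" "g \<le> a" "g \<le> b"
    and XY: "0 < X" "X \<le> Y" and c: "0 < c" "c \<le> 1"
  shows "finite (decomposed_solutions c X Y a b g s r) \<and>
    card (decomposed_solutions c X Y a b g s r) \<le>
     108 * 2 ^ 17 / c\<^sup>2 * (2 / c + 2) * (X powr (7/4) * Y powr (5/4)) *
      (a powr (-5/4) * b powr (-5/4) * g powr (-5/4) * s powr (-5/4) * r powr (-5/4))"
    (is "finite ?D \<and> _ \<le> ?bound")
proof -
  define h where "h = s * r"
  have Y0: "0 < Y" using XY by simp
  have h1: "1 \<le> h" unfolding h_def using ge mult_mono[of 1 s 1 r] by simp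
  have pos: "0 < a" "0 < b" "0 < g" "0 < s" "0 < r" "0 < h" using ge h1 by auto
  define Z where "Z = Y / (a * b)"
  define Z2 where "Z2 = Y / (a * g)"
  define Z3 where "Z3 = Y / (b * g)"
  define W where "W = X / (a\<^sup>2 * h)"
  define W2 where "W2 = X / (b\<^sup>2 * h)"
  have Zpos: "Z > 0" "Z2 > 0" "Z3 > 0" "W > 0" "W2 > 0"
    unfolding Z_def Z2_def Z3_def W_def W2_def using pos Y0 XY by auto
  define I where "I = {(w2, z1). w2 \<noteq> 0 \<and> \<bar>real_of_int w2\<bar> \<le> W2 \<and> z1 \<noteq> 0 \<and> s dvd z1 \<and> h dvd z1\<^sup>2 \<and>
     c * Z \<le> \<bar>real_of_int z1\<bar> \<and> \<bar>real_of_int z1\<bar> \<le> Z \<and> coprime w2 (z1\<^sup>2 div h)}"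
  define T where "T = (\<lambda>(w2, z1). {(w, u, v). w \<noteq> 0 \<and> \<bar>real_of_int w\<bar> \<le> W \<and> coprime w (z1\<^sup>2 div h) \<and>
       coprime u v \<and> c * Z2 \<le> \<bar>real_of_int u\<bar> \<and> \<bar>real_of_int u\<bar> \<le> Z2 \<and> \<bar>real_of_int v\<bar> \<le> Z3 \<and>
       coprime u (z1\<^sup>2 div h) \<and> coprime v (z1\<^sup>2 div h) \<and> z1\<^sup>2 div h dvd w2 * u\<^sup>2 + w * v\<^sup>2})"
  define bT where "bT = 3 * W * (2 ^ 17 * max 1 (Z / W) powr (1/4)) * ((8 * Z2 * Z3 / ((c * Z)\<^sup>2 / h) + 1) * (2 / c + 2))"
  have bT0: "bT \<ge> 0" unfolding bT_def using Zpos c pos by simp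
  have I: "finite I" "real (card I) \<le> (2 * W2) * (2 * (Z / s))"
  proof -
    let ?A = "{k::int. k \<noteq> 0 \<and> \<bar>of_int k\<bar> \<le> W2}" and ?B = "{k::int. k \<noteq> 0 \<and> \<bar>of_int k\<bar> \<le> Z / s}"
    have A: "finite ?A" "real (card ?A) \<le> 2 * W2" by (rule card_nonzero_interval; use Zpos in simp)+
    have B: "finite ?B" "real (card ?B) \<le> 2 * (Z / s)" by (rule card_nonzero_interval; use Zpos pos in simp)+
    have sub: "I \<subseteq> (\<lambda>(w, k). (w, s * k)) ` (?A \<times> ?B)"
    proof
      fix x assume "x \<in> I"
      then obtain w z where xx: "x = (w, z)" and wz: "w \<noteq> 0" "\<bar>real_of_int w\<bar> \<le> W2" "z \<noteq> 0" "s dvd z" "\<bar>real_of_int z\<bar> \<le> Z"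
        unfolding I_def by blast
      obtain k where k: "z = s * k" using wz by blast
      have "real_of_int s * \<bar>real_of_int k\<bar> \<le> Z" using wz(5) pos by (simp add: k abs_mult)
      hence "\<bar>real_of_int k\<bar> \<le> Z / s" using pos by (simp add: field_simps)
      moreover have "k \<noteq> 0" using wz k by auto
      ultimately have "(w, k) \<in> ?A \<times> ?B" using wz by blast
      thus "x \<in> (\<lambda>(w, k). (w, s * k)) ` (?A \<times> ?B)" unfolding xx k by force
    qed
    have fin: "finite ((\<lambda>(w, k). (w, s * k)) ` (?A \<times> ?B))" using A B by blast
    show "finite I" using sub fin by (rule finite_subset)
    have "card I \<le> card ((\<lambda>(w, k). (w, s * k)) ` (?A \<times> ?B))" using fin sub by (rule card_mono)
    also have "\<dots> \<le> card (?A \<times> ?B)" using A B by (intro card_image_le) blast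
    also have "\<dots> = card ?A * card ?B" by (rule card_cartesian_product)
    finally have "real (card I) \<le> real (card ?A * card ?B)" by (rule of_nat_mono)
    also have "\<dots> = real (card ?A) * real (card ?B)" by (rule of_nat_mult)
    also have "\<dots> \<le> (2 * W2) * (2 * (Z / s))"
      by (rule mult_mono[OF A(2) B(2)]) (use Zpos in simp_all)
    finally show "real (card I) \<le> (2 * W2) * (2 * (Z / s))" .
  qed
  have T: "finite (T i) \<and> card (T i) \<le> bT" if i: "i \<in> I" for i
  proof -
    obtain w2 z1 where ii: "i = (w2, z1)" by (cases i) auto
    have i': "z1 \<noteq> 0" "h dvd z1\<^sup>2" "c * Z \<le> \<bar>real_of_int z1\<bar>" "\<bar>real_of_int z1\<bar> \<le> Z" "coprime w2 (z1\<^sup>2 div h)"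
      using i unfolding ii I_def by auto
    define n where "n = z1\<^sup>2 div h"
    have zn: "z1\<^sup>2 = h * n" using i' by (simp add: n_def)
    have "h * n > 0" using i' unfolding zn[symmetric] by simp
    hence n0: "n > 0" using pos by (simp add: zero_less_mult_iff)
    have "n dvd z1\<^sup>2" unfolding zn by simp
    hence "\<Prod>(prime_factors n) \<le> \<bar>z1\<bar>" using i' by (intro prod_prime_factors_le)
    hence rad: "real_of_int (\<Prod>(prime_factors n)) \<le> Z" using i' by linarith
    have "(c * Z)\<^sup>2 \<le> \<bar>real_of_int z1\<bar>\<^sup>2" using i' c Zpos by (intro power_mono) auto
    also have "\<dots> = real_of_int (z1\<^sup>2)" by simp
    also have "\<dots> = h * n" unfolding zn by simp
    finally have nn: "(c * Z)\<^sup>2 / h \<le> n" using pos by (simp add: field_simps)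
    have cz: "(c * Z)\<^sup>2 / h > 0" using c Zpos pos by simp
    have Ti: "w \<noteq> 0 \<and> \<bar>real_of_int w\<bar> \<le> W \<and> coprime w n \<and> coprime u v \<and>
        c * Z2 \<le> \<bar>real_of_int u\<bar> \<and> \<bar>real_of_int u\<bar> \<le> Z2 \<and> \<bar>real_of_int v\<bar> \<le> Z3 \<and>
        coprime u n \<and> coprime v n \<and> n dvd w2 * u\<^sup>2 + w * v\<^sup>2" if "(w, u, v) \<in> T i" for w u v
      using that unfolding T_def ii n_def by simp
    have "finite (T i) \<and> card (T i) \<le>
        3 * \<bar>W\<bar> * (2 ^ 17 * max 1 (Z / W) powr (1/4)) * ((8 * Z2 * Z3 / n + 1) * (2 / c + 2))"
      by (rule card_coefficient_solutions[OF n0 c(1) Zpos(2,3) i'(5)[folded n_def] rad Ti])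
    \<comment> \<open>Since \<open>z1\<close> is at least \<open>c * Z\<close> in absolute value,
      \<open>n\<close> may be replaced by a lower bound that is the same for all
      \<open>i\<close>.\<close>
    moreover have "3 * \<bar>W\<bar> * (2 ^ 17 * max 1 (Z / W) powr (1/4)) * ((8 * Z2 * Z3 / n + 1) * (2 / c + 2)) \<le> bT"
    proof -
      have "8 * Z2 * Z3 / n \<le> 8 * Z2 * Z3 / ((c * Z)\<^sup>2 / h)"
      proof (rule divide_left_mono[OF nn])
        show "0 \<le> 8 * Z2 * Z3" using Zpos by (intro mult_nonneg_nonneg) linarith+
        show "0 < real_of_int n * ((c * Z)\<^sup>2 / h)" using n0 cz by (intro mult_pos_pos) linarith+
      qed
      hence "(8 * Z2 * Z3 / n + 1) * (2 / c + 2) \<le> (8 * Z2 * Z3 / ((c * Z)\<^sup>2 / h) + 1) * (2 / c + 2)"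
        by (rule mult_right_mono[OF add_right_mono]) (use c in simp)
      moreover have absW: "\<bar>W\<bar> = W" using Zpos(4) by (rule abs_of_pos)
      have "0 \<le> 3 * W" using Zpos(4) by simp
      hence "0 \<le> 3 * W * (2 ^ 17 * max 1 (Z / W) powr (1/4))"
        by (rule mult_nonneg_nonneg) simp
      ultimately show ?thesis unfolding bT_def absW by (rule mult_left_mono)
    qed
    ultimately show ?thesis by (metis (no_types) order.trans)
  qed
  define \<Phi> where "\<Phi> = (\<lambda>((w2, z1), (w3, z2, z3)).
     (- ((b\<^sup>2 * h * w2) * (a * g * z2)\<^sup>2 + (a\<^sup>2 * h * w3) * (b * g * z3)\<^sup>2) div (a * b * z1)\<^sup>2,
      b\<^sup>2 * h * w2, a\<^sup>2 * h * w3, a * b * z1, a * g * z2, b * g * z3))"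
  have sub: "?D \<subseteq> \<Phi> ` (Sigma I T)"
  proof
    fix t assume t: "t \<in> ?D"
    obtain x1 x2 x3 y1 y2 y3 where tt: "t = (x1, x2, x3, y1, y2, y3)" by (cases t) auto
    obtain w2 w3 z1 z2 z3 where d: "s = gcd z1 h" "h dvd z1\<^sup>2"
       "x2 = b\<^sup>2 * h * w2" "x3 = a\<^sup>2 * h * w3" "y1 = a * b * z1" "y2 = a * g * z2" "y3 = b * g * z3"
       "coprime z2 z3" "coprime z2 (z1\<^sup>2 div h)" "coprime z3 (z1\<^sup>2 div h)"
       "z1\<^sup>2 div h dvd w2 * z2\<^sup>2 + w3 * z3\<^sup>2" "coprime w2 (z1\<^sup>2 div h)" "coprime w3 (z1\<^sup>2 div h)"
      using t unfolding tt decomposed_solutions_def h_def by blast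
    have p: "x2 \<noteq> 0" "x3 \<noteq> 0" "\<bar>real_of_int x2\<bar> \<le> X" "\<bar>real_of_int x3\<bar> \<le> X"
      "c * Y \<le> \<bar>real_of_int y1\<bar>" "\<bar>real_of_int y1\<bar> \<le> Y" "c * Y \<le> \<bar>real_of_int y2\<bar>" "\<bar>real_of_int y2\<bar> \<le> Y"
      "\<bar>real_of_int y3\<bar> \<le> Y"  "x1 * y1\<^sup>2 + x2 * y2\<^sup>2 + x3 * y3\<^sup>2 = 0"
      using t unfolding tt decomposed_solutions_def primitive_solutions_def by auto
    have scale: "\<bar>real_of_int w\<bar> = \<bar>real_of_int x\<bar> / real_of_int k" if "x = k * w" "k > 0" for x w k :: int
      using that by (simp add: abs_mult)
    have k0: "b\<^sup>2 * h > 0" "a\<^sup>2 * h > 0" "a * b > 0" "a * g > 0" "b * g > 0" using pos by auto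
    note sc = scale[OF d(3) k0(1)] scale[OF d(4) k0(2)] scale[OF d(5) k0(3)] scale[OF d(6) k0(4)] scale[OF d(7) k0(5)]
    have k0': "real_of_int (b\<^sup>2 * h) > 0" "real_of_int (a\<^sup>2 * h) > 0" "real_of_int (a * b) > 0" "real_of_int (a * g) > 0" "real_of_int (b * g) > 0"
      using k0 by (simp_all only: of_int_0_less_iff)
    have dm: "u / k \<le> v / k" if "u \<le> v" "k > 0" for u v k :: real using that by (simp add: divide_right_mono)
    have bd: "\<bar>real_of_int w2\<bar> \<le> W2" "\<bar>real_of_int w3\<bar> \<le> W" "\<bar>real_of_int z1\<bar> \<le> Z" "c * Z \<le> \<bar>real_of_int z1\<bar>"
        "\<bar>real_of_int z2\<bar> \<le> Z2" "c * Z2 \<le> \<bar>real_of_int z2\<bar>" "\<bar>real_of_int z3\<bar> \<le> Z3"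
      using dm[OF p(3) k0'(1)] dm[OF p(4) k0'(2)] dm[OF p(5) k0'(3)] dm[OF p(6) k0'(3)] dm[OF p(7) k0'(4)] dm[OF p(8) k0'(4)]
        dm[OF p(9) k0'(5)]
      unfolding sc W2_def W_def Z_def Z2_def Z3_def by simp_all
    have z10: "z1 \<noteq> 0" using bd(4) mult_pos_pos[OF c(1) Zpos(1)] by auto
    have w0: "w2 \<noteq> 0" "w3 \<noteq> 0" using p d by auto
    have "(w2, z1) \<in> I" unfolding I_def using bd z10 w0 d(1,2,12) by auto
    moreover have "(w3, z2, z3) \<in> T (w2, z1)" unfolding T_def using bd w0 d by auto
    moreover have "t = \<Phi> ((w2, z1), (w3, z2, z3))"
    proof -
      have y0: "y1\<^sup>2 \<noteq> 0" using z10 d(5) pos by simp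
      have "- (x2 * y2\<^sup>2 + x3 * y3\<^sup>2) = x1 * y1\<^sup>2" using p(10) by linarith
      hence "x1 = - (x2 * y2\<^sup>2 + x3 * y3\<^sup>2) div y1\<^sup>2" using y0 by simp
      thus ?thesis unfolding tt \<Phi>_def d(3-7) by simp
    qed
    ultimately show "t \<in> \<Phi> ` (Sigma I T)" by blast
  qed
  have fin: "finite (Sigma I T)" using I T by blast
  have "card ?D \<le> card (\<Phi> ` (Sigma I T))" using fin sub by (intro card_mono) auto
  also have "\<dots> \<le> card (Sigma I T)" using fin by (rule card_image_le)
  also have "\<dots> = (\<Sum>i\<in>I. card (T i))" using I T by (intro card_SigmaI) auto
  finally have "real (card ?D) \<le> real (\<Sum>i\<in>I. card (T i))" by (rule of_nat_mono)
  also have "\<dots> = (\<Sum>i\<in>I. real (card (T i)))" by (rule of_nat_sum)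
  also have "\<dots> \<le> (\<Sum>i\<in>I. bT)" by (intro sum_mono) (use T in auto)
  also have "\<dots> = card I * bT" by simp
  also have "\<dots> \<le> (2 * W2) * (2 * (Z / s)) * bT" using bT0 by (intro mult_right_mono I)
  also have "\<dots> = (2 * (X / ((real_of_int b)\<^sup>2 * real_of_int h))) * (2 * (Y / (real_of_int a * real_of_int b * real_of_int s))) * bT"
    unfolding W2_def Z_def by simp
  also have "\<dots> \<le> ?bound"
  proof -
    have ge': "1 \<le> real_of_int a" "1 \<le> real_of_int b" "1 \<le> real_of_int g" "1 \<le> real_of_int s" "1 \<le> real_of_int r"
      using ge by linarith+
    have le': "real_of_int r \<le> real_of_int s" "real_of_int g \<le> real_of_int a" "real_of_int g \<le> real_of_int b"
      using le by linarith+
    have h': "real_of_int h = real_of_int s * real_of_int r" by (simp add: h_def)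
    have W': "W = X / ((real_of_int a)\<^sup>2 * real_of_int h)" by (simp add: W_def)
    have Z': "Z = Y / (real_of_int a * real_of_int b)" "Z2 = Y / (real_of_int a * real_of_int g)"
      "Z3 = Y / (real_of_int b * real_of_int g)" by (simp_all add: Z_def Z2_def Z3_def)
    have n': "(c * (Y / (real_of_int a * real_of_int b)))\<^sup>2 / real_of_int h \<le> (c * Z)\<^sup>2 / h"
      unfolding Z'(1) by (rule order.refl)
    show ?thesis unfolding bT_def by (rule fiber_bound_arith[OF ge' le' h' XY c n' W' Z'])
  qed
  finally show ?thesis using finite_subset[OF sub finite_imageI[OF fin]] by blast
qed

lemma p_series_bound:
  obtains S :: real where "S \<ge> 1" "\<And>M::int. (\<Sum>k=1..M. real_of_int k powr (-5/4)) \<le> S"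
proof
  define S where "S = (\<Sum>n. real n powr (-5/4))"
  have sm: "summable (\<lambda>n. real n powr (-5/4))" by (subst summable_real_powr_iff) simp
  have le: "(\<Sum>k=1..M. real_of_int k powr (-5/4)) \<le> S" for M :: int
  proof -
    have "(\<Sum>k=1..M. real_of_int k powr (-5/4)) = (\<Sum>n\<in>{1..nat M}. real n powr (-5/4))"
      by (rule sum.reindex_bij_witness[of _ int nat]) auto
    also have "\<dots> \<le> S" unfolding S_def by (rule sum_le_suminf[OF sm]) auto
    finally show ?thesis .
  qed
  show "(\<Sum>k=1..M. real_of_int k powr (-5/4)) \<le> max 1 S" for M :: int using le[of M] by simp
  show "max 1 S \<ge> 1" by simp
qed

lemma finite_primitive_solutions: "finite (primitive_solutions c X Y)"
proof -
  let ?A = "{-\<lfloor>X\<rfloor>..\<lfloor>X\<rfloor>}" and ?B = "{-\<lfloor>Y\<rfloor>..\<lfloor>Y\<rfloor>}"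
  have *: "k \<in> {-\<lfloor>w\<rfloor>..\<lfloor>w\<rfloor>}" if "\<bar>real_of_int k\<bar> \<le> w" for k w
    using that by (auto simp: abs_le_iff le_floor_iff minus_le_iff)
  have "primitive_solutions c X Y \<subseteq> ?A \<times> ?A \<times> ?A \<times> ?B \<times> ?B \<times> ?B"
    unfolding primitive_solutions_def using * by blast
  thus ?thesis by (rule finite_subset) blast
qed

text \<open>By Bezout \<open>s = u * z1 + v * h\<close>, and \<open>h\<close> divides
  \<open>z1^2\<close>, so \<open>h\<close> divides \<open>s^2\<close>. With \<open>h = s * r\<close>
  this says \<open>r dvd s\<close>, whence \<open>r <= s\<close>; and \<open>s\<close> divides
  \<open>y1\<close>, which bounds it by \<open>Y\<close>.\<close>

lemma mem_decomposed_solutions: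
  assumes t: "(x1, x2, x3, y1, y2, y3) \<in> primitive_solutions c X Y" and c: "0 < c" and Y: "0 < Y"
  obtains s r where "1 \<le> r" "r \<le> s" "real_of_int s \<le> Y"
    "(x1, x2, x3, y1, y2, y3) \<in> decomposed_solutions c X Y (gcd y1 y2) (gcd y1 y3) (gcd y2 y3) s r"
proof -
  note p = t[unfolded primitive_solutions_def, simplified]
  have cY: "c * Y > 0" using c Y by simp
  have nz: "y1 \<noteq> 0" "y2 \<noteq> 0" "y3 \<noteq> 0" using p cY by auto
  have x: "x2 \<noteq> 0" "x3 \<noteq> 0" "gcd x1 (gcd x2 x3) = 1" "gcd y1 (gcd y2 y3) = 1"
    "x1 * y1\<^sup>2 + x2 * y2\<^sup>2 + x3 * y3\<^sup>2 = 0" using p by auto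
  obtain w2 w3 z1 z2 z3 h where d: "h > 0" "x2 = (gcd y1 y3)\<^sup>2 * h * w2" "x3 = (gcd y1 y2)\<^sup>2 * h * w3"
    "y1 = gcd y1 y2 * gcd y1 y3 * z1" "y2 = gcd y1 y2 * gcd y2 y3 * z2" "y3 = gcd y1 y3 * gcd y2 y3 * z3"
    "h dvd z1\<^sup>2" "coprime z2 z3" "coprime z2 (z1\<^sup>2 div h)" "coprime z3 (z1\<^sup>2 div h)"
    "z1\<^sup>2 div h dvd w2 * z2\<^sup>2 + w3 * z3\<^sup>2" "coprime w2 (z1\<^sup>2 div h)" "coprime w3 (z1\<^sup>2 div h)"
    using primitive_solution_decomposition[OF nz x refl refl refl] by metis
  define s where "s = gcd z1 h"
  define r where "r = h div s"
  have s0: "s > 0" using d(1) by (simp add: s_def)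
  have hr: "h = s * r" unfolding r_def s_def by simp
  have r1: "1 \<le> r" using d(1) s0 hr by (simp add: zero_less_mult_iff int_one_le_iff_zero_less)
  obtain u v where uv: "s = u * z1 + v * h" unfolding s_def by (metis bezout_int)
  have "s\<^sup>2 = u\<^sup>2 * z1\<^sup>2 + h * (2 * u * v * z1 + v\<^sup>2 * h)" unfolding uv by (simp add: algebra_simps power2_eq_square)
  hence "h dvd s\<^sup>2" using d(7) by simp
  then obtain k where "s\<^sup>2 = h * k" by auto
  hence "s * s = s * (r * k)" by (simp add: hr power2_eq_square mult.assoc)
  hence "s = r * k" using s0 by simp
  hence "r \<le> s" using s0 by (intro zdvd_imp_le) auto
  have "s dvd y1" using d(4) unfolding s_def by (metis dvd_mult gcd_dvd1 dvd_trans)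
  hence "s \<le> \<bar>y1\<bar>" using nz(1) dvd_imp_le_int[of y1 s] s0 by simp
  hence sY: "real_of_int s \<le> Y" using p by linarith
  have "(x1, x2, x3, y1, y2, y3) \<in> decomposed_solutions c X Y (gcd y1 y2) (gcd y1 y3) (gcd y2 y3) s r"
    unfolding decomposed_solutions_def using t d hr s_def by blast
  with that r1 \<open>r \<le> s\<close> sY show thesis by blast
qed

text \<open>Enlarging the index set to all five-tuples makes the majorant a product, so the total is
  the fifth power of a partial sum of one convergent series, bounded uniformly in
  \<open>Y\<close>.\<close>

lemma card_primitive_solutions_min_gcd:
  assumes c: "0 < c" "c \<le> 1"
  obtains K where "\<And>X Y. 0 < X \<Longrightarrow> X \<le> Y \<Longrightarrow>
    card {(x1, x2, x3, y1, y2, y3) \<in> primitive_solutions c X Y. gcd y2 y3 \<le> gcd y1 y2 \<and> gcd y2 y3 \<le> gcd y1 y3}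
      \<le> K * (X powr (7/4) * Y powr (5/4))"
proof -
  obtain S where S: "S \<ge> 1" "\<And>M::int. (\<Sum>k=1..M. real_of_int k powr (-5/4)) \<le> S" by (rule p_series_bound) blast
  define C where "C = 108 * 2 ^ 17 / c\<^sup>2 * (2 / c + 2)"
  have C0: "C \<ge> 0" unfolding C_def using c by simp
  show thesis
  proof (rule that[of "C * S ^ 5"])
    fix X Y :: real assume XY: "0 < X" "X \<le> Y"
    let ?P = "{(x1, x2, x3, y1, y2, y3) \<in> primitive_solutions c X Y. gcd y2 y3 \<le> gcd y1 y2 \<and> gcd y2 y3 \<le> gcd y1 y3}"
    define N where "N = {1..\<lfloor>Y\<rfloor>}"
    define I where "I = {(a, b, g, s, r) \<in> N \<times> N \<times> N \<times> N \<times> N. r \<le> s \<and> g \<le> a \<and> g \<le> b}"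
    define f where "f = (\<lambda>k. real_of_int k powr (-5/4))"
    define D where "D = (\<lambda>(a, b, g, s, r). decomposed_solutions c X Y a b g s r)"
    define w where "w = C * (X powr (7/4) * Y powr (5/4))"
    have w0: "w \<ge> 0" unfolding w_def using C0 by simp
    have f0: "f k \<ge> 0" for k by (simp add: f_def)
    have finN: "finite N" by (simp add: N_def)
    have finI: "finite I" using finN by (intro finite_subset[of I "N \<times> N \<times> N \<times> N \<times> N"]) (auto simp: I_def)
    have sub: "?P \<subseteq> (\<Union>i\<in>I. D i)"
    proof
      fix t assume "t \<in> ?P"
      then obtain x1 x2 x3 y1 y2 y3 where t: "t = (x1, x2, x3, y1, y2, y3)"
        and ps: "(x1, x2, x3, y1, y2, y3) \<in> primitive_solutions c X Y"
        and g: "gcd y2 y3 \<le> gcd y1 y2" "gcd y2 y3 \<le> gcd y1 y3" by blast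
      have "Y > 0" using XY by simp
      from mem_decomposed_solutions[OF ps c(1) this] obtain s r where sr: "1 \<le> r" "r \<le> s" "real_of_int s \<le> Y"
        "(x1, x2, x3, y1, y2, y3) \<in> decomposed_solutions c X Y (gcd y1 y2) (gcd y1 y3) (gcd y2 y3) s r" by blast
      have cY: "c * Y > 0" using c XY by simp
      note p = ps[unfolded primitive_solutions_def, simplified]
      have nz: "y1 \<noteq> 0" "y2 \<noteq> 0" "y3 \<noteq> 0" using p cY by auto
      have gN: "gcd u v \<in> N" if "u \<noteq> 0" "\<bar>real_of_int u\<bar> \<le> Y" for u v
      proof -
        have "1 \<le> gcd u v" using that gcd_pos_int[of u v] by linarith
        moreover have "gcd u v \<le> \<bar>u\<bar>" using dvd_imp_le_int[OF that(1), of "gcd u v"] by simp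
        hence "real_of_int (gcd u v) \<le> Y" using that by linarith
        ultimately show ?thesis by (simp add: N_def le_floor_iff)
      qed
      have sN: "s \<in> N" "r \<in> N" using sr by (auto simp: N_def le_floor_iff)
      have y: "\<bar>real_of_int y1\<bar> \<le> Y" "\<bar>real_of_int y2\<bar> \<le> Y" using p by auto
      have "(gcd y1 y2, gcd y1 y3, gcd y2 y3, s, r) \<in> I"
        unfolding I_def using gN[OF nz(1) y(1)] gN[OF nz(2) y(2)] sN sr(2) g by blast
      thus "t \<in> (\<Union>i\<in>I. D i)" unfolding t using sr(4) by (intro UN_I) (auto simp: D_def)
    qed
    define F where "F = (\<lambda>(a, b, g, s, r). f a * f b * f g * f s * f r)"
    have D: "finite (D i) \<and> real (card (D i)) \<le> w * F i" if i: "i \<in> I" for i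
    proof -
      obtain a b g s r where ii: "i = (a, b, g, s, r)" by (cases i)
      have ge: "1 \<le> a" "1 \<le> b" "1 \<le> g" "1 \<le> s" "1 \<le> r" and le: "r \<le> s" "g \<le> a" "g \<le> b"
        using i unfolding ii I_def N_def by auto
      show ?thesis using card_decomposed_solutions[OF ge le XY c]
        unfolding ii D_def F_def f_def w_def C_def prod.case .
    qed
    have fin: "finite (\<Union>i\<in>I. D i)" using finI D by blast
    have "card ?P \<le> card (\<Union>i\<in>I. D i)" using fin sub by (rule card_mono)
    also have "\<dots> \<le> (\<Sum>i\<in>I. card (D i))" by (rule card_UN_le[OF finI])
    finally have "real (card ?P) \<le> real (\<Sum>i\<in>I. card (D i))" by (rule of_nat_mono)
    also have "\<dots> = (\<Sum>i\<in>I. real (card (D i)))" by (rule of_nat_sum)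
    also have "\<dots> \<le> (\<Sum>i\<in>I. w * F i)" by (intro sum_mono) (use D in blast)
    also have "\<dots> \<le> (\<Sum>i\<in>N \<times> N \<times> N \<times> N \<times> N. w * F i)"
    proof (rule sum_mono2)
      show "finite (N \<times> N \<times> N \<times> N \<times> N)" using finN by blast
      show "I \<subseteq> N \<times> N \<times> N \<times> N \<times> N" unfolding I_def by blast
      show "0 \<le> w * F i" for i unfolding F_def by (cases i) (simp add: w0 f0)
    qed
    also have "\<dots> = w * (\<Sum>a\<in>N. \<Sum>b\<in>N. \<Sum>g\<in>N. \<Sum>s\<in>N. \<Sum>r\<in>N. f a * f b * f g * f s * f r)"
      unfolding F_def by (simp only: sum_distrib_left[symmetric] sum.cartesian_product[symmetric])
    also have "(\<Sum>a\<in>N. \<Sum>b\<in>N. \<Sum>g\<in>N. \<Sum>s\<in>N. \<Sum>r\<in>N. f a * f b * f g * f s * f r) = (\<Sum>k\<in>N. f k) ^ 5"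
      by (simp only: sum_distrib_left[symmetric] sum_distrib_right[symmetric]) (simp add: numeral_eq_Suc mult.assoc)
    also have "w * (\<Sum>k\<in>N. f k) ^ 5 \<le> w * S ^ 5"
      using S(2)[of "\<lfloor>Y\<rfloor>"] w0 f0 by (intro mult_left_mono power_mono sum_nonneg) (auto simp: f_def N_def)
    finally show "real (card ?P) \<le> C * S ^ 5 * (X powr (7/4) * Y powr (5/4))"
      by (simp add: w_def mult_ac)
  qed
qed

text \<open>The equation is symmetric in the three coordinates, so a transposition brings the
  smallest of the three pairwise gcds to the pair \<open>(y2, y3)\<close>; hence the factor
  3.\<close>

lemma card_primitive_solutions:
  assumes c: "0 < c" "c \<le> 1"
  obtains K where "\<And>X Y. 0 < X \<Longrightarrow> X \<le> Y \<Longrightarrow>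
    card (primitive_solutions c X Y) \<le> K * (X powr (7/4) * Y powr (5/4))"
proof -
  obtain K where K: "\<And>X Y. 0 < X \<Longrightarrow> X \<le> Y \<Longrightarrow>
    card {(x1, x2, x3, y1, y2, y3) \<in> primitive_solutions c X Y. gcd y2 y3 \<le> gcd y1 y2 \<and> gcd y2 y3 \<le> gcd y1 y3}
      \<le> K * (X powr (7/4) * Y powr (5/4))" by (rule card_primitive_solutions_min_gcd[OF c]) blast
  show thesis
  proof (rule that[of "3 * K"])
    fix X Y :: real assume XY: "0 < X" "X \<le> Y"
    let ?P = "primitive_solutions c X Y"
    let ?Q = "{(x1, x2, x3, y1, y2, y3) \<in> ?P. gcd y2 y3 \<le> gcd y1 y2 \<and> gcd y2 y3 \<le> gcd y1 y3}"
    let ?s = "\<lambda>(x1, x2, x3, y1, y2, y3). (x2, x1, x3, y2, y1, y3) :: int \<times> int \<times> int \<times> int \<times> int \<times> int"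
    let ?t = "\<lambda>(x1, x2, x3, y1, y2, y3). (x3, x2, x1, y3, y2, y1) :: int \<times> int \<times> int \<times> int \<times> int \<times> int"
    have fin: "finite ?Q" using finite_primitive_solutions[of c X Y] by (rule finite_subset[rotated]) blast
    have sub: "?P \<subseteq> ?Q \<union> (?s ` ?Q \<union> ?t ` ?Q)"
    proof
      fix z assume z: "z \<in> ?P"
      obtain x1 x2 x3 y1 y2 y3 where zz: "z = (x1, x2, x3, y1, y2, y3)" by (cases z)
      have s: "(x2, x1, x3, y2, y1, y3) \<in> ?P" "(x3, x2, x1, y3, y2, y1) \<in> ?P"
        using z unfolding zz primitive_solutions_def by (auto simp: gcd.left_commute gcd.commute add_ac)
      consider "gcd y2 y3 \<le> gcd y1 y2" "gcd y2 y3 \<le> gcd y1 y3"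
        | "gcd y1 y3 \<le> gcd y1 y2" "gcd y1 y3 \<le> gcd y2 y3"
        | "gcd y1 y2 \<le> gcd y1 y3" "gcd y1 y2 \<le> gcd y2 y3" by linarith
      thus "z \<in> ?Q \<union> (?s ` ?Q \<union> ?t ` ?Q)"
      proof cases
        case 1
        thus ?thesis using z zz by blast
      next
        case 2
        hence "(x2, x1, x3, y2, y1, y3) \<in> ?Q" using s by (simp add: gcd.commute)
        hence "z \<in> ?s ` ?Q" unfolding zz by (rule image_eqI[rotated]) simp
        thus ?thesis by blast
      next
        case 3
        hence "(x3, x2, x1, y3, y2, y1) \<in> ?Q" using s by (simp add: gcd.commute)
        hence "z \<in> ?t ` ?Q" unfolding zz by (rule image_eqI[rotated]) simp
        thus ?thesis by blast
      qed
    qed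
    have "card ?P \<le> card (?Q \<union> (?s ` ?Q \<union> ?t ` ?Q))" using sub fin by (intro card_mono) blast+
    also have "\<dots> \<le> card ?Q + (card (?s ` ?Q) + card (?t ` ?Q))"
      by (rule order.trans[OF card_Un_le]) (rule add_left_mono[OF card_Un_le])
    also have "\<dots> \<le> card ?Q + (card ?Q + card ?Q)" using fin by (intro add_mono card_image_le) auto
    finally have "real (card ?P) \<le> real (card ?Q + (card ?Q + card ?Q))" by (rule of_nat_mono)
    also have "\<dots> = 3 * real (card ?Q)" by simp
    also have "\<dots> \<le> 3 * (K * (X powr (7/4) * Y powr (5/4)))" using K[OF XY] by (rule mult_left_mono) simp
    finally show "real (card ?P) \<le> 3 * K * (X powr (7/4) * Y powr (5/4))" by (simp only: mult.assoc)
  qed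
qed

section \<open>Shortest lattice vectors\<close>

text \<open>
  For \<open>gcd y1 (gcd y2 y3) = 1\<close> these are the first two coordinates of the integer solutions \<open>x\<close> of
  \<open>F x y = 0\<close>; the third coordinate is determined. They form a sublattice of index \<open>y3\<^sup>2\<close> in the plane.
\<close>

definition is_lattice_vector :: "int \<Rightarrow> int \<Rightarrow> int \<Rightarrow> int \<Rightarrow> int \<Rightarrow> bool" where
  "is_lattice_vector y1 y2 y3 x1 x2 \<longleftrightarrow> y3\<^sup>2 dvd x1 * y1\<^sup>2 + x2 * y2\<^sup>2"

text \<open>The first successive minimum in the maximum norm of the plane. Being a
  \<open>LEAST\<close> over \<open>nat\<close>, it is attained as soon as there is a nonzero lattice
  vector, for which \<open>y3 \<noteq> 0\<close> suffices.\<close>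

definition lattice_min :: "int \<Rightarrow> int \<Rightarrow> int \<Rightarrow> nat" where
  "lattice_min y1 y2 y3 = (LEAST m. \<exists>x1 x2. (x1, x2) \<noteq> (0, 0) \<and> \<bar>x1\<bar> \<le> int m \<and> \<bar>x2\<bar> \<le> int m \<and>
     is_lattice_vector y1 y2 y3 x1 x2)"

lemma lattice_min_attained:
  assumes "y3 \<noteq> 0"
  obtains x1 x2 where "(x1, x2) \<noteq> (0, 0)" "\<bar>x1\<bar> \<le> int (lattice_min y1 y2 y3)"
    "\<bar>x2\<bar> \<le> int (lattice_min y1 y2 y3)" "is_lattice_vector y1 y2 y3 x1 x2"
proof -
  let ?P = "\<lambda>m. \<exists>x1 x2. (x1, x2) \<noteq> (0, 0) \<and> \<bar>x1\<bar> \<le> int m \<and> \<bar>x2\<bar> \<le> int m \<and> is_lattice_vector y1 y2 y3 x1 x2"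
  have "?P (nat (y3\<^sup>2))" by (rule exI[of _ "y3\<^sup>2"], rule exI[of _ 0]) (use assms in \<open>auto simp: is_lattice_vector_def\<close>)
  from LeastI[of ?P, OF this] show thesis unfolding lattice_min_def[symmetric] using that by blast
qed

lemma lattice_min_le:
  assumes "(x1, x2) \<noteq> (0, 0)" "\<bar>x1\<bar> \<le> int m" "\<bar>x2\<bar> \<le> int m" "is_lattice_vector y1 y2 y3 x1 x2"
  shows "lattice_min y1 y2 y3 \<le> m"
  unfolding lattice_min_def by (rule Least_le) (use assms in blast)

lemma lattice_min_pos:
  assumes "y3 \<noteq> 0" shows "lattice_min y1 y2 y3 \<ge> 1"
proof (rule ccontr)
  assume "\<not> ?thesis"
  hence 0: "int (lattice_min y1 y2 y3) = 0" by simp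
  obtain x1 x2 where "(x1, x2) \<noteq> (0, 0)" "\<bar>x1\<bar> \<le> int (lattice_min y1 y2 y3)"
    "\<bar>x2\<bar> \<le> int (lattice_min y1 y2 y3)" by (rule lattice_min_attained[OF assms])
  thus False unfolding 0 by simp
qed

section \<open>Boxes of coordinates and pairs with a large common divisor\<close>

definition box3 :: "real \<Rightarrow> real \<Rightarrow> (int \<times> int \<times> int) set" where
  "box3 r R = {(y1, y2, y3). r \<le> \<bar>real_of_int y1\<bar> \<and> \<bar>real_of_int y1\<bar> \<le> R \<and> r \<le> \<bar>real_of_int y2\<bar> \<and> \<bar>real_of_int y2\<bar> \<le> R \<and>
     r \<le> \<bar>real_of_int y3\<bar> \<and> \<bar>real_of_int y3\<bar> \<le> R}"

lemma card_box3:
  assumes "0 < r" "0 < R"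
  shows "finite (box3 r R)" "real (card (box3 r R)) \<le> 8 * R ^ 3"
proof -
  let ?A = "{k::int. k \<noteq> 0 \<and> \<bar>of_int k\<bar> \<le> R}"
  have A: "finite ?A" "real (card ?A) \<le> 2 * R" by (rule card_nonzero_interval; use assms in simp)+
  have sub: "box3 r R \<subseteq> ?A \<times> ?A \<times> ?A" unfolding box3_def using assms by auto
  have fin: "finite (?A \<times> ?A \<times> ?A)" using A by blast
  show "finite (box3 r R)" using sub fin by (rule finite_subset)
  have "card (box3 r R) \<le> card (?A \<times> ?A \<times> ?A)" using fin sub by (rule card_mono)
  also have "\<dots> = card ?A * (card ?A * card ?A)" by (simp only: card_cartesian_product)
  finally have "real (card (box3 r R)) \<le> real (card ?A * (card ?A * card ?A))" by (rule of_nat_mono)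
  also have "\<dots> = real (card ?A) ^ 3" by (simp add: power3_eq_cube)
  also have "\<dots> \<le> (2 * R) ^ 3" by (rule power_mono[OF A(2)]) simp
  finally show "real (card (box3 r R)) \<le> 8 * R ^ 3" by (simp add: power3_eq_cube)
qed

definition primitive_box :: "real \<Rightarrow> real \<Rightarrow> (int \<times> int \<times> int) set" where
  "primitive_box c Y = {(y1, y2, y3) \<in> box3 (c * Y) Y. gcd y1 (gcd y2 y3) = 1}"

lemma card_primitive_box:
  assumes "0 < c" "0 < Y"
  shows "finite (primitive_box c Y)" "real (card (primitive_box c Y)) \<le> 8 * Y ^ 3"
proof -
  have sub: "primitive_box c Y \<subseteq> box3 (c * Y) Y" unfolding primitive_box_def by auto
  have box: "finite (box3 (c * Y) Y)" "real (card (box3 (c * Y) Y)) \<le> 8 * Y ^ 3"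
    using card_box3[of "c * Y" Y] assms by simp_all
  show "finite (primitive_box c Y)" using sub box(1) by (rule finite_subset)
  show "real (card (primitive_box c Y)) \<le> 8 * Y ^ 3"
    using card_mono[OF box(1) sub] box(2) by linarith
qed

text \<open>Telescoping with \<open>1 / k^2 <= 2 / k - 2 / (k + 1)\<close>, which holds from
  \<open>k = 1\<close> on. \<open>G\<close> may lie below 1, hence the maximum in
  \<open>m\<close>.\<close>

lemma sum_inverse_squares_tail:
  fixes G :: real assumes G: "G > 0"
  shows "(\<Sum>g\<in>{g\<in>{1..M::int}. G \<le> g}. 1 / (real_of_int g)\<^sup>2) \<le> 2 / G"
proof -
  define m where "m = max 1 \<lceil>G\<rceil>"
  have mg: "m \<le> g \<longleftrightarrow> 1 \<le> g \<and> G \<le> g" for g :: int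
    unfolding m_def max.bounded_iff ceiling_le_iff by (rule refl)
  have m1: "m \<ge> 1" "G \<le> m" using mg[THEN iffD1, OF order.refl] by blast+
  have eq: "{g\<in>{1..M::int}. G \<le> g} = {m..M}"
    unfolding set_eq_iff mem_Collect_eq atLeastAtMost_iff mg by blast
  have tele: "1 / k\<^sup>2 \<le> 2 / k - 2 / (k + 1)" if "1 \<le> k" for k :: real
  proof -
    have "1 / k\<^sup>2 = 2 / (k * (2 * k))" using that by (simp add: power2_eq_square)
    also have "\<dots> \<le> 2 / (k * (k + 1))" using that by (intro divide_left_mono mult_left_mono mult_pos_pos) auto
    also have "\<dots> = 2 / k - 2 / (k + 1)" using that by (simp add: field_simps)
    finally show ?thesis .
  qed
  have "(\<Sum>g=m..m + int n. 1 / (real_of_int g)\<^sup>2) \<le> 2 / m - 2 / (m + int n + 1)" for n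
  proof (induction n)
    case 0
    show ?case using tele[of "real_of_int m"] m1 by simp
  next
    case (Suc n)
    define k where "k = m + int n + 1"
    have k1: "k \<ge> 1" using m1 by (simp add: k_def)
    have "{m..m + int (Suc n)} = insert k {m..m + int n}" unfolding k_def by auto
    hence "(\<Sum>g=m..m + int (Suc n). 1 / (real_of_int g)\<^sup>2) = 1 / (real_of_int k)\<^sup>2 + (\<Sum>g=m..m + int n. 1 / (real_of_int g)\<^sup>2)"
      by (simp add: k_def)
    also have "\<dots> \<le> (2 / k - 2 / (k + 1)) + (2 / m - 2 / k)"
    proof (rule add_mono)
      show "1 / (real_of_int k)\<^sup>2 \<le> 2 / k - 2 / (k + 1)" using tele[of "real_of_int k"] k1 by simp
      show "(\<Sum>g=m..m + int n. 1 / (real_of_int g)\<^sup>2) \<le> 2 / m - 2 / k" using Suc.IH by (simp add: k_def)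
    qed
    also have "\<dots> = 2 / m - 2 / (m + int (Suc n) + 1)" by (simp add: k_def add_ac)
    finally show ?case .
  qed
  from this[of "nat (M - m)"] have *: "(\<Sum>g=m..M. 1 / (real_of_int g)\<^sup>2) \<le> 2 / m - 2 / (M + 1)" if "m \<le> M"
    using that by simp
  have "(\<Sum>g=m..M. 1 / (real_of_int g)\<^sup>2) \<le> 2 / m"
  proof (cases "m \<le> M")
    case True
    have "2 / real_of_int (M + 1) \<ge> 0" using True m1 by simp
    thus ?thesis using *[OF True] by linarith
  qed (use m1 in simp)
  also have "\<dots> \<le> 2 / G" using m1 G by (intro divide_left_mono mult_pos_pos) auto
  finally show ?thesis unfolding eq .
qed

text \<open>Sorting by the exact gcd \<open>g\<close> leaves at most \<open>(2 * Y / g)^2\<close>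
  pairs for each \<open>g\<close>, and the tail of the sum of \<open>1 / g^2\<close> from
  \<open>G\<close> on is at most \<open>2 / G\<close>.\<close>

lemma card_pairs_large_gcd:
  fixes G Y :: real assumes G: "G > 0" and Y: "Y > 0"
  defines "P \<equiv> {(u :: int, v :: int). u \<noteq> 0 \<and> v \<noteq> 0 \<and> \<bar>of_int u\<bar> \<le> Y \<and> \<bar>of_int v\<bar> \<le> Y \<and> G \<le> of_int (gcd u v)}"
  shows "finite P" "real (card P) \<le> 8 * Y\<^sup>2 / G"
proof -
  define I where "I = {g\<in>{1..\<lfloor>Y\<rfloor>}. G \<le> real_of_int g}"
  define A where "A = (\<lambda>g::int. {k::int. k \<noteq> 0 \<and> \<bar>of_int k\<bar> \<le> Y / g})"
  define D where "D = (\<lambda>g::int. (\<lambda>(j, k). (g * j, g * k)) ` (A g \<times> A g))"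
  have finI: "finite I" unfolding I_def by (rule finite_subset[of _ "{1..\<lfloor>Y\<rfloor>}"]) blast+
  have A: "finite (A g)" "real (card (A g)) \<le> 2 * (Y / g)" if "g \<in> I" for g
    unfolding A_def by (rule card_nonzero_interval; use Y that in \<open>simp add: I_def\<close>)+
  have sub: "P \<subseteq> (\<Union>g\<in>I. D g)"
  proof
    fix z assume "z \<in> P"
    then obtain u v where z: "z = (u, v)" and uv: "u \<noteq> 0" "v \<noteq> 0" "\<bar>of_int u\<bar> \<le> Y" "\<bar>of_int v\<bar> \<le> Y" "G \<le> of_int (gcd u v)"
      unfolding P_def by blast
    define g where "g = gcd u v"
    have g0: "g > 0" using uv by (simp add: g_def)
    obtain j k where jk: "u = g * j" "v = g * k" unfolding g_def by (meson dvd_def gcd_dvd1 gcd_dvd2)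
    have "g \<le> \<bar>u\<bar>" using dvd_imp_le_int[OF uv(1), of g] g0 by (simp add: g_def)
    hence gI: "g \<in> I" using uv g0 unfolding I_def g_def[symmetric] by (simp add: le_floor_iff)
    have "\<bar>real_of_int j\<bar> \<le> Y / g" "\<bar>real_of_int k\<bar> \<le> Y / g"
      using uv(3,4) g0 by (simp_all add: jk abs_mult field_simps)
    moreover have "j \<noteq> 0" "k \<noteq> 0" using uv jk by auto
    ultimately have "(j, k) \<in> A g \<times> A g" by (simp add: A_def)
    hence "z \<in> D g" unfolding D_def z jk by (rule image_eqI[rotated]) simp
    with gI show "z \<in> (\<Union>g\<in>I. D g)" by blast
  qed
  have fin: "finite (\<Union>g\<in>I. D g)" using finI A unfolding D_def by blast
  show "finite P" using sub fin by (rule finite_subset)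
  have D: "real (card (D g)) \<le> 4 * Y\<^sup>2 * (1 / (real_of_int g)\<^sup>2)" if g: "g \<in> I" for g
  proof -
    have "card (D g) \<le> card (A g \<times> A g)" unfolding D_def using A[OF g] by (intro card_image_le) blast
    also have "\<dots> = card (A g) * card (A g)" by (rule card_cartesian_product)
    finally have "real (card (D g)) \<le> real (card (A g) * card (A g))" by (rule of_nat_mono)
    also have "\<dots> = real (card (A g)) ^ 2" by (simp add: power2_eq_square)
    also have "\<dots> \<le> (2 * (Y / g))\<^sup>2" by (rule power_mono[OF A(2)[OF g]]) simp
    finally show ?thesis by (simp add: power2_eq_square)
  qed
  have "card P \<le> card (\<Union>g\<in>I. D g)" using fin sub by (rule card_mono)
  also have "\<dots> \<le> (\<Sum>g\<in>I. card (D g))" by (rule card_UN_le[OF finI])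
  finally have "real (card P) \<le> real (\<Sum>g\<in>I. card (D g))" by (rule of_nat_mono)
  also have "\<dots> = (\<Sum>g\<in>I. real (card (D g)))" by (rule of_nat_sum)
  also have "\<dots> \<le> (\<Sum>g\<in>I. 4 * Y\<^sup>2 * (1 / (real_of_int g)\<^sup>2))" by (intro sum_mono D)
  also have "\<dots> = 4 * Y\<^sup>2 * (\<Sum>g\<in>I. 1 / (real_of_int g)\<^sup>2)" by (simp only: sum_distrib_left)
  also have "\<dots> \<le> 4 * Y\<^sup>2 * (2 / G)" unfolding I_def by (intro mult_left_mono sum_inverse_squares_tail G) simp
  finally show "real (card P) \<le> 8 * Y\<^sup>2 / G" by simp
qed

text \<open>After division by the gcd, \<open>u\<close> and \<open>v\<close> become coprime
  \<open>j\<close> and \<open>k\<close>, so \<open>j^2\<close> divides \<open>x3\<close>. This is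
  meant for lattice vectors with one zero coordinate: for \<open>u\<close> of size about
  \<open>Y\<close> it forces a gcd of size at least about \<open>Y / sqrt X\<close>.\<close>

lemma square_le_coefficient_mult_gcd_square:
  fixes x2 x3 u v :: int
  assumes "u \<noteq> 0" "v \<noteq> 0" "x3 \<noteq> 0" "x2 * u\<^sup>2 + x3 * v\<^sup>2 = 0"
  shows "u\<^sup>2 \<le> \<bar>x3\<bar> * (gcd u v)\<^sup>2"
proof -
  define g where "g = gcd u v"
  have g0: "g > 0" using assms by (simp add: g_def)
  obtain j k where jk: "u = g * j" "v = g * k" unfolding g_def by (meson dvd_def gcd_dvd1 gcd_dvd2)
  have "coprime (u div g) (v div g)" unfolding g_def using assms by (simp add: div_gcd_coprime)
  hence cop: "coprime j k" using g0 by (simp add: jk)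
  have "g\<^sup>2 * (x2 * j\<^sup>2 + x3 * k\<^sup>2) = 0" using assms(4) unfolding jk by (simp add: algebra_simps power2_eq_square)
  hence "x3 * k\<^sup>2 = - x2 * j\<^sup>2" using g0 by simp
  hence "j\<^sup>2 dvd x3 * k\<^sup>2" by simp
  hence "j\<^sup>2 dvd x3" using cop coprime_dvd_mult_left_iff[of "j\<^sup>2" "k\<^sup>2"] by simp
  hence "j\<^sup>2 \<le> \<bar>x3\<bar>" using dvd_imp_le_int[OF assms(3), of "j\<^sup>2"] by simp
  hence "g\<^sup>2 * j\<^sup>2 \<le> g\<^sup>2 * \<bar>x3\<bar>" by (intro mult_left_mono) auto
  moreover have "u\<^sup>2 = g\<^sup>2 * j\<^sup>2" unfolding jk(1) by (rule power_mult_distrib)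
  ultimately show ?thesis by (simp only: g_def mult.commute)
qed

text \<open>A shortest vector extends to a primitive solution whose third coordinate is also
  \<open>O(X)\<close>, because the coordinates of \<open>y\<close> have comparable size. If no
  coordinate of it vanishes, it is counted by \<open>card_primitive_solutions\<close>; otherwise two
  coordinates of \<open>y\<close> have a large gcd, which gives the second term.\<close>

lemma card_lattice_min_le:
  assumes c: "0 < c" "c \<le> 1"
  obtains K where "K \<ge> 0" "\<And>X Y. 1 \<le> X \<Longrightarrow> 1 \<le> Y \<Longrightarrow>
    card {(y1, y2, y3) \<in> primitive_box c Y. real (lattice_min y1 y2 y3) \<le> X}
      \<le> K * (X powr (7/4) * Y powr (5/4) + X powr (1/2) * Y powr 2)"
proof -
  obtain K where K: "\<And>X Y. 0 < X \<Longrightarrow> X \<le> Y \<Longrightarrow>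
    card (primitive_solutions c X Y) \<le> K * (X powr (7/4) * Y powr (5/4))"
    by (rule card_primitive_solutions[OF c]) blast
  \<comment> \<open>From \<open>x3 * y3^2 = - (x1 * y1^2 + x2 * y2^2)\<close> and
    \<open>c * Y <= \<bar>y3\<bar>\<close> follows
    \<open>\<bar>x3\<bar> <= 2 * X / c^2\<close>.\<close>
  define e where "e = 2 / c\<^sup>2"
  have cc: "c\<^sup>2 \<le> 1" using c by (simp add: power_le_one)
  have e1: "e \<ge> 1" unfolding e_def using c cc by (simp add: field_simps)
  define K' where "K' = max (max K 8 * e powr (7/4)) (48 / c * e powr (1/2))"
  have K'0: "K' \<ge> 0" unfolding K'_def using c by (simp add: le_max_iff_disj)
  show thesis
  proof (rule that[OF K'0])
    fix X Y :: real assume X: "1 \<le> X" and Y: "1 \<le> Y"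
    define X' where "X' = e * X"
    have X'X: "X \<le> X'" unfolding X'_def using e1 X mult_right_mono[of 1 e X] by simp
    have X'0: "X' > 0" using X'X X by linarith
    let ?N = "{(y1, y2, y3) \<in> primitive_box c Y. real (lattice_min y1 y2 y3) \<le> X}"
    have finB: "finite (primitive_box c Y)" and cB: "card (primitive_box c Y) \<le> 8 * Y ^ 3"
      using card_primitive_box[of c Y] c Y by auto
    have subB: "?N \<subseteq> primitive_box c Y" by blast
    have pw: "X' powr p = e powr p * X powr p" for p unfolding X'_def using e1 X by (simp add: powr_mult)
    have main: "card ?N \<le> max K 8 * (X' powr (7/4) * Y powr (5/4)) + 48 / c * (X' powr (1/2) * Y powr 2)"
    proof (cases "X' \<le> Y")
      \<comment> \<open>For \<open>X' > Y\<close> the trivial bound \<open>8 * Y ^ 3\<close> is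
        already below the first term.\<close>
      case False
      have "real (card ?N) \<le> card (primitive_box c Y)" using card_mono[OF finB subB] by simp
      also have "\<dots> \<le> 8 * Y ^ 3" by (rule cB)
      also have "Y ^ 3 = Y powr (7/4) * Y powr (5/4)" using Y by (simp flip: powr_add powr_numeral)
      also have "8 * \<dots> \<le> max K 8 * (X' powr (7/4) * Y powr (5/4))"
        using False Y by (intro mult_mono mult_right_mono powr_mono2) auto
      also have "\<dots> \<le> max K 8 * (X' powr (7/4) * Y powr (5/4)) + 48 / c * (X' powr (1/2) * Y powr 2)"
        using c by simp
      finally show ?thesis .
    next
      case True
      define S where "S = primitive_solutions c X' Y"
      have finS: "finite S" unfolding S_def by (rule finite_primitive_solutions)
      define G where "G = c * Y / sqrt X'"
      have G0: "G > 0" unfolding G_def using c Y X'0 by simp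
      define A where "A = {k::int. k \<noteq> 0 \<and> \<bar>of_int k\<bar> \<le> Y}"
      have A: "finite A" "real (card A) \<le> 2 * Y"
        unfolding A_def by (rule card_nonzero_interval; use Y in simp)+
      define P where "P = {(u :: int, v :: int). u \<noteq> 0 \<and> v \<noteq> 0 \<and> \<bar>of_int u\<bar> \<le> Y \<and> \<bar>of_int v\<bar> \<le> Y \<and> G \<le> of_int (gcd u v)}"
      have Y0: "Y > 0" using Y by simp
      have P: "finite P" "real (card P) \<le> 8 * Y\<^sup>2 / G"
        unfolding P_def using card_pairs_large_gcd[OF G0 Y0] by auto
      \<comment> \<open>A triple in \<open>R\<close> is the free coordinate followed by the pair
        with large gcd; the maps \<open>?g1\<close>, \<open>?g2\<close>, \<open>?g3\<close> put the
        free coordinate back in its place.\<close>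
      define R where "R = A \<times> P"
      have finR: "finite R" unfolding R_def using A P by blast
      have "real (card R) = real (card A) * real (card P)" unfolding R_def by (simp add: card_cartesian_product)
      also have "\<dots> \<le> (2 * Y) * (8 * Y\<^sup>2 / G)" by (rule mult_mono[OF A(2) P(2)]) (use Y in auto)
      also have "\<dots> = 16 * Y\<^sup>2 * sqrt X' / c" unfolding G_def using Y c by (simp add: field_simps power2_eq_square)
      finally have cR: "real (card R) \<le> 16 * Y\<^sup>2 * sqrt X' / c" .
      let ?f = "\<lambda>(x1::int, x2::int, x3::int, y1::int, y2::int, y3::int). (y1, y2, y3)"
      let ?g1 = "\<lambda>(y1::int, y2::int, y3::int). (y1, y2, y3)"
      let ?g2 = "\<lambda>(y2::int, y1::int, y3::int). (y1, y2, y3)"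
      let ?g3 = "\<lambda>(y3::int, y1::int, y2::int). (y1, y2, y3)"
      have sub: "?N \<subseteq> ?f ` S \<union> (?g1 ` R \<union> (?g2 ` R \<union> ?g3 ` R))"
      proof
        fix z assume z: "z \<in> ?N"
        obtain y1 y2 y3 where zz: "z = (y1, y2, y3)" by (cases z)
        have yb: "gcd y1 (gcd y2 y3) = 1" "c * Y \<le> \<bar>real_of_int y1\<bar>" "\<bar>real_of_int y1\<bar> \<le> Y"
          "c * Y \<le> \<bar>real_of_int y2\<bar>" "\<bar>real_of_int y2\<bar> \<le> Y" "c * Y \<le> \<bar>real_of_int y3\<bar>" "\<bar>real_of_int y3\<bar> \<le> Y"
          and lm: "real (lattice_min y1 y2 y3) \<le> X"
          using z unfolding zz primitive_box_def box3_def by auto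
        have cY: "c * Y > 0" using c Y by simp
        have nz: "y1 \<noteq> 0" "y2 \<noteq> 0" "y3 \<noteq> 0" using yb cY by auto
        define m where "m = lattice_min y1 y2 y3"
        obtain x1 x2 where x: "(x1, x2) \<noteq> (0, 0)" "\<bar>x1\<bar> \<le> int m" "\<bar>x2\<bar> \<le> int m" "is_lattice_vector y1 y2 y3 x1 x2"
          unfolding m_def by (rule lattice_min_attained[OF nz(3)])
        from x(4) obtain k where "x1 * y1\<^sup>2 + x2 * y2\<^sup>2 = y3\<^sup>2 * k" unfolding is_lattice_vector_def by auto
        define x3 where "x3 = - k"
        have eq: "x1 * y1\<^sup>2 + x2 * y2\<^sup>2 + x3 * y3\<^sup>2 = 0"
          unfolding x3_def using \<open>x1 * y1\<^sup>2 + x2 * y2\<^sup>2 = y3\<^sup>2 * k\<close> by simp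
        have X12: "\<bar>real_of_int x1\<bar> \<le> X" "\<bar>real_of_int x2\<bar> \<le> X" using x(2,3) lm unfolding m_def by linarith+
        have sq: "(real_of_int u)\<^sup>2 \<le> Y\<^sup>2" if "\<bar>real_of_int u\<bar> \<le> Y" for u
          using power_mono[OF that, of 2] by simp
        have X3: "\<bar>real_of_int x3\<bar> \<le> X'"
        proof -
          have "(c * Y)\<^sup>2 \<le> \<bar>real_of_int y3\<bar>\<^sup>2" using yb(6) cY by (intro power_mono) auto
          hence "\<bar>real_of_int x3\<bar> * (c * Y)\<^sup>2 \<le> \<bar>real_of_int x3\<bar> * (real_of_int y3)\<^sup>2" by (intro mult_left_mono) auto
          also have "\<dots> = \<bar>real_of_int (x3 * y3\<^sup>2)\<bar>" by (simp add: abs_mult)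
          also have "x3 * y3\<^sup>2 = - (x1 * y1\<^sup>2 + x2 * y2\<^sup>2)" using eq by linarith
          also have "\<bar>real_of_int (- (x1 * y1\<^sup>2 + x2 * y2\<^sup>2))\<bar> \<le> \<bar>real_of_int x1\<bar> * (real_of_int y1)\<^sup>2 + \<bar>real_of_int x2\<bar> * (real_of_int y2)\<^sup>2"
            using abs_triangle_ineq[of "real_of_int (x1 * y1\<^sup>2)" "real_of_int (x2 * y2\<^sup>2)"] by (simp add: abs_mult)
          also have "\<dots> \<le> X * Y\<^sup>2 + X * Y\<^sup>2"
            using X12 X sq[OF yb(3)] sq[OF yb(5)] by (intro add_mono mult_mono) auto
          finally have "\<bar>real_of_int x3\<bar> \<le> (X * Y\<^sup>2 + X * Y\<^sup>2) / (c * Y)\<^sup>2" using zero_less_power[OF cY, of 2] by (simp only: pos_le_divide_eq)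
          also have "\<dots> = X'" unfolding X'_def e_def using Y c by (simp add: field_simps power2_eq_square)
          finally show ?thesis .
        qed
        have X12': "\<bar>real_of_int x1\<bar> \<le> X'" "\<bar>real_of_int x2\<bar> \<le> X'" using X12 X'X by linarith+
        \<comment> \<open>A common divisor \<open>d\<close> could be divided out, leaving a lattice
          vector shorter by the factor \<open>d\<close>, against minimality.\<close>
        have g1: "gcd x1 (gcd x2 x3) = 1"
        proof -
          define d where "d = gcd x1 (gcd x2 x3)"
          have d0: "d > 0" using x(1) unfolding d_def by (auto simp: gcd_pos_int)
          obtain u1 where u1: "x1 = d * u1" unfolding d_def by (meson dvdE gcd_dvd1)
          obtain u2 where u2: "x2 = d * u2" unfolding d_def by (meson dvdE gcd_dvd1 gcd_dvd2 dvd_trans)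
          obtain u3 where u3: "x3 = d * u3" unfolding d_def by (meson dvdE gcd_dvd2 dvd_trans)
          have "d * (u1 * y1\<^sup>2 + u2 * y2\<^sup>2 + u3 * y3\<^sup>2) = 0" using eq unfolding u1 u2 u3 by (simp add: algebra_simps)
          hence "u1 * y1\<^sup>2 + u2 * y2\<^sup>2 + u3 * y3\<^sup>2 = 0" using d0 by simp
          hence "u1 * y1\<^sup>2 + u2 * y2\<^sup>2 = y3\<^sup>2 * (- u3)" by (simp add: algebra_simps)
          hence lv: "is_lattice_vector y1 y2 y3 u1 u2" unfolding is_lattice_vector_def by simp
          define m' where "m' = nat (max \<bar>u1\<bar> \<bar>u2\<bar>)"
          have m'1: "\<bar>u1\<bar> \<le> int m'" "\<bar>u2\<bar> \<le> int m'" unfolding m'_def by auto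
          have "m \<le> m'" unfolding m_def by (rule lattice_min_le[OF _ m'1 lv]) (use x(1) u1 u2 in auto)
          have "int m' = \<bar>u1\<bar> \<or> int m' = \<bar>u2\<bar>" unfolding m'_def by (auto simp: max_def)
          hence "d * int m' \<le> int m" using x(2,3) d0 unfolding u1 u2 by (auto simp: abs_mult)
          also have "\<dots> \<le> int m'" using \<open>m \<le> m'\<close> by simp
          finally have *: "d * int m' \<le> int m'" .
          have "m' > 0" unfolding m'_def using x(1) u1 u2 by auto
          hence "d \<le> 1" using * by simp
          thus ?thesis using d0 unfolding d_def by linarith
        qed
        have inR: "(w, u, v) \<in> R" if uv: "u \<in> {y1, y2, y3}" "v \<in> {y1, y2, y3}" "w \<in> {y1, y2, y3}"
          and e: "a * u\<^sup>2 + b * v\<^sup>2 = 0" and b: "b \<noteq> 0" "\<bar>real_of_int b\<bar> \<le> X'" for u v w a b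
        proof -
          have u: "u \<noteq> 0" "v \<noteq> 0" "w \<noteq> 0" "\<bar>real_of_int u\<bar> \<le> Y" "\<bar>real_of_int v\<bar> \<le> Y" "\<bar>real_of_int w\<bar> \<le> Y" "c * Y \<le> \<bar>real_of_int u\<bar>"
            using uv nz yb by auto
          have "real_of_int (u\<^sup>2) \<le> real_of_int (\<bar>b\<bar> * (gcd u v)\<^sup>2)"
            using square_le_coefficient_mult_gcd_square[OF u(1,2) b(1) e] by (simp only: of_int_le_iff)
          also have "\<dots> = \<bar>real_of_int b\<bar> * (real_of_int (gcd u v))\<^sup>2" by simp
          also have "\<dots> \<le> X' * (real_of_int (gcd u v))\<^sup>2" by (rule mult_right_mono[OF b(2)]) simp
          also have "\<dots> = (sqrt X' * real_of_int (gcd u v))\<^sup>2" using X'0 by (simp add: power_mult_distrib)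
          finally have "\<bar>real_of_int u\<bar>\<^sup>2 \<le> (sqrt X' * real_of_int (gcd u v))\<^sup>2" by simp
          moreover have "0 \<le> sqrt X' * real_of_int (gcd u v)"
            by (rule mult_nonneg_nonneg[OF real_sqrt_ge_zero[OF less_imp_le[OF X'0]]]) (simp only: of_int_0_le_iff gcd_ge_0_int)
          ultimately have "\<bar>real_of_int u\<bar> \<le> sqrt X' * real_of_int (gcd u v)" by (rule power2_le_imp_le)
          hence "c * Y \<le> sqrt X' * real_of_int (gcd u v)" using u by linarith
          hence "G \<le> real_of_int (gcd u v)" unfolding G_def using X'0 by (simp add: pos_divide_le_eq mult.commute)
          thus ?thesis unfolding R_def A_def P_def using u by blast
        qed
        have sqnz: "y1\<^sup>2 \<noteq> 0" "y2\<^sup>2 \<noteq> 0" "y3\<^sup>2 \<noteq> 0" using nz by simp_all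
        \<comment> \<open>Since no coordinate of \<open>y\<close> vanishes, two vanishing
          coordinates of \<open>x\<close> would force the third one to vanish too.\<close>
        have dichotomy: "x2 \<noteq> 0 \<and> x3 \<noteq> 0" if "x1 = 0"
        proof -
          have "x2 \<noteq> 0" using that x(1) by simp
          hence "x2 * y2\<^sup>2 \<noteq> 0" using sqnz by simp
          thus ?thesis using that eq by (metis add.commute add_0 mult_zero_left)
        qed
        have dich2: "x1 \<noteq> 0 \<and> x3 \<noteq> 0" if "x2 = 0"
        proof -
          have "x1 \<noteq> 0" using that x(1) by simp
          hence "x1 * y1\<^sup>2 \<noteq> 0" using sqnz by simp
          thus ?thesis using that eq by (metis add.commute add_0 mult_zero_left)
        qed
        have dich3: "x1 \<noteq> 0 \<and> x2 \<noteq> 0" if "x3 = 0"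
        proof -
          have e: "x1 * y1\<^sup>2 + x2 * y2\<^sup>2 = 0" using that eq by simp
          have "x1 \<noteq> 0"
          proof
            assume "x1 = 0"
            hence "x2 * y2\<^sup>2 = 0" using e by simp
            thus False using sqnz x(1) \<open>x1 = 0\<close> by simp
          qed
          hence "x1 * y1\<^sup>2 \<noteq> 0" using sqnz by simp
          thus ?thesis using \<open>x1 \<noteq> 0\<close> e by (metis add.right_neutral mult_zero_left)
        qed
        consider "x1 = 0" | "x2 = 0" | "x3 = 0" | "x1 \<noteq> 0" "x2 \<noteq> 0" "x3 \<noteq> 0" by blast
        thus "z \<in> ?f ` S \<union> (?g1 ` R \<union> (?g2 ` R \<union> ?g3 ` R))"
        proof cases
          case 1
          have "(y1, y2, y3) \<in> R" by (rule inR[of _ _ _ x2 x3]) (use 1 eq dichotomy X3 in auto)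
          hence "z \<in> ?g1 ` R" unfolding zz by (rule image_eqI[rotated]) simp
          thus ?thesis by blast
        next
          case 2
          have "(y2, y1, y3) \<in> R" by (rule inR[of _ _ _ x1 x3]) (use 2 eq dich2 X3 in auto)
          hence "z \<in> ?g2 ` R" unfolding zz by (rule image_eqI[rotated]) simp
          thus ?thesis by blast
        next
          case 3
          have "(y3, y1, y2) \<in> R" by (rule inR[of _ _ _ x1 x2]) (use 3 eq dich3 X12' in auto)
          hence "z \<in> ?g3 ` R" unfolding zz by (rule image_eqI[rotated]) simp
          thus ?thesis by blast
        next
          case 4
          have "(x1, x2, x3, y1, y2, y3) \<in> S"
            unfolding S_def primitive_solutions_def using 4 g1 yb X12' X3 eq by blast
          hence "z \<in> ?f ` S" unfolding zz by (rule image_eqI[rotated]) simp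
          thus ?thesis by blast
        qed
      qed
      have "card ?N \<le> card (?f ` S \<union> (?g1 ` R \<union> (?g2 ` R \<union> ?g3 ` R)))"
        using sub finS finR by (intro card_mono) blast+
      also have "\<dots> \<le> card (?f ` S) + (card (?g1 ` R) + (card (?g2 ` R) + card (?g3 ` R)))"
        by (meson add_left_mono card_Un_le order.trans)
      also have "\<dots> \<le> card S + (card R + (card R + card R))"
        using finS finR by (intro add_mono card_image_le) auto
      finally have "real (card ?N) \<le> real (card S + (card R + (card R + card R)))" by (rule of_nat_mono)
      also have "\<dots> = real (card S) + 3 * real (card R)" by simp
      also have "\<dots> \<le> K * (X' powr (7/4) * Y powr (5/4)) + 3 * (16 * Y\<^sup>2 * sqrt X' / c)"
        unfolding S_def by (intro add_mono mult_left_mono K[OF X'0 True] cR) simp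
      also have "\<dots> \<le> max K 8 * (X' powr (7/4) * Y powr (5/4)) + 3 * (16 * Y\<^sup>2 * sqrt X' / c)"
        by (intro add_right_mono mult_right_mono) auto
      also have "3 * (16 * Y\<^sup>2 * sqrt X' / c) = 48 / c * (X' powr (1/2) * Y powr 2)"
        using X'0 Y by (simp add: powr_half_sqrt)
      finally show ?thesis .
    qed
    also have "\<dots> = (max K 8 * e powr (7/4)) * (X powr (7/4) * Y powr (5/4)) + (48 / c * e powr (1/2)) * (X powr (1/2) * Y powr 2)"
      unfolding pw by (simp only: mult_ac)
    also have "\<dots> \<le> K' * (X powr (7/4) * Y powr (5/4)) + K' * (X powr (1/2) * Y powr 2)"
      unfolding K'_def by (intro add_mono mult_right_mono) auto
    finally show "card ?N \<le> K' * (X powr (7/4) * Y powr (5/4) + X powr (1/2) * Y powr 2)"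
      by (simp only: distrib_left)
  qed
qed

text \<open>Discrete layer cake: \<open>1 / l\<close> is the sum of
  \<open>1 / j - 1 / (j + 1)\<close> over \<open>j >= l\<close>, and each difference is at most
  \<open>1 / j^2\<close>. The first term is what remains after truncation at
  \<open>N\<close>.\<close>

lemma inverse_le_layers:
  fixes l :: nat assumes l: "1 \<le> l"
  shows "1 / real l \<le> 1 / (real N + 1) + (\<Sum>j=1..N. if l \<le> j then 1 / (real j)\<^sup>2 else 0)"
proof (induction N)
  case 0
  show ?case using l by simp
next
  case (Suc N)
  let ?s = "\<lambda>N. \<Sum>j=1..N. if l \<le> j then 1 / (real j)\<^sup>2 else 0"
  have s0: "?s M \<ge> 0" for M by (intro sum_nonneg) simp
  show ?case
  proof (cases "l \<le> Suc N")
    case True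
    have "1 / (real N + 1) \<le> 1 / (real N + 2) + 1 / (real N + 1)\<^sup>2"
    proof -
      have "1 / (real N + 1) - 1 / (real N + 2) = 1 / ((real N + 1) * (real N + 2))" by (simp add: field_simps)
      also have "\<dots> \<le> 1 / (real N + 1)\<^sup>2" unfolding power2_eq_square
        by (intro divide_left_mono mult_left_mono mult_pos_pos) auto
      finally show ?thesis by linarith
    qed
    moreover have "?s (Suc N) = ?s N + 1 / (real N + 1)\<^sup>2" using True by (simp add: add.commute)
    ultimately show ?thesis using Suc.IH by (simp add: add.commute)
  next
    case False
    have "1 / real l \<le> 1 / (real (Suc N) + 1)" using False by (intro divide_left_mono) auto
    thus ?thesis using s0[of "Suc N"] by linarith
  qed
qed

lemma sum_inverse_le_layers:
  fixes l :: "'a \<Rightarrow> nat"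
  assumes "finite A" "\<And>x. x \<in> A \<Longrightarrow> 1 \<le> l x"
  shows "(\<Sum>x\<in>A. 1 / real (l x)) \<le> card A / (real N + 1) + (\<Sum>j=1..N. 1 / (real j)\<^sup>2 * card {x \<in> A. l x \<le> j})"
proof -
  have "(\<Sum>x\<in>A. 1 / real (l x)) \<le> (\<Sum>x\<in>A. 1 / (real N + 1) + (\<Sum>j=1..N. if l x \<le> j then 1 / (real j)\<^sup>2 else 0))"
    by (intro sum_mono inverse_le_layers assms)
  also have "\<dots> = card A / (real N + 1) + (\<Sum>x\<in>A. \<Sum>j=1..N. if l x \<le> j then 1 / (real j)\<^sup>2 else 0)"
    by (simp add: sum.distrib)
  also have "(\<Sum>x\<in>A. \<Sum>j=1..N. if l x \<le> j then 1 / (real j)\<^sup>2 else 0) =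
      (\<Sum>j=1..N. \<Sum>x\<in>A. if l x \<le> j then 1 / (real j)\<^sup>2 else 0)" by (rule sum.swap)
  also have "\<dots> = (\<Sum>j=1..N. 1 / (real j)\<^sup>2 * card {x \<in> A. l x \<le> j})"
    by (intro sum.cong refl) (simp add: sum.If_cases[OF assms(1)] Int_def)
  finally show ?thesis .
qed

text \<open>The constant 2, instead of the 4/3 of the integral, leaves room for a crude induction
  step: after multiplication by \<open>(x + 1) powr (1/4)\<close> it follows from
  \<open>sqrt (x * (x + 1)) <= x + 1/2\<close>.\<close>

lemma sum_powr_neg_quarter:
  "(\<Sum>j=1..N. real j powr (-1/4)) \<le> 2 * real N powr (3/4)"
proof (induction N)
  case (Suc N)
  define x where "x = real N"
  have x0: "x \<ge> 0" by (simp add: x_def)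
  have "2 * x powr (3/4) + (x + 1) powr (-1/4) \<le> 2 * (x + 1) powr (3/4)"
  proof -
    have "x powr (3/4) * (x + 1) powr (1/4) \<le> x + 1 / 2"
    proof (cases "x = 0")
      case False
      hence x1: "x > 0" using x0 by simp
      have "x powr (3/4) * (x + 1) powr (1/4) = x powr (1/2) * (x powr (1/4) * (x + 1) powr (1/4))"
        using x1 by (simp flip: powr_add mult.assoc)
      also have "\<dots> \<le> x powr (1/2) * ((x + 1) powr (1/4) * (x + 1) powr (1/4))"
        using x1 by (intro mult_left_mono mult_right_mono powr_mono2) auto
      also have "\<dots> = sqrt (x * (x + 1))" using x1 by (simp add: powr_half_sqrt real_sqrt_mult flip: powr_add)
      also have "\<dots> \<le> sqrt ((x + 1 / 2)\<^sup>2)" by (intro real_sqrt_le_mono) (simp add: power2_eq_square algebra_simps)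
      also have "\<dots> = x + 1 / 2" using x1 by simp
      finally show ?thesis .
    qed simp
    hence "2 * (x powr (3/4) * (x + 1) powr (1/4)) + 1 \<le> 2 * (x + 1)" by simp
    hence "(2 * (x powr (3/4) * (x + 1) powr (1/4)) + 1) * (x + 1) powr (-1/4) \<le> 2 * (x + 1) * (x + 1) powr (-1/4)"
      by (rule mult_right_mono) simp
    moreover have "(x + 1) powr (1/4) * (x + 1) powr (-1/4) = 1" using x0 by (simp flip: powr_add)
    moreover have "(x + 1) * (x + 1) powr (-1/4) = (x + 1) powr (3/4)"
      using x0 powr_add[of "x + 1" 1 "-1/4"] by simp
    ultimately show ?thesis by (simp add: distrib_right mult.assoc)
  qed
  thus ?case using Suc.IH by (simp add: x_def add_ac)
qed simp

text \<open>The layers are cut at \<open>N\<close> about \<open>Y\<close>, where even the trivial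
  count of the whole box contributes only \<open>O(Y^3 / Y)\<close>. Below, layer \<open>j\<close>
  carries \<open>Y powr (5/4) * j powr (-1/4)\<close>, which sums to \<open>O(Y^2)\<close>, and
  \<open>Y^2 * j powr (-3/2)\<close>, which converges over \<open>j\<close>.\<close>

lemma sum_inverse_lattice_min:
  assumes c: "0 < c" "c \<le> 1"
  obtains K where "K \<ge> 0" "\<And>Y. 1 \<le> Y \<Longrightarrow>
    (\<Sum>(y1, y2, y3)\<in>primitive_box c Y. 1 / real (lattice_min y1 y2 y3)) \<le> K * Y\<^sup>2"
proof -
  obtain K where K: "K \<ge> 0" "\<And>X Y. 1 \<le> X \<Longrightarrow> 1 \<le> Y \<Longrightarrow>
    card {(y1, y2, y3) \<in> primitive_box c Y. real (lattice_min y1 y2 y3) \<le> X}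
      \<le> K * (X powr (7/4) * Y powr (5/4) + X powr (1/2) * Y powr 2)"
    by (rule card_lattice_min_le[OF c]) blast
  obtain S where S: "S \<ge> 1" "\<And>M::int. (\<Sum>k=1..M. real_of_int k powr (-5/4)) \<le> S" by (rule p_series_bound) blast
  show thesis
  proof (rule that[of "8 + K * (2 + S)"])
    show "8 + K * (2 + S) \<ge> 0" using K S by simp
    fix Y :: real assume Y: "1 \<le> Y"
    define N where "N = nat \<lfloor>Y\<rfloor>"
    have N: "real N \<le> Y" "Y \<le> real N + 1" "N \<ge> 1" unfolding N_def using Y by linarith+
    define l where "l = (\<lambda>(y1, y2, y3). lattice_min y1 y2 y3)"
    let ?B = "primitive_box c Y"
    have B: "finite ?B" "real (card ?B) \<le> 8 * Y ^ 3" using card_primitive_box[of c Y] c Y by simp_all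
    have l1: "1 \<le> l y" if "y \<in> ?B" for y
    proof -
      obtain y1 y2 y3 where y: "y = (y1, y2, y3)" by (cases y)
      have "0 < c * Y" using c Y by simp
      moreover have "c * Y \<le> \<bar>real_of_int y3\<bar>" using that unfolding y primitive_box_def box3_def by blast
      ultimately have "y3 \<noteq> 0" by (cases "y3 = 0") simp_all
      thus ?thesis unfolding y l_def prod.case by (rule lattice_min_pos)
    qed
    have sets: "{y \<in> ?B. l y \<le> j} = {(y1, y2, y3) \<in> ?B. real (lattice_min y1 y2 y3) \<le> real j}" for j
      unfolding l_def of_nat_le_iff by auto
    have S1: "(\<Sum>j=1..N. real j powr (-3/2)) \<le> S"
    proof -
      have "(\<Sum>j=1..N. real j powr (-3/2)) \<le> (\<Sum>j=1..N. real j powr (-5/4))"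
        by (intro sum_mono powr_mono) auto
      also have "\<dots> = (\<Sum>k=1..int N. real_of_int k powr (-5/4))"
        by (rule sum.reindex_bij_witness[of _ nat int]) auto
      also have "\<dots> \<le> S" by (rule S(2))
      finally show ?thesis .
    qed
    have "(\<Sum>(y1, y2, y3)\<in>?B. 1 / real (lattice_min y1 y2 y3)) = (\<Sum>y\<in>?B. 1 / real (l y))"
      by (rule sum.cong) (simp_all add: l_def split: prod.splits)
    also have "\<dots> \<le> card ?B / (real N + 1) + (\<Sum>j=1..N. 1 / (real j)\<^sup>2 * card {y \<in> ?B. l y \<le> j})"
      by (rule sum_inverse_le_layers[OF B(1) l1])
    also have "\<dots> \<le> 8 * Y\<^sup>2 + (\<Sum>j=1..N. K * (Y powr (5/4) * real j powr (-1/4) + Y powr 2 * real j powr (-3/2)))"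
    proof (rule add_mono)
      have "card ?B / (real N + 1) \<le> 8 * Y ^ 3 / Y" using B(2) N Y by (intro frac_le) auto
      also have "\<dots> = 8 * Y\<^sup>2" using Y by (simp add: power2_eq_square power3_eq_cube)
      finally show "card ?B / (real N + 1) \<le> 8 * Y\<^sup>2" .
      show "(\<Sum>j=1..N. 1 / (real j)\<^sup>2 * card {y \<in> ?B. l y \<le> j}) \<le>
        (\<Sum>j=1..N. K * (Y powr (5/4) * real j powr (-1/4) + Y powr 2 * real j powr (-3/2)))"
      proof (rule sum_mono)
        fix j assume "j \<in> {1..N}"
        hence j: "1 \<le> real j" by simp
        have "1 / (real j)\<^sup>2 * card {y \<in> ?B. l y \<le> j} \<le>
            1 / (real j)\<^sup>2 * (K * (real j powr (7/4) * Y powr (5/4) + real j powr (1/2) * Y powr 2))"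
          unfolding sets by (rule mult_left_mono[OF K(2)[OF j Y]]) simp
        also have sq: "1 / (real j)\<^sup>2 = real j powr (-2)" using j by (simp add: powr_minus_divide)
        also have "real j powr (-2) * (K * (real j powr (7/4) * Y powr (5/4) + real j powr (1/2) * Y powr 2)) =
            K * (Y powr (5/4) * (real j powr (-2) * real j powr (7/4)) + Y powr 2 * (real j powr (-2) * real j powr (1/2)))"
          by (simp only: algebra_simps)
        also have "real j powr (-2) * real j powr (7/4) = real j powr (-1/4)" by (simp flip: powr_add)
        also have "real j powr (-2) * real j powr (1/2) = real j powr (-3/2)" by (simp flip: powr_add)
        finally show "1 / (real j)\<^sup>2 * card {y \<in> ?B. l y \<le> j} \<le>
          K * (Y powr (5/4) * real j powr (-1/4) + Y powr 2 * real j powr (-3/2))" unfolding sq .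
      qed
    qed
    also have "(\<Sum>j=1..N. K * (Y powr (5/4) * real j powr (-1/4) + Y powr 2 * real j powr (-3/2))) =
        K * (Y powr (5/4) * (\<Sum>j=1..N. real j powr (-1/4)) + Y powr 2 * (\<Sum>j=1..N. real j powr (-3/2)))"
      by (simp only: sum_distrib_left[symmetric] sum.distrib)
    also have "\<dots> \<le> K * (Y powr (5/4) * (2 * Y powr (3/4)) + Y powr 2 * S)"
    proof (intro mult_left_mono add_mono S1)
      have "(\<Sum>j=1..N. real j powr (-1/4)) \<le> 2 * real N powr (3/4)" by (rule sum_powr_neg_quarter)
      also have "\<dots> \<le> 2 * Y powr (3/4)" using N by (intro mult_left_mono powr_mono2) simp_all
      finally show "(\<Sum>j=1..N. real j powr (-1/4)) \<le> 2 * Y powr (3/4)" .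
    qed (use K in simp_all)
    also have "Y powr (5/4) * (2 * Y powr (3/4)) = 2 * Y powr 2" by (simp flip: powr_add)
    also have "Y powr 2 = Y\<^sup>2" using Y by simp
    finally show "(\<Sum>(y1, y2, y3)\<in>?B. 1 / real (lattice_min y1 y2 y3)) \<le> (8 + K * (2 + S)) * Y\<^sup>2"
      by (simp add: algebra_simps)
  qed
qed

section \<open>Lattice sums of Lipschitz functions\<close>

text \<open>In the coordinate where \<open>v\<close> attains its norm \<open>l\<close>, each block
  of length \<open>l\<close> contains at most one point: two points of one block are closer than
  \<open>l\<close> there and hence, their difference being parallel to \<open>v\<close>, also in the
  other coordinate. The range meets at most \<open>(hi - lo) / l + 2\<close> blocks.\<close>

lemma card_separated_line:
  fixes P :: "(int \<times> int) set" and v1 v2 l lo hi :: int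
  assumes l: "l \<ge> 1" and v: "max \<bar>v1\<bar> \<bar>v2\<bar> = l" and lohi: "lo \<le> hi"
    and box: "\<And>p1 p2. (p1, p2) \<in> P \<Longrightarrow> lo \<le> p1 \<and> p1 \<le> hi \<and> lo \<le> p2 \<and> p2 \<le> hi"
    and par: "\<And>p1 p2 q1 q2. (p1, p2) \<in> P \<Longrightarrow> (q1, q2) \<in> P \<Longrightarrow> (p1 - q1) * v2 = (p2 - q2) * v1"
    and sep: "\<And>p1 p2 q1 q2. (p1, p2) \<in> P \<Longrightarrow> (q1, q2) \<in> P \<Longrightarrow> \<bar>p1 - q1\<bar> < l \<Longrightarrow> \<bar>p2 - q2\<bar> < l \<Longrightarrow> p1 = q1 \<and> p2 = q2"
  shows "real (card P) \<le> (hi - lo) / l + 2"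
proof -
  define f where "f = (\<lambda>(p1, p2). (if \<bar>v1\<bar> = l then p1 else p2) div l)"
  have l0: "l > 0" using l by simp
  have close: "\<bar>a - b\<bar> < l" if "a div l = b div l" for a b :: int
  proof -
    have "l * (a div l) = l * (b div l)" using that by simp
    hence "a - b = a mod l - b mod l" using mult_div_mod_eq[of l a] mult_div_mod_eq[of l b] by linarith
    thus ?thesis using pos_mod_sign[OF l0, of a] pos_mod_bound[OF l0, of a] pos_mod_sign[OF l0, of b] pos_mod_bound[OF l0, of b]
      by linarith
  qed
  have other: "\<bar>b\<bar> < l" if "\<bar>a\<bar> < l" "a * w = b * u" "\<bar>u\<bar> = l" "\<bar>w\<bar> \<le> l" for a b u w :: int
  proof -
    have "\<bar>b\<bar> * l = \<bar>a\<bar> * \<bar>w\<bar>" using that(2,3) by (metis abs_mult)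
    also have "\<dots> \<le> \<bar>a\<bar> * l" using that(4) by (intro mult_left_mono) simp_all
    finally have "\<bar>b\<bar> \<le> \<bar>a\<bar>" using l0 by simp
    thus ?thesis using that(1) by linarith
  qed
  have inj: "inj_on f P"
  proof (rule inj_onI)
    fix p q assume p: "p \<in> P" and q: "q \<in> P" and eq: "f p = f q"
    obtain p1 p2 where pp: "p = (p1, p2)" by (cases p)
    obtain q1 q2 where qq: "q = (q1, q2)" by (cases q)
    note P = p[unfolded pp] and Q = q[unfolded qq]
    have vb: "\<bar>v1\<bar> \<le> l" "\<bar>v2\<bar> \<le> l" using v by linarith+
    have "\<bar>p1 - q1\<bar> < l \<and> \<bar>p2 - q2\<bar> < l"
    proof (cases "\<bar>v1\<bar> = l")
      case True
      have "\<bar>p1 - q1\<bar> < l" using eq True unfolding f_def pp qq by (intro close) simp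
      with other[OF this par[OF P Q] True vb(2)] show ?thesis by simp
    next
      case False
      hence v2: "\<bar>v2\<bar> = l" using v by linarith
      have "\<bar>p2 - q2\<bar> < l" using eq False unfolding f_def pp qq by (intro close) simp
      with other[OF this par[OF P Q, symmetric] v2 vb(1)] show ?thesis by simp
    qed
    with sep[OF P Q] show "p = q" unfolding pp qq by simp
  qed
  have sub: "f ` P \<subseteq> {lo div l..hi div l}"
  proof (rule image_subsetI)
    fix p assume p: "p \<in> P"
    obtain p1 p2 where pp: "p = (p1, p2)" by (cases p)
    show "f p \<in> {lo div l..hi div l}" using box[OF p[unfolded pp]] l0 unfolding f_def pp
      by (simp add: zdiv_mono1)
  qed
  have "card P = card (f ` P)" using inj by (simp add: card_image)
  also have "\<dots> \<le> card {lo div l..hi div l}" using sub by (intro card_mono) simp_all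
  also have "real \<dots> = real_of_int (hi div l) - real_of_int (lo div l) + 1"
    using zdiv_mono1[OF lohi l0] by simp
  also have "\<dots> \<le> (hi - lo) / l + 2"
  proof -
    have "real_of_int (hi div l) \<le> hi / l"
      using of_int_floor_le[of "real_of_int hi / real_of_int l"] unfolding floor_divide_of_int_eq .
    moreover have "real_of_int (lo div l) \<ge> lo / l - 1"
      using floor_correct[of "real_of_int lo / real_of_int l"] unfolding floor_divide_of_int_eq by simp
    ultimately show ?thesis by (simp add: diff_divide_distrib)
  qed
  finally show ?thesis by simp
qed

section \<open>Successive minima and cosets of the lattice\<close>

lemma is_lattice_vector_diff:
  "is_lattice_vector y1 y2 y3 a b \<Longrightarrow> is_lattice_vector y1 y2 y3 a' b' \<Longrightarrow> is_lattice_vector y1 y2 y3 (a - a') (b - b')"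
  unfolding is_lattice_vector_def by (drule (1) dvd_diff) (simp add: algebra_simps)

lemma is_lattice_vector_diff_if_mod_eq:
  assumes "(a * y1\<^sup>2 + b * y2\<^sup>2) mod y3\<^sup>2 = (a' * y1\<^sup>2 + b' * y2\<^sup>2) mod y3\<^sup>2"
  shows "is_lattice_vector y1 y2 y3 (a - a') (b - b')"
proof -
  have "y3\<^sup>2 dvd (a * y1\<^sup>2 + b * y2\<^sup>2) - (a' * y1\<^sup>2 + b' * y2\<^sup>2)" using assms by (simp add: mod_eq_dvd_iff)
  thus ?thesis unfolding is_lattice_vector_def by (simp add: algebra_simps)
qed

lemma is_lattice_vector_lincomb:
  "is_lattice_vector y1 y2 y3 a b \<Longrightarrow> is_lattice_vector y1 y2 y3 a' b' \<Longrightarrow>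
   is_lattice_vector y1 y2 y3 (i * a + j * a') (i * b + j * b')"
  unfolding is_lattice_vector_def
proof -
  assume "y3\<^sup>2 dvd a * y1\<^sup>2 + b * y2\<^sup>2" "y3\<^sup>2 dvd a' * y1\<^sup>2 + b' * y2\<^sup>2"
  hence "y3\<^sup>2 dvd (a * y1\<^sup>2 + b * y2\<^sup>2) * i + (a' * y1\<^sup>2 + b' * y2\<^sup>2) * j" by (simp add: dvd_add dvd_mult2)
  thus "y3\<^sup>2 dvd (i * a + j * a') * y1\<^sup>2 + (i * b + j * b') * y2\<^sup>2" by (simp add: algebra_simps)
qed

lemma lattice_min_le_max:
  assumes "is_lattice_vector y1 y2 y3 a b" "(a, b) \<noteq> (0, 0)"
  shows "int (lattice_min y1 y2 y3) \<le> max \<bar>a\<bar> \<bar>b\<bar>"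
proof -
  have 0: "int (nat (max \<bar>a\<bar> \<bar>b\<bar>)) = max \<bar>a\<bar> \<bar>b\<bar>" by (rule nat_0_le) (simp only: le_max_iff_disj abs_ge_zero simp_thms)
  have "lattice_min y1 y2 y3 \<le> nat (max \<bar>a\<bar> \<bar>b\<bar>)"
    by (rule lattice_min_le[OF assms(2) _ _ assms(1)]; unfold 0; rule max.cobounded1 max.cobounded2)
  thus ?thesis using 0 by linarith
qed

text \<open>Thue's pigeonhole argument: the box with both sides \<open>{0..\<bar>y3\<bar>}\<close>
  has more points than there are residues modulo \<open>y3^2\<close>, so two of its points differ by
  a lattice vector.\<close>

lemma lattice_min_le_abs:
  assumes "y3 \<noteq> 0"
  shows "int (lattice_min y1 y2 y3) \<le> \<bar>y3\<bar>"
proof -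
  define n where "n = y3\<^sup>2"
  have n0: "n > 0" using assms by (simp add: n_def)
  define B where "B = {0..\<bar>y3\<bar>} \<times> {0..\<bar>y3\<bar>}"
  define f where "f = (\<lambda>(a, b). (a * y1\<^sup>2 + b * y2\<^sup>2) mod n)"
  have "card B = nat (\<bar>y3\<bar> + 1) * nat (\<bar>y3\<bar> + 1)" by (simp add: B_def card_cartesian_product)
  also have "\<dots> > nat n"
  proof -
    have "n < (\<bar>y3\<bar> + 1) * (\<bar>y3\<bar> + 1)" unfolding n_def power2_abs[of y3, symmetric] power2_eq_square
      by (simp add: algebra_simps)
    thus ?thesis using n0 by (subst nat_mult_distrib[symmetric]) simp_all
  qed
  finally have card: "card {0..<n} < card B" by simp
  have "f ` B \<subseteq> {0..<n}" unfolding f_def using n0 by auto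
  hence "card (f ` B) < card B" using card card_mono[of "{0..<n}" "f ` B"] by simp
  hence "\<not> inj_on f B" by (rule pigeonhole)
  then obtain p q where pq: "p \<in> B" "q \<in> B" "p \<noteq> q" "f p = f q" unfolding inj_on_def by blast
  obtain a b where p: "p = (a, b)" by (cases p)
  obtain a' b' where q: "q = (a', b')" by (cases q)
  have "is_lattice_vector y1 y2 y3 (a - a') (b - b')"
    by (rule is_lattice_vector_diff_if_mod_eq) (use pq(4) in \<open>simp add: f_def p q n_def\<close>)
  moreover have "(a - a', b - b') \<noteq> (0, 0)" using pq(3) p q by simp
  ultimately have "int (lattice_min y1 y2 y3) \<le> max \<bar>a - a'\<bar> \<bar>b - b'\<bar>" by (rule lattice_min_le_max)
  also have "\<dots> \<le> \<bar>y3\<bar>" using pq(1,2) unfolding p q B_def by simp linarith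
  finally show ?thesis .
qed

text \<open>
  Pigeonhole in a box of side \<open>4 n / l\<close>: if all differences were parallel to the shortest vector,
  every residue class would meet the box in too few points.
\<close>

lemma exists_second_lattice_vector:
  fixes y1 y2 y3 v1 v2 :: int
  assumes y3: "y3 \<noteq> 0" and v: "max \<bar>v1\<bar> \<bar>v2\<bar> = int (lattice_min y1 y2 y3)"
  obtains w1 w2 where "is_lattice_vector y1 y2 y3 w1 w2" "w1 * v2 \<noteq> w2 * v1"
    "real_of_int (max \<bar>w1\<bar> \<bar>w2\<bar>) \<le> 4 * real_of_int (y3\<^sup>2) / real (lattice_min y1 y2 y3)"
proof (rule ccontr)
  assume neg: "\<not> thesis"
  note outer = that
  define n where "n = y3\<^sup>2"
  have n0: "n > 0" using y3 by (simp add: n_def)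
  define l where "l = int (lattice_min y1 y2 y3)"
  have l1: "l \<ge> 1" using lattice_min_pos[OF y3, of y1 y2] by (simp add: l_def)
  have ll: "l * l \<le> n"
  proof -
    have "l \<le> \<bar>y3\<bar>" unfolding l_def by (rule lattice_min_le_abs[OF y3])
    hence "l * l \<le> \<bar>y3\<bar> * \<bar>y3\<bar>" using l1 by (intro mult_mono) simp_all
    thus ?thesis by (simp add: n_def power2_eq_square)
  qed
  define T where "T = 4 * n div l"
  have "T * l \<le> 4 * n" unfolding T_def
    using l1 mult_div_mod_eq[of l "4 * n"] pos_mod_sign[of l "4 * n"] by (simp only: mult.commute[of _ l]) linarith
  hence TT: "real_of_int T \<le> 4 * real_of_int n / l" using l1 by (simp add: pos_le_divide_eq flip: of_int_mult)
  have "(4 * l) * l div l \<le> T" unfolding T_def by (rule zdiv_mono1) (use ll l1 in simp_all)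
  hence Tl: "l \<le> T" using l1 by simp
  have "l * T + 4 * n mod l = 4 * n" unfolding T_def by (rule mult_div_mod_eq)
  moreover have "(T + 1) * l = l * T + l" by (subst mult.commute) (simp only: distrib_left mult_1_right)
  ultimately have Tgt: "4 * n < (T + 1) * l" using pos_mod_bound[of l "4 * n"] l1 by linarith
  have par: "w1 * v2 = w2 * v1" if "is_lattice_vector y1 y2 y3 w1 w2" "\<bar>w1\<bar> \<le> T" "\<bar>w2\<bar> \<le> T" for w1 w2
  proof (rule ccontr)
    assume "w1 * v2 \<noteq> w2 * v1"
    moreover have "real_of_int (max \<bar>w1\<bar> \<bar>w2\<bar>) \<le> 4 * real_of_int (y3\<^sup>2) / real (lattice_min y1 y2 y3)"
    proof -
      have "max \<bar>w1\<bar> \<bar>w2\<bar> \<le> T" using that by simp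
      hence "real_of_int (max \<bar>w1\<bar> \<bar>w2\<bar>) \<le> real_of_int T" by (rule of_int_le_iff[THEN iffD2])
      also note TT
      finally show ?thesis by (simp add: n_def l_def)
    qed
    ultimately show False using neg outer[OF that(1)] by blast
  qed
  define B where "B = {0..T} \<times> {0..T}"
  define P where "P = (\<lambda>r. {(a, b) \<in> B. (a * y1\<^sup>2 + b * y2\<^sup>2) mod n = r})"
  have cP: "real (card (P r)) \<le> T / l + 2" for r
  proof -
    have mem: "0 \<le> a \<and> a \<le> T \<and> 0 \<le> b \<and> b \<le> T \<and> (a * y1\<^sup>2 + b * y2\<^sup>2) mod n = r" if "(a, b) \<in> P r" for a b
      using that unfolding P_def B_def by simp
    have lat: "is_lattice_vector y1 y2 y3 (a - a') (b - b')" if "(a, b) \<in> P r" "(a', b') \<in> P r" for a b a' b'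
      by (rule is_lattice_vector_diff_if_mod_eq) (use mem[OF that(1)] mem[OF that(2)] in \<open>simp add: n_def\<close>)
    have "real (card (P r)) \<le> (T - 0) / l + 2"
    proof (rule card_separated_line[OF l1 v[folded l_def]])
      show "0 \<le> T" using Tl l1 by simp
      show "0 \<le> p1 \<and> p1 \<le> T \<and> 0 \<le> p2 \<and> p2 \<le> T" if "(p1, p2) \<in> P r" for p1 p2 using mem[OF that] by simp
      show "(p1 - q1) * v2 = (p2 - q2) * v1" if p: "(p1, p2) \<in> P r" and q: "(q1, q2) \<in> P r" for p1 p2 q1 q2
      proof (rule par[OF lat[OF p q]])
        show "\<bar>p1 - q1\<bar> \<le> T" using mem[OF p] mem[OF q] by linarith
        show "\<bar>p2 - q2\<bar> \<le> T" using mem[OF p] mem[OF q] by linarith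
      qed
      show "p1 = q1 \<and> p2 = q2" if p: "(p1, p2) \<in> P r" and q: "(q1, q2) \<in> P r" and
        "\<bar>p1 - q1\<bar> < l" "\<bar>p2 - q2\<bar> < l" for p1 p2 q1 q2
        using lattice_min_le_max[OF lat[OF p q]] that(3,4) unfolding l_def[symmetric] by force
    qed
    thus ?thesis by simp
  qed
  have "B \<subseteq> (\<Union>r\<in>{0..<n}. P r)" unfolding P_def using n0 by auto
  moreover have finP: "finite (P r)" for r unfolding P_def B_def
    by (rule finite_subset[of _ "{0..T} \<times> {0..T}"]) blast+
  ultimately have "card B \<le> card (\<Union>r\<in>{0..<n}. P r)" by (intro card_mono) simp_all
  also have "\<dots> \<le> (\<Sum>r\<in>{0..<n}. card (P r))" by (rule card_UN_le) simp
  finally have "real (card B) \<le> real (\<Sum>r\<in>{0..<n}. card (P r))" by (rule of_nat_mono)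
  also have "\<dots> = (\<Sum>r\<in>{0..<n}. real (card (P r)))" by (rule of_nat_sum)
  also have "\<dots> \<le> (\<Sum>r\<in>{0..<n}. T / l + 2)" by (intro sum_mono cP)
  also have "\<dots> = n * (T / l + 2)" using n0 by simp
  also have "real (card B) = (T + 1) * (T + 1)" using Tl l1 by (simp add: B_def card_cartesian_product)
  finally have "real_of_int ((T + 1) * (T + 1)) \<le> n * (T / l + 2)" .
  hence "real_of_int ((T + 1) * (T + 1)) * l \<le> n * (T / l + 2) * l" using l1 by (intro mult_right_mono) simp_all
  also have "\<dots> = real_of_int (n * (T + 2 * l))" using l1 by (simp add: field_simps)
  finally have "real_of_int ((T + 1) * (T + 1) * l) \<le> real_of_int (n * (T + 2 * l))" by simp
  hence 1: "(T + 1) * (T + 1) * l \<le> n * (T + 2 * l)" by (simp only: of_int_le_iff)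
  \<comment> \<open>Two facts about \<open>T\<close> collide with the count: \<open>l <= T\<close>
    bounds \<open>T + 2 * l\<close> by a multiple of \<open>T + 1\<close>, while
    \<open>T + 1\<close> exceeds \<open>4 * n / l\<close>. The side of the box is chosen for
    this.\<close>
  have "n * (T + 2 * l) \<le> n * (4 * (T + 1))" using Tl n0 l1 by (intro mult_left_mono) simp_all
  also have "\<dots> = (4 * n) * (T + 1)" by simp
  also have "\<dots> < ((T + 1) * l) * (T + 1)" using Tgt Tl l1 by (intro mult_strict_right_mono) simp_all
  also have "\<dots> = (T + 1) * (T + 1) * l" by simp
  finally show False using 1 by simp
qed

text \<open>The squares of a primitive triple again have gcd 1, so by Bezout the linear form in
  \<open>a\<close> and \<open>b\<close> takes every value modulo \<open>y3^2\<close>; for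
  \<open>y3 \<noteq> 0\<close> the index of the lattice is therefore exactly
  \<open>y3^2\<close>.\<close>

lemma exists_lattice_residue:
  fixes y1 y2 y3 r :: int
  assumes "gcd y1 (gcd y2 y3) = 1"
  obtains a b where "(a * y1\<^sup>2 + b * y2\<^sup>2) mod y3\<^sup>2 = r mod y3\<^sup>2"
proof -
  have "gcd (y1\<^sup>2) (gcd (y2\<^sup>2) (y3\<^sup>2)) = (gcd y1 (gcd y2 y3))\<^sup>2" by (simp only: gcd_exp)
  hence g: "gcd (y1\<^sup>2) (gcd (y2\<^sup>2) (y3\<^sup>2)) = 1" using assms by simp
  obtain u v where uv: "u * y1\<^sup>2 + v * gcd (y2\<^sup>2) (y3\<^sup>2) = gcd (y1\<^sup>2) (gcd (y2\<^sup>2) (y3\<^sup>2))" using bezout_int by blast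
  obtain s t where st: "s * y2\<^sup>2 + t * y3\<^sup>2 = gcd (y2\<^sup>2) (y3\<^sup>2)" using bezout_int by blast
  have "u * y1\<^sup>2 + v * (s * y2\<^sup>2 + t * y3\<^sup>2) = 1" unfolding st using uv g by simp
  hence "r = r * (u * y1\<^sup>2 + v * (s * y2\<^sup>2 + t * y3\<^sup>2))" by simp
  hence e: "r = (r * u) * y1\<^sup>2 + (r * v * s) * y2\<^sup>2 + (r * v * t) * y3\<^sup>2" by (simp add: algebra_simps)
  have "((r * u) * y1\<^sup>2 + (r * v * s) * y2\<^sup>2) mod y3\<^sup>2 = r mod y3\<^sup>2" by (subst (3) e) simp
  thus thesis by (rule that)
qed

text \<open>A representative is reduced into the parallelogram spanned by \<open>v\<close> and
  \<open>w\<close>: by Cramer's rule \<open>D\<close> times the point has coefficients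
  \<open>\<alpha>\<close> and \<open>\<beta>\<close> with respect to \<open>v\<close> and
  \<open>w\<close>, and division with remainder by \<open>D\<close> leaves coefficients of absolute
  value less than 1.\<close>

lemma exists_small_lattice_residue:
  fixes y1 y2 y3 r v1 v2 w1 w2 m :: int
  assumes gcd: "gcd y1 (gcd y2 y3) = 1"
    and v: "is_lattice_vector y1 y2 y3 v1 v2" and w: "is_lattice_vector y1 y2 y3 w1 w2"
    and D: "w1 * v2 \<noteq> w2 * v1" and m: "max \<bar>v1\<bar> \<bar>v2\<bar> \<le> m" "max \<bar>w1\<bar> \<bar>w2\<bar> \<le> m"
  obtains a b where "(a * y1\<^sup>2 + b * y2\<^sup>2) mod y3\<^sup>2 = r mod y3\<^sup>2" "\<bar>a\<bar> \<le> 2 * m" "\<bar>b\<bar> \<le> 2 * m"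
proof -
  obtain a b where ab: "(a * y1\<^sup>2 + b * y2\<^sup>2) mod y3\<^sup>2 = r mod y3\<^sup>2" by (rule exists_lattice_residue[OF gcd])
  define D where "D = v1 * w2 - v2 * w1"
  have D0: "D \<noteq> 0" using D unfolding D_def by (simp add: mult.commute)
  define \<alpha> where "\<alpha> = a * w2 - b * w1"
  define \<beta> where "\<beta> = v1 * b - v2 * a"
  define i where "i = \<alpha> div D"
  define j where "j = \<beta> div D"
  have lat: "is_lattice_vector y1 y2 y3 (i * v1 + j * w1) (i * v2 + j * w2)" by (rule is_lattice_vector_lincomb[OF v w])
  define a' where "a' = a - (i * v1 + j * w1)"
  define b' where "b' = b - (i * v2 + j * w2)"
  have "(a' * y1\<^sup>2 + b' * y2\<^sup>2) - (a * y1\<^sup>2 + b * y2\<^sup>2) = - ((i * v1 + j * w1) * y1\<^sup>2 + (i * v2 + j * w2) * y2\<^sup>2)"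
    by (simp add: a'_def b'_def algebra_simps)
  moreover have "y3\<^sup>2 dvd - ((i * v1 + j * w1) * y1\<^sup>2 + (i * v2 + j * w2) * y2\<^sup>2)"
    using lat unfolding is_lattice_vector_def dvd_minus_iff .
  ultimately have "(a' * y1\<^sup>2 + b' * y2\<^sup>2) mod y3\<^sup>2 = (a * y1\<^sup>2 + b * y2\<^sup>2) mod y3\<^sup>2" by (simp only: mod_eq_dvd_iff)
  hence res: "(a' * y1\<^sup>2 + b' * y2\<^sup>2) mod y3\<^sup>2 = r mod y3\<^sup>2" unfolding ab .
  have ij: "\<alpha> = i * D + \<alpha> mod D" "\<beta> = j * D + \<beta> mod D" unfolding i_def j_def by simp_all
  have "D * a = \<alpha> * v1 + \<beta> * w1" "D * b = \<alpha> * v2 + \<beta> * w2"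
    unfolding D_def \<alpha>_def \<beta>_def by (simp_all add: algebra_simps)
  moreover have "\<alpha> * v1 + \<beta> * w1 = D * (i * v1 + j * w1) + ((\<alpha> mod D) * v1 + (\<beta> mod D) * w1)"
    by (subst ij(1), subst ij(2)) (simp add: algebra_simps)
  moreover have "\<alpha> * v2 + \<beta> * w2 = D * (i * v2 + j * w2) + ((\<alpha> mod D) * v2 + (\<beta> mod D) * w2)"
    by (subst ij(1), subst ij(2)) (simp add: algebra_simps)
  ultimately have Da: "D * a' = (\<alpha> mod D) * v1 + (\<beta> mod D) * w1" "D * b' = (\<alpha> mod D) * v2 + (\<beta> mod D) * w2"
    unfolding a'_def b'_def by (simp_all add: right_diff_distrib)
  have small: "\<bar>x\<bar> \<le> 2 * m" if "D * x = (\<alpha> mod D) * s + (\<beta> mod D) * t" "\<bar>s\<bar> \<le> m" "\<bar>t\<bar> \<le> m" for x s t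
  proof -
    have "\<bar>D\<bar> * \<bar>x\<bar> = \<bar>(\<alpha> mod D) * s + (\<beta> mod D) * t\<bar>" using that(1) by (metis abs_mult)
    also have "\<dots> \<le> \<bar>(\<alpha> mod D) * s\<bar> + \<bar>(\<beta> mod D) * t\<bar>" by (rule abs_triangle_ineq)
    also have "\<dots> = \<bar>\<alpha> mod D\<bar> * \<bar>s\<bar> + \<bar>\<beta> mod D\<bar> * \<bar>t\<bar>" by (simp only: abs_mult)
    also have "\<dots> \<le> \<bar>D\<bar> * m + \<bar>D\<bar> * m"
    proof (intro add_mono mult_mono that(2,3))
      show "\<bar>\<alpha> mod D\<bar> \<le> \<bar>D\<bar>" "\<bar>\<beta> mod D\<bar> \<le> \<bar>D\<bar>" using abs_mod_less[OF D0] by (simp_all add: less_imp_le)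
    qed simp_all
    also have "\<dots> = \<bar>D\<bar> * (2 * m)" by simp
    finally show ?thesis using D0 by simp
  qed
  have "\<bar>v1\<bar> \<le> m" "\<bar>v2\<bar> \<le> m" "\<bar>w1\<bar> \<le> m" "\<bar>w2\<bar> \<le> m" using m by linarith+
  hence "\<bar>a'\<bar> \<le> 2 * m" "\<bar>b'\<bar> \<le> 2 * m" using small[OF Da(1)] small[OF Da(2)] by simp_all
  with that[OF res] show thesis by blast
qed

text \<open>
  If the second minimum is at most \<open>N\<close>, the sum over the lattice is compared with the sum over each
  of its cosets, shifted by a small representative; otherwise all lattice points in the box are
  multiples of the shortest vector and both sums are small.
\<close>

lemma lattice_sum_approx:
  fixes y1 y2 y3 N :: int and \<phi> :: "int \<times> int \<Rightarrow> real" and M C :: real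
  assumes gcd: "gcd y1 (gcd y2 y3) = 1" and y3: "y3 \<noteq> 0" and N: "N \<ge> 1"
    and supp: "\<And>a b. \<bar>a\<bar> > N \<or> \<bar>b\<bar> > N \<Longrightarrow> \<phi> (a, b) = 0"
    and bound: "\<And>p. \<bar>\<phi> p\<bar> \<le> M"
    and lip: "\<And>a b a' b'. \<bar>\<phi> (a, b) - \<phi> (a', b')\<bar> \<le> C / N * (\<bar>real_of_int (a - a')\<bar> + \<bar>real_of_int (b - b')\<bar>)"
  defines "Bx \<equiv> {-N..N} \<times> {-N..N}"
  shows "\<bar>(\<Sum>(a, b)\<in>{(a, b) \<in> Bx. is_lattice_vector y1 y2 y3 a b}. \<phi> (a, b)) - (\<Sum>p\<in>Bx. \<phi> p) / real_of_int (y3\<^sup>2)\<bar>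
    \<le> (38 * M + 4000 * C) * (1 + N / lattice_min y1 y2 y3)"
proof -
  define n where "n = y3\<^sup>2"
  have n0: "n > 0" using y3 by (simp add: n_def)
  define l where "l = int (lattice_min y1 y2 y3)"
  have l1: "l \<ge> 1" using lattice_min_pos[OF y3, of y1 y2] by (simp add: l_def)
  have M0: "M \<ge> 0" using bound[of "(0, 0)"] by linarith
  have C0: "C \<ge> 0"
  proof -
    have "0 \<le> C / N * (\<bar>real_of_int (1 - 0)\<bar> + \<bar>real_of_int (0 - 0)\<bar>)" using lip[of 1 0 0 0] by linarith
    hence "0 \<le> C / N" by simp
    thus ?thesis using N by (simp add: zero_le_divide_iff)
  qed
  obtain v1 v2 where v: "(v1, v2) \<noteq> (0, 0)" "\<bar>v1\<bar> \<le> l" "\<bar>v2\<bar> \<le> l" "is_lattice_vector y1 y2 y3 v1 v2"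
    unfolding l_def by (rule lattice_min_attained[OF y3])
  have vl: "max \<bar>v1\<bar> \<bar>v2\<bar> = l" using lattice_min_le_max[OF v(4,1)] v(2,3) unfolding l_def[symmetric] by linarith
  define Lat where "Lat = (\<lambda>K. {(a, b) \<in> {-K..K} \<times> {-K..K}. is_lattice_vector y1 y2 y3 a b})"
  have finLat: "finite (Lat K)" for K unfolding Lat_def by (rule finite_subset[of _ "{-K..K} \<times> {-K..K}"]) blast+
  have Lat: "(a, b) \<in> Lat K \<longleftrightarrow> \<bar>a\<bar> \<le> K \<and> \<bar>b\<bar> \<le> K \<and> is_lattice_vector y1 y2 y3 a b" for a b K
    unfolding Lat_def by (simp add: abs_le_iff) linarith
  let ?L = "\<Sum>p\<in>Lat N. \<phi> p" and ?A = "\<Sum>p\<in>Bx. \<phi> p"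
  have goal_eq: "(\<Sum>(a, b)\<in>{(a, b) \<in> Bx. is_lattice_vector y1 y2 y3 a b}. \<phi> (a, b)) = ?L"
    unfolding Lat_def Bx_def by (rule sum.cong) simp_all
  have "\<bar>?L - ?A / n\<bar> \<le> (38 * M + 4000 * C) * (1 + N / l)"
  proof (cases "\<exists>w1 w2. is_lattice_vector y1 y2 y3 w1 w2 \<and> w1 * v2 \<noteq> w2 * v1 \<and> max \<bar>w1\<bar> \<bar>w2\<bar> \<le> N")
    case False
    hence par: "w1 * v2 = w2 * v1" if "is_lattice_vector y1 y2 y3 w1 w2" "\<bar>w1\<bar> \<le> N" "\<bar>w2\<bar> \<le> N" for w1 w2
      using that by simp blast
    obtain w1 w2 where w: "is_lattice_vector y1 y2 y3 w1 w2" "w1 * v2 \<noteq> w2 * v1"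
      "real_of_int (max \<bar>w1\<bar> \<bar>w2\<bar>) \<le> 4 * real_of_int n / l"
      using exists_second_lattice_vector[OF y3 vl[unfolded l_def]] unfolding n_def l_def by auto
    \<comment> \<open>A second independent vector always exists within \<open>4 * n / l\<close>, so
      in this case \<open>N\<close> is smaller than that, and the mean value \<open>?A / n\<close>
      is only of order \<open>N / l\<close>.\<close>
    have "N < max \<bar>w1\<bar> \<bar>w2\<bar>" using False w(1,2) by force
    hence "real_of_int N \<le> 4 * real_of_int n / l" using w(3) by linarith
    hence Nn: "real_of_int N / n \<le> 4 / l" using n0 l1 by (simp add: field_simps)
    have scale: "a * v2 = b * v1" if "(a, b) \<in> Lat N" for a b using that par unfolding Lat by blast
    have "real (card (Lat N)) \<le> (N - (-N)) / l + 2"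
    proof (rule card_separated_line[OF l1 vl])
      show "- N \<le> N" using N by simp
      show "- N \<le> p1 \<and> p1 \<le> N \<and> - N \<le> p2 \<and> p2 \<le> N" if "(p1, p2) \<in> Lat N" for p1 p2
        using that unfolding Lat by linarith
      show "(p1 - q1) * v2 = (p2 - q2) * v1" if "(p1, p2) \<in> Lat N" "(q1, q2) \<in> Lat N" for p1 p2 q1 q2
        using scale[OF that(1)] scale[OF that(2)] by (simp add: left_diff_distrib)
      show "p1 = q1 \<and> p2 = q2" if "(p1, p2) \<in> Lat N" "(q1, q2) \<in> Lat N" "\<bar>p1 - q1\<bar> < l" "\<bar>p2 - q2\<bar> < l" for p1 p2 q1 q2
      proof (rule ccontr)
        assume "\<not> ?thesis"
        hence "(p1 - q1, p2 - q2) \<noteq> (0, 0)" by auto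
        moreover have "is_lattice_vector y1 y2 y3 (p1 - q1) (p2 - q2)"
          using that(1,2) unfolding Lat by (blast intro: is_lattice_vector_diff)
        ultimately have "l \<le> max \<bar>p1 - q1\<bar> \<bar>p2 - q2\<bar>" unfolding l_def by (intro lattice_min_le_max)
        thus False using that(3,4) by linarith
      qed
    qed
    hence cL: "real (card (Lat N)) \<le> 2 * N / l + 2" by simp
    have "\<bar>?L\<bar> \<le> (\<Sum>p\<in>Lat N. \<bar>\<phi> p\<bar>)" by (rule sum_abs)
    also have "\<dots> \<le> (\<Sum>p\<in>Lat N. M)" by (intro sum_mono bound)
    also have "\<dots> = card (Lat N) * M" by simp
    also have "\<dots> \<le> (2 * N / l + 2) * M" using cL M0 by (rule mult_right_mono)
    finally have 1: "\<bar>?L\<bar> \<le> (2 * N / l + 2) * M" .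
    have "\<bar>?A\<bar> \<le> (\<Sum>p\<in>Bx. \<bar>\<phi> p\<bar>)" by (rule sum_abs)
    also have "\<dots> \<le> (\<Sum>p\<in>Bx. M)" by (intro sum_mono bound)
    also have "\<dots> = real_of_int ((2 * N + 1) * (2 * N + 1)) * M"
      using N by (simp add: Bx_def card_cartesian_product algebra_simps)
    also have "\<dots> \<le> real_of_int (9 * (N * N)) * M"
    proof (intro mult_right_mono M0)
      have "(2 * N + 1) * (2 * N + 1) \<le> (3 * N) * (3 * N)" by (rule mult_mono) (use N in linarith)+
      also have "\<dots> = 9 * (N * N)" by simp
      finally show "real_of_int ((2 * N + 1) * (2 * N + 1)) \<le> real_of_int (9 * (N * N))" by (simp only: of_int_le_iff)
    qed
    finally have "\<bar>?A\<bar> / n \<le> real_of_int (9 * (N * N)) * M / n" using n0 by (intro divide_right_mono) simp_all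
    also have "\<dots> = 9 * N * M * (real_of_int N / n)" by simp
    also have "\<dots> \<le> 9 * N * M * (4 / l)"
      by (rule mult_left_mono[OF Nn]) (use M0 N in simp)
    also have "9 * N * M * (4 / l) = 36 * M * (N / l)" by simp
    finally have 2: "\<bar>?A\<bar> / n \<le> 36 * M * (N / l)" .
    have "\<bar>?A / n\<bar> = \<bar>?A\<bar> / n" using n0 by simp
    hence "\<bar>?L - ?A / n\<bar> \<le> \<bar>?L\<bar> + \<bar>?A\<bar> / n" using abs_triangle_ineq4[of ?L "?A / n"] by (simp only:)
    also have "\<dots> \<le> (2 * N / l + 2) * M + 36 * M * (N / l)" by (rule add_mono[OF 1 2])
    also have "\<dots> = M * (2 + 38 * (N / l))" by (simp add: algebra_simps)
    also have "\<dots> \<le> M * (38 * (1 + N / l))" using M0 by (intro mult_left_mono) simp_all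
    also have "\<dots> = (38 * M) * (1 + N / l)" by simp
    also have "\<dots> \<le> (38 * M + 4000 * C) * (1 + N / l)" by (rule mult_right_mono) (use C0 N l1 in simp_all)
    finally show ?thesis .
  next
    case True
    \<comment> \<open>The least \<open>k\<close> with \<open>Q k\<close> is the second successive
      minimum. The shifts below are bounded by multiples of it, and \<open>l * k <= 4 * n\<close>
      finally turns the error into a multiple of \<open>N / l\<close>.\<close>
    define Q where "Q = (\<lambda>m. \<exists>w1 w2. is_lattice_vector y1 y2 y3 w1 w2 \<and> w1 * v2 \<noteq> w2 * v1 \<and> max \<bar>w1\<bar> \<bar>w2\<bar> = int m)"
    define k where "k = (LEAST m. Q m)"
    obtain u1 u2 where u: "is_lattice_vector y1 y2 y3 u1 u2" "u1 * v2 \<noteq> u2 * v1" "max \<bar>u1\<bar> \<bar>u2\<bar> \<le> N" using True by blast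
    have natmax: "int (nat (max \<bar>a\<bar> \<bar>b\<bar>)) = max \<bar>a\<bar> \<bar>b\<bar>" for a b :: int
      by (rule nat_0_le) (simp only: le_max_iff_disj abs_ge_zero simp_thms)
    have Qk: "Q k" unfolding k_def by (rule LeastI[of _ "nat (max \<bar>u1\<bar> \<bar>u2\<bar>)"]) (use u natmax in \<open>unfold Q_def, metis\<close>)
    then obtain w1 w2 where w: "is_lattice_vector y1 y2 y3 w1 w2" "w1 * v2 \<noteq> w2 * v1" "max \<bar>w1\<bar> \<bar>w2\<bar> = int k"
      unfolding Q_def by blast
    have kmin: "int k \<le> max \<bar>a\<bar> \<bar>b\<bar>" if "is_lattice_vector y1 y2 y3 a b" "a * v2 \<noteq> b * v1" for a b
    proof -
      have "k \<le> nat (max \<bar>a\<bar> \<bar>b\<bar>)" unfolding k_def by (rule Least_le) (use that natmax in \<open>unfold Q_def, metis\<close>)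
      thus ?thesis using natmax[of a b] by linarith
    qed
    have kN: "int k \<le> N" using kmin[OF u(1,2)] u(3) by linarith
    have wnz: "(w1, w2) \<noteq> (0, 0)" using w(2) by auto
    have lk: "l \<le> int k" using lattice_min_le_max[OF w(1) wnz] w(3) unfolding l_def by simp
    have kn: "real k \<le> 4 * real_of_int n / l"
    proof -
      obtain w1 w2 where w': "is_lattice_vector y1 y2 y3 w1 w2" "w1 * v2 \<noteq> w2 * v1"
        "real_of_int (max \<bar>w1\<bar> \<bar>w2\<bar>) \<le> 4 * real_of_int n / l"
        using exists_second_lattice_vector[OF y3 vl[unfolded l_def]] unfolding n_def l_def by auto
      have "real_of_int (int k) \<le> real_of_int (max \<bar>w1\<bar> \<bar>w2\<bar>)" using kmin[OF w'(1,2)] by (rule of_int_le_iff[THEN iffD2])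
      thus ?thesis using w'(3) by simp
    qed
    define \<rho> where "\<rho> = (\<lambda>(a, b). (a * y1\<^sup>2 + b * y2\<^sup>2) mod n)"
    have "\<exists>p. \<rho> p = r mod n \<and> \<bar>fst p\<bar> \<le> 2 * int k \<and> \<bar>snd p\<bar> \<le> 2 * int k" for r
    proof -
      have "max \<bar>v1\<bar> \<bar>v2\<bar> \<le> int k" "max \<bar>w1\<bar> \<bar>w2\<bar> \<le> int k" using vl lk w(3) by simp_all
      from exists_small_lattice_residue[OF gcd v(4) w(1,2) this, of r] show ?thesis
        unfolding \<rho>_def n_def by (metis case_prod_conv fst_conv snd_conv)
    qed
    then obtain \<alpha> where \<alpha>: "\<rho> (\<alpha> r) = r mod n" "\<bar>fst (\<alpha> r)\<bar> \<le> 2 * int k" "\<bar>snd (\<alpha> r)\<bar> \<le> 2 * int k" for r by metis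
    define s where "s = (\<lambda>r (z :: int \<times> int). (fst z + fst (\<alpha> r), snd z + snd (\<alpha> r)))"
    \<comment> \<open>Points of \<open>Bx\<close> shifted by a representative of size at most
      \<open>2 * k <= 2 * N\<close> stay within \<open>3 * N\<close>, so that one index set
      \<open>Z\<close> serves all cosets.\<close>
    define Z where "Z = Lat (3 * N)"
    have finZ: "finite Z" unfolding Z_def by (rule finLat)
    have Zmem: "(a, b) \<in> Z \<longleftrightarrow> \<bar>a\<bar> \<le> 3 * N \<and> \<bar>b\<bar> \<le> 3 * N \<and> n dvd a * y1\<^sup>2 + b * y2\<^sup>2" for a b
      unfolding Z_def Lat is_lattice_vector_def n_def by simp
    have \<rho>s: "\<rho> (s r z) = r" if "z \<in> Z" "r \<in> {0..<n}" for z r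
    proof -
      obtain a b where z: "z = (a, b)" by (cases z)
      obtain c d where c: "\<alpha> r = (c, d)" by (cases "\<alpha> r")
      have "n dvd a * y1\<^sup>2 + b * y2\<^sup>2" using that(1) unfolding z Zmem by blast
      then obtain t where t: "a * y1\<^sup>2 + b * y2\<^sup>2 = n * t" by auto
      have "(a + c) * y1\<^sup>2 + (b + d) * y2\<^sup>2 = (c * y1\<^sup>2 + d * y2\<^sup>2) + n * t" unfolding t[symmetric] by (simp add: algebra_simps)
      hence "\<rho> (s r z) = \<rho> (\<alpha> r)" unfolding s_def z c \<rho>_def by simp
      thus ?thesis using \<alpha>(1)[of r] that(2) by simp
    qed
    \<comment> \<open>The \<open>n\<close> translates of \<open>Z\<close> are disjoint and lie in
      the box of radius \<open>5 * N\<close>, which has at most \<open>(11 * N)^2\<close>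
      points.\<close>
    have cZ: "n * real (card Z) \<le> 121 * (real_of_int N)\<^sup>2"
    proof -
      define f where "f = (\<lambda>(r, z). s r z)"
      have "inj_on f ({0..<n} \<times> Z)"
      proof (rule inj_onI)
        fix p q assume p: "p \<in> {0..<n} \<times> Z" and q: "q \<in> {0..<n} \<times> Z" and e: "f p = f q"
        obtain r z where pp: "p = (r, z)" by (cases p)
        obtain r' z' where qq: "q = (r', z')" by (cases q)
        have sz: "s r z = s r' z'" using e by (simp add: f_def pp qq)
        have "r = r'" using \<rho>s[of z r] \<rho>s[of z' r'] sz p q unfolding pp qq by simp
        moreover have "z = z'" using sz unfolding s_def \<open>r = r'\<close> by (simp add: prod_eq_iff)
        ultimately show "p = q" unfolding pp qq by simp
      qed
      hence "card ({0..<n} \<times> Z) = card (f ` ({0..<n} \<times> Z))" by (simp add: card_image)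
      also have "\<dots> \<le> card ({-(5 * N)..5 * N} \<times> {-(5 * N)..5 * N})"
      proof (rule card_mono)
        show "f ` ({0..<n} \<times> Z) \<subseteq> {-(5 * N)..5 * N} \<times> {-(5 * N)..5 * N}"
        proof (rule image_subsetI)
          fix p assume p: "p \<in> {0..<n} \<times> Z"
          obtain r a b where pp: "p = (r, (a, b))" by (cases p) auto
          have "\<bar>a\<bar> \<le> 3 * N" "\<bar>b\<bar> \<le> 3 * N" using p unfolding pp using Zmem by blast+
          thus "f p \<in> {-(5 * N)..5 * N} \<times> {-(5 * N)..5 * N}"
            using \<alpha>(2,3)[of r] kN unfolding f_def pp s_def by simp linarith
        qed
      qed simp
      also have "\<dots> = nat (10 * N + 1) * nat (10 * N + 1)" using N by (simp add: card_cartesian_product)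
      finally have "real (card ({0..<n} \<times> Z)) \<le> real (nat (10 * N + 1) * nat (10 * N + 1))" by (rule of_nat_mono)
      also have "\<dots> = (10 * real_of_int N + 1)\<^sup>2" using N by (simp add: power2_eq_square)
      also have "\<dots> \<le> (11 * real_of_int N)\<^sup>2" using N by (intro power_mono) simp_all
      finally show ?thesis using n0 by (simp add: card_cartesian_product power2_eq_square)
    qed
    have zero: "\<phi> z = 0" if "z \<notin> Bx" for z
    proof -
      obtain a b where z: "z = (a, b)" by (cases z)
      show ?thesis unfolding z by (rule supp) (use that in \<open>unfold z Bx_def, simp, linarith\<close>)
    qed
    have finB: "finite Bx" unfolding Bx_def by blast
    have shift: "(\<Sum>p\<in>{p \<in> Bx. \<rho> p = r}. \<phi> p) = (\<Sum>z\<in>Z. \<phi> (s r z))" if r: "r \<in> {0..<n}" for r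
    proof -
      define t where "t = (\<lambda>p :: int \<times> int. (fst p - fst (\<alpha> r), snd p - snd (\<alpha> r)))"
      have st: "s r (t p) = p" "t (s r p) = p" for p unfolding s_def t_def by simp_all
      have tZ: "t p \<in> Z" if p: "p \<in> {p \<in> Bx. \<rho> p = r}" for p
      proof -
        obtain a b where pp: "p = (a, b)" by (cases p)
        obtain c d where c: "\<alpha> r = (c, d)" by (cases "\<alpha> r")
        have "(a * y1\<^sup>2 + b * y2\<^sup>2) mod n = (c * y1\<^sup>2 + d * y2\<^sup>2) mod n"
          using p \<alpha>(1)[of r] r unfolding \<rho>_def c pp by simp
        hence "n dvd (a * y1\<^sup>2 + b * y2\<^sup>2) - (c * y1\<^sup>2 + d * y2\<^sup>2)" by (simp add: mod_eq_dvd_iff)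
        hence "n dvd (a - c) * y1\<^sup>2 + (b - d) * y2\<^sup>2" by (simp add: algebra_simps)
        moreover have "\<bar>a - c\<bar> \<le> 3 * N" "\<bar>b - d\<bar> \<le> 3 * N"
          using p \<alpha>(2,3)[of r] kN unfolding c pp Bx_def by (simp_all, linarith+)
        ultimately show ?thesis unfolding t_def c pp fst_conv snd_conv Zmem by blast
      qed
      have "(\<Sum>p\<in>{p \<in> Bx. \<rho> p = r}. \<phi> p) = (\<Sum>z\<in>{z \<in> Z. s r z \<in> Bx}. \<phi> (s r z))"
        by (rule sum.reindex_bij_witness[of _ "s r" t]) (use st tZ \<rho>s[OF _ r] in simp_all)
      also have "\<dots> = (\<Sum>z\<in>Z. \<phi> (s r z))"
        by (rule sum.mono_neutral_left[OF finZ]) (use zero in \<open>simp_all add: subset_eq\<close>)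
      finally show ?thesis .
    qed
    have A: "?A = (\<Sum>r\<in>{0..<n}. \<Sum>z\<in>Z. \<phi> (s r z))"
    proof -
      have "?A = (\<Sum>r\<in>{0..<n}. \<Sum>p\<in>{p \<in> Bx. \<rho> p = r}. \<phi> p)"
        by (rule sum.group[symmetric, OF finB]) (use n0 in \<open>auto simp: \<rho>_def\<close>)
      also have "\<dots> = (\<Sum>r\<in>{0..<n}. \<Sum>z\<in>Z. \<phi> (s r z))" by (rule sum.cong[OF refl shift])
      finally show ?thesis .
    qed
    have L: "?L = (\<Sum>z\<in>Z. \<phi> z)"
    proof (rule sum.mono_neutral_left[OF finZ])
      show "Lat N \<subseteq> Z" unfolding Z_def Lat_def using N by auto
      show "\<forall>i\<in>Z - Lat N. \<phi> i = 0"
      proof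
        fix i assume i: "i \<in> Z - Lat N"
        have "i \<notin> Bx" using i unfolding Z_def Lat_def Bx_def by blast
        thus "\<phi> i = 0" by (rule zero)
      qed
    qed
    have diff: "\<bar>\<phi> z - \<phi> (s r z)\<bar> \<le> C / N * (4 * real k)" for r z
    proof -
      obtain a b where z: "z = (a, b)" by (cases z)
      have "\<bar>\<phi> z - \<phi> (s r z)\<bar> \<le> C / N * (\<bar>real_of_int (a - (a + fst (\<alpha> r)))\<bar> + \<bar>real_of_int (b - (b + snd (\<alpha> r)))\<bar>)"
        unfolding z s_def fst_conv snd_conv by (rule lip)
      also have "\<dots> \<le> C / N * (4 * real k)"
      proof (rule mult_left_mono)
        show "\<bar>real_of_int (a - (a + fst (\<alpha> r)))\<bar> + \<bar>real_of_int (b - (b + snd (\<alpha> r)))\<bar> \<le> 4 * real k"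
          using \<alpha>(2,3)[of r] by simp
        show "0 \<le> C / N" using C0 N by simp
      qed
      finally show ?thesis .
    qed
    \<comment> \<open>Each coset sum is the lattice sum with shifted arguments, so the Lipschitz
      bound applies term by term. The constants multiply to \<open>121 * 4 * 4 = 1936\<close>, below
      4000.\<close>
    have "n * ?L - ?A = (\<Sum>r\<in>{0..<n}. \<Sum>z\<in>Z. \<phi> z - \<phi> (s r z))"
      unfolding A L using n0 by (simp add: sum_subtractf)
    also have "\<bar>\<dots>\<bar> \<le> (\<Sum>r\<in>{0..<n}. \<Sum>z\<in>Z. \<bar>\<phi> z - \<phi> (s r z)\<bar>)"
      by (rule order.trans[OF sum_abs]) (intro sum_mono sum_abs)
    also have "\<dots> \<le> (\<Sum>r\<in>{0..<n}. \<Sum>z\<in>Z. C / N * (4 * real k))" by (intro sum_mono diff)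
    also have "\<dots> = (n * real (card Z)) * (C / N * (4 * real k))" using n0 by simp
    also have "\<dots> \<le> (121 * (real_of_int N)\<^sup>2) * (C / N * (4 * real k))"
      by (rule mult_right_mono[OF cZ]) (use C0 N in simp)
    also have "\<dots> = 484 * N * C * real k" using N by (simp add: power2_eq_square)
    also have "\<dots> \<le> 484 * N * C * (4 * real_of_int n / l)" using C0 N by (intro mult_left_mono kn) simp_all
    finally have "\<bar>n * ?L - ?A\<bar> \<le> n * (1936 * C * (N / l))" by (simp add: mult_ac)
    moreover have "n * ?L - ?A = n * (?L - ?A / n)" using n0 by (simp add: right_diff_distrib)
    ultimately have "real_of_int n * \<bar>?L - ?A / n\<bar> \<le> n * (1936 * C * (N / l))" using n0 by (simp add: abs_mult)
    hence "\<bar>?L - ?A / n\<bar> \<le> 1936 * C * (N / l)" by (rule mult_left_le_imp_le) (use n0 in simp)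
    also have "\<dots> \<le> 4000 * C * (1 + N / l)" using C0 N l1 by (intro mult_mono) simp_all
    also have "\<dots> \<le> (38 * M + 4000 * C) * (1 + N / l)" using M0 N l1 by (intro mult_right_mono) simp_all
    finally show ?thesis .
  qed
  thus ?thesis unfolding goal_eq by (simp add: n_def l_def)
qed

section \<open>Jordan's totient\<close>

text \<open>Jordan's totient of order 2, given by what it counts and not by an Euler product: the
  divisor sum below is then a matter of sorting pairs.\<close>

definition jordan2 :: "nat \<Rightarrow> nat" where
  "jordan2 n = card {(a, b). a \<in> {1..n} \<and> b \<in> {1..n} \<and> gcd a (gcd b n) = 1}"

lemma jordan2_le: "jordan2 n \<le> n\<^sup>2"
proof -
  have "jordan2 n \<le> card ({1..n} \<times> {1..n})" unfolding jordan2_def by (intro card_mono) auto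
  thus ?thesis by (simp add: card_cartesian_product power2_eq_square)
qed

text \<open>The pairs with entries in \<open>{1..n}\<close> are sorted by
  \<open>g = gcd a (gcd b n)\<close>; dividing by \<open>g\<close> identifies the class of
  \<open>g\<close> with the pairs counted by \<open>jordan2 (n div g)\<close>.\<close>

lemma sum_jordan2_divisors:
  assumes n: "n \<ge> 1"
  shows "(\<Sum>d | d dvd n. jordan2 d) = n\<^sup>2"
proof -
  define A where "A = {1..n} \<times> {1..n}"
  define f where "f = (\<lambda>(a, b). gcd a (gcd b n))"
  have fib: "card {p \<in> A. f p = g} = jordan2 (n div g)" if g: "g dvd n" for g
  proof -
    obtain m where m: "n = g * m" using g by auto
    have g0: "g > 0" and m0: "m > 0" using n m by (auto intro: Nat.gr0I)
    let ?S = "{(a, b). a \<in> {1..m} \<and> b \<in> {1..m} \<and> gcd a (gcd b m) = 1}"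
    have "bij_betw (\<lambda>(a, b). (g * a, g * b)) ?S {p \<in> A. f p = g}"
    proof (rule bij_betwI[of _ _ _ "\<lambda>(a, b). (a div g, b div g)"])
      show "(\<lambda>(a, b). (g * a, g * b)) \<in> ?S \<rightarrow> {p \<in> A. f p = g}"
      proof (rule Pi_I)
        fix p assume p: "p \<in> ?S"
        obtain a b where pp: "p = (a, b)" by (cases p)
        have ab: "a \<in> {1..m}" "b \<in> {1..m}" "gcd a (gcd b m) = 1" using p unfolding pp by simp_all
        have "gcd (g * a) (gcd (g * b) (g * m)) = g * gcd a (gcd b m)" by (simp only: gcd_mult_distrib_nat[symmetric])
        hence "f (g * a, g * b) = g" using ab m by (simp add: f_def)
        thus "(\<lambda>(a, b). (g * a, g * b)) p \<in> {p \<in> A. f p = g}" using ab g0 m unfolding pp A_def by simp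
      qed
      show "(\<lambda>(a, b). (a div g, b div g)) \<in> {p \<in> A. f p = g} \<rightarrow> ?S"
      proof (rule Pi_I)
        fix p assume p: "p \<in> {p \<in> A. f p = g}"
        obtain a b where pp: "p = (a, b)" by (cases p)
        have ab: "a \<in> {1..n}" "b \<in> {1..n}" "gcd a (gcd b n) = g" using p unfolding pp A_def f_def by simp_all
        have "g dvd a" "g dvd b" using ab(3) by (metis gcd_dvd1, metis gcd_dvd1 gcd_dvd2 dvd_trans)
        then obtain a' b' where a': "a = g * a'" "b = g * b'" by (elim dvdE) blast
        have "g * gcd a' (gcd b' m) = g" using ab(3) unfolding a' m by (simp only: gcd_mult_distrib_nat)
        hence "gcd a' (gcd b' m) = 1" using g0 by simp
        moreover have "a' \<in> {1..m}" "b' \<in> {1..m}" using ab(1,2) g0 unfolding a' m by simp_all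
        ultimately show "(\<lambda>(a, b). (a div g, b div g)) p \<in> ?S" unfolding pp a' using g0 by simp
      qed
      show "(\<lambda>(a, b). (a div g, b div g)) ((\<lambda>(a, b). (g * a, g * b)) p) = p" for p using g0 by (cases p) simp
      show "(\<lambda>(a, b). (g * a, g * b)) ((\<lambda>(a, b). (a div g, b div g)) p) = p" if "p \<in> {p \<in> A. f p = g}" for p
      proof -
        obtain a b where pp: "p = (a, b)" by (cases p)
        have "gcd a (gcd b n) = g" using that unfolding pp f_def by simp
        hence "g dvd a" "g dvd b" by (metis gcd_dvd1, metis gcd_dvd1 gcd_dvd2 dvd_trans)
        thus ?thesis unfolding pp by simp
      qed
    qed
    hence "card ?S = card {p \<in> A. f p = g}" by (rule bij_betw_same_card)
    moreover have "n div g = m" using m g0 by simp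
    ultimately show ?thesis unfolding jordan2_def by simp
  qed
  have finA: "finite A" by (simp add: A_def)
  have finD: "finite {d. d dvd n}" using n by (intro finite_divisors_nat) simp
  have "n\<^sup>2 = card A" by (simp add: A_def card_cartesian_product power2_eq_square)
  also have "\<dots> = (\<Sum>p\<in>A. 1)" by simp
  also have "\<dots> = (\<Sum>g | g dvd n. \<Sum>p\<in>{p \<in> A. f p = g}. 1)"
  proof (rule sum.group[symmetric, OF finA finD])
    show "f ` A \<subseteq> {d. d dvd n}" unfolding f_def by (auto intro: dvd_trans[OF gcd_dvd2])
  qed
  also have "\<dots> = (\<Sum>g | g dvd n. jordan2 (n div g))" by (rule sum.cong) (use fib in simp_all)
  also have "\<dots> = (\<Sum>d | d dvd n. jordan2 d)"
    by (rule sum.reindex_bij_witness[of _ "\<lambda>d. n div d" "\<lambda>d. n div d"]) (use n in \<open>auto simp: div_div_eq_right\<close>)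
  finally show ?thesis by simp
qed

definition jordan2_sum :: "nat \<Rightarrow> real" where
  "jordan2_sum E = (\<Sum>e=1..E. real (jordan2 e) / real e ^ 3)"

lemma jordan2_term_bounds:
  assumes "e \<ge> 1" shows "0 \<le> real (jordan2 e) / real e ^ 3" "real (jordan2 e) / real e ^ 3 \<le> 1 / e"
proof -
  have "real (jordan2 e) \<le> real (e\<^sup>2)" using jordan2_le by (rule of_nat_mono)
  hence "real (jordan2 e) / real e ^ 3 \<le> real (e\<^sup>2) / real e ^ 3" by (rule divide_right_mono) simp
  also have "\<dots> = 1 / e" using assms by (simp add: power2_eq_square power3_eq_cube)
  finally show "real (jordan2 e) / real e ^ 3 \<le> 1 / e" .
qed simp

text \<open>Collecting the pairs with \<open>k * e = n\<close> produces the divisor sum of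
  \<open>jordan2\<close>, which is \<open>n^2\<close>, over \<open>n^3\<close>. It is the truncated
  form of the factorisation of zeta(s - 2) into zeta(s) and the Dirichlet series of the totient,
  taken at s = 3.\<close>

lemma jordan2_sum_convolution:
  "(\<Sum>k=1..E. 1 / real k ^ 3 * jordan2_sum (E div k)) = harm E"
proof -
  have "(\<Sum>k=1..E. 1 / real k ^ 3 * jordan2_sum (E div k)) = (\<Sum>k\<in>{1..E}. \<Sum>e\<in>{1..E div k}. real (jordan2 e) / real (k * e) ^ 3)"
    unfolding jordan2_sum_def sum_distrib_left by (intro sum.cong refl) (simp add: power_mult_distrib)
  also have "\<dots> = (\<Sum>(k, e)\<in>Sigma {1..E} (\<lambda>k. {1..E div k}). real (jordan2 e) / real (k * e) ^ 3)"
    by (rule sum.Sigma) simp_all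
  also have "\<dots> = (\<Sum>(n, e)\<in>Sigma {1..E} (\<lambda>n. {e. e dvd n}). real (jordan2 e) / real n ^ 3)"
  proof (rule sum.reindex_bij_witness[of _ "\<lambda>(n, e). (n div e, e)" "\<lambda>(k, e). (k * e, e)"])
    fix p assume p: "p \<in> Sigma {1..E} (\<lambda>k. {1..E div k})"
    obtain k e where pp: "p = (k, e)" by (cases p)
    have ke: "1 \<le> k" "1 \<le> e" "e \<le> E div k" using p unfolding pp by simp_all
    have "k * e \<le> k * (E div k)" using ke by simp
    also have "\<dots> \<le> E" by simp
    finally have "k * e \<le> E" .
    thus "(case p of (k, e) \<Rightarrow> (k * e, e)) \<in> Sigma {1..E} (\<lambda>n. {e. e dvd n})" using ke unfolding pp by simp
    show "(case case p of (k, e) \<Rightarrow> (k * e, e) of (n, e) \<Rightarrow> (n div e, e)) = p" using ke unfolding pp by simp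
    show "(case case p of (k, e) \<Rightarrow> (k * e, e) of (n, e) \<Rightarrow> real (jordan2 e) / real n ^ 3) = (case p of (k, e) \<Rightarrow> real (jordan2 e) / real (k * e) ^ 3)"
      unfolding pp by simp
  next
    fix p assume p: "p \<in> Sigma {1..E} (\<lambda>n. {e. e dvd n})"
    obtain n e where pp: "p = (n, e)" by (cases p)
    have n: "1 \<le> n" "n \<le> E" "e dvd n" using p unfolding pp by simp_all
    then obtain k where k: "n = e * k" by auto
    have ek: "e \<ge> 1" "k \<ge> 1" using n(1) k by (auto simp: Suc_le_eq intro: Nat.gr0I)
    have "e \<le> E div k" using n(2) k ek by (simp add: less_eq_div_iff_mult_less_eq)
    moreover have "k \<le> E" using n(2) k ek by (metis dual_order.trans dvd_imp_le dvd_triv_right le_trans less_le_trans n(1) zero_less_one)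
    ultimately show "(case p of (n, e) \<Rightarrow> (n div e, e)) \<in> Sigma {1..E} (\<lambda>k. {1..E div k})" using ek unfolding pp k by simp
    show "(case case p of (n, e) \<Rightarrow> (n div e, e) of (k, e) \<Rightarrow> (k * e, e)) = p" using ek unfolding pp k by simp
  qed
  also have "\<dots> = (\<Sum>n\<in>{1..E}. \<Sum>e | e dvd n. real (jordan2 e) / real n ^ 3)"
    by (rule sum.Sigma[symmetric]) (simp_all add: finite_divisors_nat)
  also have "\<dots> = (\<Sum>n\<in>{1..E}. inverse (real n))"
  proof (rule sum.cong[OF refl])
    fix n assume n: "n \<in> {1..E}"
    have "(\<Sum>e | e dvd n. real (jordan2 e) / real n ^ 3) = real (\<Sum>e | e dvd n. jordan2 e) / real n ^ 3"
      by (simp add: sum_divide_distrib)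
    also have "\<dots> = inverse (real n)" using n by (simp add: sum_jordan2_divisors power2_eq_square power3_eq_cube field_simps)
    finally show "(\<Sum>e | e dvd n. real (jordan2 e) / real n ^ 3) = inverse (real n)" .
  qed
  finally show ?thesis by (simp add: harm_def)
qed

text \<open>There are fewer than \<open>k * (q + 1)\<close> terms beyond \<open>q = E div k\<close>,
  each at most \<open>1 / (q + 1)\<close>. A logarithmic bound in \<open>k\<close> would be closer
  to the truth, but \<open>k\<close> suffices, since it is later weighted by
  \<open>1 / k^3\<close>.\<close>

lemma jordan2_sum_diff:
  assumes k: "1 \<le> k" "k \<le> E"
  shows "0 \<le> jordan2_sum E - jordan2_sum (E div k)" "jordan2_sum E - jordan2_sum (E div k) \<le> k"
proof -
  define q where "q = E div k"
  have q1: "q \<le> E" unfolding q_def by simp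
  have Eq: "E < k * (q + 1)" unfolding q_def using k by (metis dividend_less_times_div less_le_trans mult.commute zero_less_one Suc_eq_plus1 mult_Suc_right add.commute)
  have "{1..E} = {1..q} \<union> {q+1..E}" using q1 by auto
  hence d: "jordan2_sum E - jordan2_sum q = (\<Sum>e=q+1..E. real (jordan2 e) / real e ^ 3)"
    unfolding jordan2_sum_def by (simp add: sum.union_disjoint)
  show "0 \<le> jordan2_sum E - jordan2_sum (E div k)" unfolding q_def[symmetric] d by (intro sum_nonneg) simp
  have "(\<Sum>e=q+1..E. real (jordan2 e) / real e ^ 3) \<le> (\<Sum>e=q+1..E. 1 / (real q + 1))"
  proof (rule sum_mono)
    fix e assume e: "e \<in> {q+1..E}"
    have "real (jordan2 e) / real e ^ 3 \<le> 1 / real e" by (rule jordan2_term_bounds(2)) (use e in simp)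
    also have "\<dots> \<le> 1 / (real q + 1)" using e by (intro divide_left_mono mult_pos_pos) auto
    finally show "real (jordan2 e) / real e ^ 3 \<le> 1 / (real q + 1)" .
  qed
  also have "\<dots> = real (E - q) / (real q + 1)" by simp
  also have "\<dots> \<le> real (k * (q + 1)) / (real q + 1)" using Eq by (intro divide_right_mono of_nat_mono) simp_all
  also have "\<dots> = k" by (simp add: field_simps)
  finally show "jordan2_sum E - jordan2_sum (E div k) \<le> k" unfolding q_def[symmetric] d .
qed

text \<open>The convolution identity is inverted without the Moebius function: replacing every
  \<open>jordan2_sum (E div k)\<close> by \<open>jordan2_sum E\<close> costs the convergent sum of
  \<open>k / k^3\<close> and leaves a partial sum of \<open>zeta 3\<close> times
  \<open>jordan2_sum E\<close> against the harmonic number.\<close>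

lemma jordan2_sum_asymp:
  obtains C where "\<And>E. E \<ge> 1 \<Longrightarrow> \<bar>jordan2_sum E - ln (real E) / zeta 3\<bar> \<le> C"
proof -
  define a where "a = (\<lambda>n. 1 / real (Suc n) ^ 3)"
  define D where "D = (\<Sum>n. 1 / real (Suc n) ^ 2)"
  have sD: "summable (\<lambda>n. 1 / real (Suc n) ^ 2)"
  proof -
    have "summable (\<lambda>n. inverse (real n ^ 2))" by (rule inverse_power_summable) simp
    hence "summable (\<lambda>n. inverse (real (Suc n) ^ 2))" by (rule summable_Suc_iff[THEN iffD2])
    thus ?thesis by (simp only: inverse_eq_divide)
  qed
  have sa: "summable a"
  proof -
    have "summable (\<lambda>n. inverse (real n ^ 3))" by (rule inverse_power_summable) simp
    hence "summable (\<lambda>n. inverse (real (Suc n) ^ 3))" by (rule summable_Suc_iff[THEN iffD2])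
    thus ?thesis unfolding a_def by (simp only: inverse_eq_divide)
  qed
  have p3: "real (Suc n) powr 3 = real (Suc n) ^ 3" for n by (subst powr_numeral) simp_all
  have z: "zeta 3 = suminf a" unfolding zeta_def a_def p3 ..
  have D0: "D \<ge> 0" unfolding D_def by (rule suminf_nonneg[OF sD]) simp
  have Zsum: "(\<Sum>k=1..E. 1 / real k ^ 3) = sum a {..<E}" for E
    unfolding a_def by (rule sum.reindex_bij_witness[of _ Suc "\<lambda>k. k - 1"]) auto
  have Dsum: "(\<Sum>k=1..E. 1 / real k ^ 2) \<le> D" for E
  proof -
    have "(\<Sum>k=1..E. 1 / real k ^ 2) = (\<Sum>n<E. 1 / real (Suc n) ^ 2)"
      by (rule sum.reindex_bij_witness[of _ Suc "\<lambda>k. k - 1"]) auto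
    also have "\<dots> \<le> D" unfolding D_def by (rule sum_le_suminf[OF sD]) simp_all
    finally show ?thesis .
  qed
  have z1: "zeta 3 \<ge> 1"
  proof -
    have "sum a {..<1} \<le> suminf a" by (rule sum_le_suminf[OF sa]) (simp_all add: a_def)
    thus ?thesis unfolding z by (simp add: a_def)
  qed
  show thesis
  proof (rule that[of "2 * D + 1"])
    fix E :: nat assume E: "E \<ge> 1"
    define H where "H = jordan2_sum E"
    define Z where "Z = (\<Sum>k=1..E. 1 / real k ^ 3)"
    have H0: "0 \<le> H" unfolding H_def jordan2_sum_def by (intro sum_nonneg) simp
    have HE: "H \<le> real E"
    proof -
      have "H \<le> (\<Sum>e=1..E. 1)" unfolding H_def jordan2_sum_def
      proof (rule sum_mono)
        fix e assume e: "e \<in> {1..E}"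
        have "real (jordan2 e) / real e ^ 3 \<le> 1 / real e" by (rule jordan2_term_bounds(2)) (use e in simp)
        also have "\<dots> \<le> 1" using e by simp
        finally show "real (jordan2 e) / real e ^ 3 \<le> 1" .
      qed
      thus ?thesis by simp
    qed
    have "Z * H - harm E = (\<Sum>k=1..E. 1 / real k ^ 3 * (H - jordan2_sum (E div k)))"
      unfolding jordan2_sum_convolution[of E, symmetric] Z_def by (simp add: sum_distrib_right sum_subtractf right_diff_distrib)
    also have "\<bar>\<dots>\<bar> \<le> (\<Sum>k=1..E. \<bar>1 / real k ^ 3 * (H - jordan2_sum (E div k))\<bar>)" by (rule sum_abs)
    also have "\<dots> \<le> (\<Sum>k=1..E. 1 / real k ^ 2)"
    proof (rule sum_mono)
      fix k assume k: "k \<in> {1..E}"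
      have "\<bar>1 / real k ^ 3 * (H - jordan2_sum (E div k))\<bar> = 1 / real k ^ 3 * (H - jordan2_sum (E div k))"
        unfolding H_def using jordan2_sum_diff(1)[of k E] k by simp
      also have "\<dots> \<le> 1 / real k ^ 3 * k" unfolding H_def using jordan2_sum_diff(2)[of k E] k by (intro mult_left_mono) simp_all
      also have "\<dots> = 1 / real k ^ 2" using k by (simp add: power2_eq_square power3_eq_cube)
      finally show "\<bar>1 / real k ^ 3 * (H - jordan2_sum (E div k))\<bar> \<le> 1 / real k ^ 2" .
    qed
    also have "\<dots> \<le> D" by (rule Dsum)
    finally have 1: "\<bar>Z * H - harm E\<bar> \<le> D" .
    have tail: "zeta 3 - Z = (\<Sum>n. a (n + E))" unfolding z Z_def Zsum using suminf_split_initial_segment[OF sa, of E] by simp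
    have tail0: "0 \<le> (\<Sum>n. a (n + E))" by (rule suminf_nonneg[OF summable_ignore_initial_segment[OF sa]]) (simp add: a_def)
    \<comment> \<open>A tail of order \<open>1 / E\<close> is enough, since it is multiplied by
      \<open>H <= E\<close>.\<close>
    have "(\<Sum>n. a (n + E)) \<le> (\<Sum>n. (1 / real E) * (1 / real (Suc n) ^ 2))"
    proof (rule suminf_le[OF _ summable_ignore_initial_segment[OF sa] summable_mult[OF sD]])
      fix n
      have "real E * (real (Suc n)) ^ 2 \<le> real (Suc (n + E)) * (real (Suc (n + E))) ^ 2"
        by (intro mult_mono power_mono) simp_all
      hence "1 / (real (Suc (n + E)) * (real (Suc (n + E))) ^ 2) \<le> 1 / (real E * (real (Suc n)) ^ 2)"
        using E by (intro divide_left_mono) simp_all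
      thus "a (n + E) \<le> (1 / real E) * (1 / real (Suc n) ^ 2)" unfolding a_def by (simp add: power2_eq_square power3_eq_cube mult.assoc)
    qed
    also have "\<dots> = (1 / real E) * D" unfolding D_def by (rule suminf_mult[OF sD])
    finally have t: "zeta 3 - Z \<le> D / real E" unfolding tail by simp
    have "(zeta 3 - Z) * H \<le> D / real E * real E"
      by (rule mult_mono[OF t HE _ H0]) (use D0 in simp)
    hence 2: "(zeta 3 - Z) * H \<le> D" using E by simp
    have two_nonneg: "0 \<le> (zeta 3 - Z) * H" using tail0 H0 unfolding tail by simp
    have 3: "\<bar>harm E - ln (real E)\<bar> \<le> 1"
    proof -
      have "ln (real E) \<le> harm E"
        using ln_le_harm[of E] E order.trans[of "ln (real E)" "ln (real E + 1)" "harm E"] by simp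
      moreover have "harm E \<le> ln (real E) + 1" using decseqD[OF decseq_harm_diff_ln, of 0 "E - 1"] E by (simp add: harm_expand)
      ultimately show ?thesis by linarith
    qed
    have "zeta 3 * H - ln (real E) = (zeta 3 - Z) * H + (Z * H - harm E) + (harm E - ln (real E))"
      by (simp add: left_diff_distrib)
    hence "\<bar>zeta 3 * H - ln (real E)\<bar> \<le> 2 * D + 1" using 1 2 two_nonneg 3 by linarith
    moreover have "H - ln (real E) / zeta 3 = (zeta 3 * H - ln (real E)) / zeta 3" using z1 by (simp add: diff_divide_distrib)
    ultimately have "\<bar>H - ln (real E) / zeta 3\<bar> \<le> (2 * D + 1) / zeta 3" using z1 by (simp add: divide_right_mono)
    also have "\<dots> \<le> (2 * D + 1) / 1" using z1 D0 by (intro divide_left_mono) simp_all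
    finally show "\<bar>jordan2_sum E - ln (real E) / zeta 3\<bar> \<le> 2 * D + 1" by (simp add: H_def)
  qed
qed

section \<open>Riemann sums and Lipschitz bounds\<close>

text \<open>The cell is squeezed between the open and the closed box, which have the same
  volume.\<close>

lemma lborel_half_open_cell:
  fixes x h :: "'a::euclidean_space"
  assumes h: "\<And>b. b \<in> Basis \<Longrightarrow> 0 < h \<bullet> b"
  defines "c \<equiv> {z. \<forall>b\<in>Basis. x \<bullet> b \<le> z \<bullet> b \<and> z \<bullet> b < x \<bullet> b + h \<bullet> b}"
  shows "c \<in> sets borel" "emeasure lborel c = ennreal (\<Prod>b\<in>Basis. h \<bullet> b)"
proof -
  have "c = (\<Inter>b\<in>Basis. {z. x \<bullet> b \<le> z \<bullet> b} \<inter> {z. z \<bullet> b < x \<bullet> b + h \<bullet> b})" unfolding c_def by auto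
  also have "\<dots> \<in> sets borel" by (intro sets.countable_INT'' sets.finite_INT) (auto simp: borel_measurable_le borel_measurable_less)
  finally show c: "c \<in> sets borel" .
  have le: "x \<bullet> b \<le> (x + h) \<bullet> b" if "b \<in> Basis" for b using h[OF that] by (simp add: inner_add_left)
  have "emeasure lborel (box x (x + h)) \<le> emeasure lborel c"
    by (rule emeasure_mono) (auto simp: c_def box_def inner_add_left less_imp_le c[unfolded c_def])
  moreover have "emeasure lborel c \<le> emeasure lborel (cbox x (x + h))"
    by (rule emeasure_mono) (auto simp: c_def cbox_def inner_add_left less_imp_le)
  ultimately show "emeasure lborel c = ennreal (\<Prod>b\<in>Basis. h \<bullet> b)"
    using emeasure_lborel_box[of x "x + h", OF le] emeasure_lborel_cbox[of x "x + h", OF le] by simp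
qed

text \<open>The weighted sum is the integral of the step function \<open>f (r z)\<close>, where
  \<open>r\<close> rounds down to the grid; rounded points missing from \<open>G\<close> do no harm
  because \<open>f\<close> vanishes there. Rounding moves a coordinate by at most
  \<open>h \<bullet> b\<close>, and both functions vanish outside the cube of radius
  \<open>R + k\<close>, which gives the volume factor.\<close>

lemma riemann_sum_lipschitz:
  fixes f :: "'a::euclidean_space \<Rightarrow> real" and h :: 'a and R L k :: real
  assumes h: "\<And>b. b \<in> Basis \<Longrightarrow> 0 < h \<bullet> b" "\<And>b. b \<in> Basis \<Longrightarrow> h \<bullet> b \<le> k" and R: "0 \<le> R" "0 \<le> k" and L: "0 \<le> L"
    and supp: "\<And>z b. f z \<noteq> 0 \<Longrightarrow> b \<in> Basis \<Longrightarrow> \<bar>z \<bullet> b\<bar> \<le> R"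
    and lip: "\<And>z z'. \<bar>f z - f z'\<bar> \<le> L * (\<Sum>b\<in>Basis. \<bar>(z - z') \<bullet> b\<bar>)"
    and int: "integrable lborel f"
    and G: "finite G" "\<And>x b. x \<in> G \<Longrightarrow> b \<in> Basis \<Longrightarrow> \<exists>k::int. x \<bullet> b = k * (h \<bullet> b)"
      "\<And>x. f x \<noteq> 0 \<Longrightarrow> (\<And>b. b \<in> Basis \<Longrightarrow> \<exists>k::int. x \<bullet> b = k * (h \<bullet> b)) \<Longrightarrow> x \<in> G"
  shows "\<bar>(\<Prod>b\<in>Basis. h \<bullet> b) * (\<Sum>x\<in>G. f x) - (LINT z|lborel. f z)\<bar> \<le> L * (\<Sum>b\<in>Basis. h \<bullet> b) * (2 * R + 2 * k) ^ DIM('a)"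
proof -
  define c where "c = (\<lambda>x. {z. \<forall>b\<in>Basis. x \<bullet> b \<le> z \<bullet> b \<and> z \<bullet> b < x \<bullet> b + h \<bullet> b})"
  define vol where "vol = (\<Prod>b\<in>Basis. h \<bullet> b)"
  have vol0: "vol \<ge> 0" unfolding vol_def by (intro prod_nonneg) (use h in \<open>simp add: less_imp_le\<close>)
  have cs: "c x \<in> sets borel" "emeasure lborel (c x) = ennreal vol" for x
    unfolding c_def vol_def by (rule lborel_half_open_cell[OF h(1)], assumption)+
  have mc: "measure lborel (c x) = vol" for x using cs(2)[of x] vol0 by (simp add: measure_def)
  define g where "g = (\<lambda>z. \<Sum>x\<in>G. f x * indicator (c x) z)"
  have ic: "integrable lborel (\<lambda>z. f x * indicator (c x) z :: real)" for x
    by (intro integrable_mult_right integrable_real_indicator) (simp_all add: cs)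
  have ig: "integrable lborel g" unfolding g_def by (intro Bochner_Integration.integrable_sum ic)
  have "(LINT z|lborel. g z) = (\<Sum>x\<in>G. LINT z|lborel. f x * indicator (c x) z)"
    unfolding g_def by (rule Bochner_Integration.integral_sum[OF ic])
  also have "\<dots> = vol * (\<Sum>x\<in>G. f x)" by (simp add: mc sum_distrib_left mult.commute)
  finally have intg: "(LINT z|lborel. g z) = vol * (\<Sum>x\<in>G. f x)" .
  define r where "r = (\<lambda>z. \<Sum>b\<in>Basis. (\<lfloor>z \<bullet> b / (h \<bullet> b)\<rfloor> * (h \<bullet> b)) *\<^sub>R b)"
  have rb: "r z \<bullet> b = \<lfloor>z \<bullet> b / (h \<bullet> b)\<rfloor> * (h \<bullet> b)" if "b \<in> Basis" for z b
    unfolding r_def using that by (simp add: inner_sum_left_Basis)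
  have rc: "r z \<bullet> b \<le> z \<bullet> b \<and> z \<bullet> b < r z \<bullet> b + h \<bullet> b" if b: "b \<in> Basis" for z b
  proof -
    define t where "t = z \<bullet> b / (h \<bullet> b)"
    have hb: "0 < h \<bullet> b" by (rule h(1)[OF b])
    have z: "z \<bullet> b = t * (h \<bullet> b)" using hb by (simp add: t_def)
    have "of_int \<lfloor>t\<rfloor> * (h \<bullet> b) \<le> t * (h \<bullet> b)" using hb by (intro mult_right_mono) simp_all
    moreover have "t * (h \<bullet> b) < (of_int \<lfloor>t\<rfloor> + 1) * (h \<bullet> b)" using hb by (intro mult_strict_right_mono) simp_all
    ultimately show ?thesis unfolding rb[OF b] t_def[symmetric] z by (simp add: distrib_right)
  qed
  have uniq: "x = r z" if x: "x \<in> G" "z \<in> c x" for x z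
  proof (rule euclidean_eqI)
    fix b :: 'a assume b: "b \<in> Basis"
    have hb: "0 < h \<bullet> b" by (rule h(1)[OF b])
    obtain k :: int where k: "x \<bullet> b = k * (h \<bullet> b)" using G(2)[OF x(1) b] by blast
    have "k * (h \<bullet> b) \<le> z \<bullet> b" "z \<bullet> b < k * (h \<bullet> b) + h \<bullet> b" using x(2) b k unfolding c_def by auto
    hence "of_int k \<le> z \<bullet> b / (h \<bullet> b)" "z \<bullet> b / (h \<bullet> b) < of_int k + 1" using hb by (simp_all add: field_simps)
    hence "\<lfloor>z \<bullet> b / (h \<bullet> b)\<rfloor> = k" by (simp add: floor_unique)
    thus "x \<bullet> b = r z \<bullet> b" unfolding rb[OF b] k by simp
  qed
  have gr: "g z = f (r z)" for z
  proof (cases "r z \<in> G")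
    case True
    have zc: "z \<in> c (r z)" unfolding c_def using rc by blast
    have "g z = (\<Sum>x\<in>G. if x = r z then f (r z) else 0)"
      unfolding g_def
    proof (rule sum.cong[OF refl])
      fix x assume x: "x \<in> G"
      show "f x * indicator (c x) z = (if x = r z then f (r z) else 0)"
      proof (cases "x = r z")
        case True
        thus ?thesis using zc by simp
      next
        case False
        hence "z \<notin> c x" using uniq[OF x] by blast
        thus ?thesis using False by simp
      qed
    qed
    thus ?thesis using True G(1) by simp
  next
    case False
    hence "f (r z) = 0" using G(3)[of "r z"] rb by blast
    moreover have "g z = 0" unfolding g_def
    proof (rule sum.neutral, rule ballI)
      fix x assume "x \<in> G"
      hence "z \<notin> c x" using uniq[of x z] False by blast
      thus "f x * indicator (c x) z = 0" by simp
    qed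
    ultimately show ?thesis by simp
  qed
  define M where "M = (\<Sum>b\<in>Basis. (R + k) *\<^sub>R (b :: 'a))"
  have Mb: "M \<bullet> b = R + k" if "b \<in> Basis" for b unfolding M_def using that by (simp add: inner_sum_left_Basis)
  define Q where "Q = cbox (- M) M"
  define w where "w = L * (\<Sum>b\<in>Basis. h \<bullet> b)"
  have w0: "w \<ge> 0" unfolding w_def by (intro mult_nonneg_nonneg L sum_nonneg) (use h in \<open>simp add: less_imp_le\<close>)
  have pt: "\<bar>g z - f z\<bar> \<le> w * indicator Q z" for z
  proof (cases "z \<in> Q")
    case True
    have "\<bar>g z - f z\<bar> \<le> L * (\<Sum>b\<in>Basis. \<bar>(r z - z) \<bullet> b\<bar>)" unfolding gr by (rule lip)
    also have "\<dots> \<le> L * (\<Sum>b\<in>Basis. h \<bullet> b)"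
    proof (intro mult_left_mono L sum_mono)
      fix b :: 'a assume b: "b \<in> Basis"
      show "\<bar>(r z - z) \<bullet> b\<bar> \<le> h \<bullet> b" using rc[OF b, of z] unfolding inner_diff_left by linarith
    qed
    finally show ?thesis using True by (simp add: w_def)
  next
    case False
    then obtain b where b: "b \<in> Basis" "\<bar>z \<bullet> b\<bar> > R + k"
      unfolding Q_def mem_box using Mb by (force simp: abs_le_iff not_le)
    have "f z = 0"
    proof (rule ccontr)
      assume "f z \<noteq> 0"
      from supp[OF this b(1)] show False using b(2) R(2) by linarith
    qed
    moreover have "\<bar>r z \<bullet> b\<bar> > R" using rc[OF b(1), of z] h(2)[OF b(1)] b(2) by linarith
    have "f (r z) = 0"
    proof (rule ccontr)
      assume "f (r z) \<noteq> 0"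
      from supp[OF this b(1)] show False using \<open>\<bar>r z \<bullet> b\<bar> > R\<close> by linarith
    qed
    ultimately show ?thesis using gr w0 by simp
  qed
  have Qm: "emeasure lborel Q = ennreal ((2 * R + 2 * k) ^ DIM('a))"
  proof -
    have "emeasure lborel Q = ennreal (\<Prod>b\<in>Basis. (M - - M) \<bullet> b)"
      unfolding Q_def using R Mb by (intro emeasure_lborel_cbox) simp
    also have "(\<Prod>b\<in>Basis. (M - - M) \<bullet> b) = (\<Prod>b\<in>(Basis::'a set). 2 * R + 2 * k)"
      by (rule prod.cong[OF refl]) (simp add: inner_add_left Mb)
    finally show ?thesis by simp
  qed
  have "\<bar>vol * (\<Sum>x\<in>G. f x) - (LINT z|lborel. f z)\<bar> = \<bar>LINT z|lborel. g z - f z\<bar>"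
    unfolding intg[symmetric] by (subst Bochner_Integration.integral_diff[OF ig int]) simp
  also have "\<dots> \<le> (LINT z|lborel. \<bar>g z - f z\<bar>)" by (rule integral_abs_bound)
  also have "\<dots> \<le> (LINT z|lborel. w * indicator Q z)"
  proof (rule integral_mono)
    show "integrable lborel (\<lambda>z. \<bar>g z - f z\<bar>)" by (intro integrable_abs Bochner_Integration.integrable_diff ig int)
    show "integrable lborel (\<lambda>z. w * indicator Q z :: real)"
      by (intro integrable_mult_right integrable_real_indicator) (simp_all add: Qm, simp add: Q_def)
  qed (rule pt)
  also have "\<dots> = w * (2 * R + 2 * k) ^ DIM('a)"
    using R Qm by (simp add: measure_def)
  finally show ?thesis unfolding vol_def w_def .
qed

text \<open>A point closer than \<open>\<delta>\<close> to a point of the support lies with it in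
  \<open>S\<close>, where the function is Lipschitz; for more distant points the sup bound gives
  slope \<open>M / \<delta>\<close>. The purpose is to extend estimates valid away from
  \<open>y3 = 0\<close> to the whole space.\<close>

lemma lipschitz_if_lipschitz_near_support:
  fixes f :: "'a::metric_space \<Rightarrow> real"
  assumes \<delta>: "\<delta> > 0" and M: "\<And>p. \<bar>f p\<bar> \<le> M" and L: "0 \<le> L"
    and lip: "\<And>p q. p \<in> S \<Longrightarrow> q \<in> S \<Longrightarrow> \<bar>f p - f q\<bar> \<le> L * dist p q"
    and supp: "\<And>p q. f p \<noteq> 0 \<Longrightarrow> dist p q < \<delta> \<Longrightarrow> q \<in> S"
  shows "\<bar>f p - f q\<bar> \<le> (L + M / \<delta>) * dist p q"
proof -
  have M0: "0 \<le> M" using M[of p] by linarith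
  have near: "\<bar>f p - f q\<bar> \<le> (L + M / \<delta>) * dist p q" if p: "f p \<noteq> 0" for p q
  proof (cases "q \<in> S")
    case True
    have "p \<in> S" using supp[OF p, of p] \<delta> by simp
    hence "\<bar>f p - f q\<bar> \<le> L * dist p q" using True by (rule lip)
    also have "\<dots> \<le> (L + M / \<delta>) * dist p q" using M0 \<delta> by (intro mult_right_mono) simp_all
    finally show ?thesis .
  next
    case False
    hence d: "\<delta> \<le> dist p q" using supp[OF p, of q] by force
    have "f q = 0"
    proof (rule ccontr)
      assume "f q \<noteq> 0"
      from supp[OF this, of q] show False using False \<delta> by simp
    qed
    hence "\<bar>f p - f q\<bar> \<le> M" using M[of p] by simp
    also have "\<dots> = M / \<delta> * \<delta>" using \<delta> by simp
    also have "\<dots> \<le> M / \<delta> * dist p q" using d M0 \<delta> by (intro mult_left_mono) simp_all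
    also have "\<dots> \<le> (L + M / \<delta>) * dist p q" using L by (intro mult_right_mono) simp_all
    finally show ?thesis .
  qed
  show ?thesis
  proof (cases "f p = 0")
    case True
    show ?thesis
    proof (cases "f q = 0")
      case True
      thus ?thesis using \<open>f p = 0\<close> M0 L \<delta> by simp
    next
      case False
      from near[OF False, of p] show ?thesis by (simp add: abs_minus_commute dist_commute)
    qed
  qed (rule near)
qed

text \<open>\<open>Cn\<close> provides continuity of the derivative one direction at a time, so the
  operator norm is controlled through the basis directions, each bounded on the compact ball; the
  mean value inequality on the convex ball does the rest.\<close>

lemma smooth_lipschitz_on_cball:
  fixes W :: "'a::euclidean_space \<Rightarrow> real"
  assumes "smooth W"
  obtains L where "L \<ge> 0" "\<And>p q. p \<in> cball 0 r \<Longrightarrow> q \<in> cball 0 r \<Longrightarrow> \<bar>W p - W q\<bar> \<le> L * dist p q"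
proof -
  have "Cn (Suc 0) W" using assms unfolding smooth_def by blast
  hence d: "\<And>x. W differentiable (at x)" and c: "\<And>v. continuous_on UNIV (\<lambda>x. frechet_derivative W (at x) v)" by auto
  have "\<exists>K. \<forall>x\<in>cball 0 r. \<bar>frechet_derivative W (at x) b\<bar> \<le> K" for b
  proof -
    have "compact ((\<lambda>x. frechet_derivative W (at x) b) ` cball 0 r)"
      by (rule compact_continuous_image[OF continuous_on_subset[OF c]]) auto
    hence "bounded ((\<lambda>x. frechet_derivative W (at x) b) ` cball 0 r)" by (rule compact_imp_bounded)
    thus ?thesis unfolding bounded_iff by auto
  qed
  then obtain K where K: "\<And>b x. x \<in> cball 0 r \<Longrightarrow> \<bar>frechet_derivative W (at x) b\<bar> \<le> K b" by metis
  define L where "L = (\<Sum>b\<in>Basis. \<bar>K b\<bar>)"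
  have on: "onorm (frechet_derivative W (at x)) \<le> L" if x: "x \<in> cball 0 r" for x
  proof (rule onorm_bound)
    show "0 \<le> L" unfolding L_def by (intro sum_nonneg) simp
    fix v :: 'a
    interpret D: bounded_linear "frechet_derivative W (at x)"
      by (rule has_derivative_bounded_linear[OF frechet_derivative_works[THEN iffD1, OF d]])
    have "frechet_derivative W (at x) v = frechet_derivative W (at x) (\<Sum>b\<in>Basis. (v \<bullet> b) *\<^sub>R b)"
      by (simp add: euclidean_representation)
    also have "\<dots> = (\<Sum>b\<in>Basis. (v \<bullet> b) * frechet_derivative W (at x) b)" by (simp add: D.sum D.scaleR)
    also have "norm \<dots> \<le> (\<Sum>b\<in>Basis. norm v * \<bar>K b\<bar>)"
    proof (rule order.trans[OF norm_sum], rule sum_mono)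
      fix b :: 'a assume b: "b \<in> Basis"
      have "\<bar>v \<bullet> b\<bar> \<le> norm v" using b by (rule Basis_le_norm)
      moreover have "\<bar>frechet_derivative W (at x) b\<bar> \<le> \<bar>K b\<bar>" using K[OF x, of b] by linarith
      ultimately show "norm ((v \<bullet> b) * frechet_derivative W (at x) b) \<le> norm v * \<bar>K b\<bar>"
        by (simp add: abs_mult mult_mono)
    qed
    finally show "norm (frechet_derivative W (at x) v) \<le> L * norm v"
      unfolding L_def by (simp add: sum_distrib_left[symmetric] mult.commute)
  qed
  show thesis
  proof (rule that[of L])
    show "0 \<le> L" unfolding L_def by (intro sum_nonneg) simp
    fix p q :: 'a assume pq: "p \<in> cball 0 r" "q \<in> cball 0 r"
    have "norm (W p - W q) \<le> L * norm (p - q)"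
    proof (rule differentiable_bound[OF convex_cball _ on pq])
      fix x :: 'a
      show "(W has_derivative frechet_derivative W (at x)) (at x within cball 0 r)"
        using frechet_derivative_works[THEN iffD1, OF d[of x]] by (rule has_derivative_at_withinI)
    qed
    thus "\<bar>W p - W q\<bar> \<le> L * dist p q" by (simp add: dist_norm)
  qed
qed

text \<open>On the compact closure of the support each \<open>\<bar>y $ i\<bar>\<close> attains a
  positive minimum, whence \<open>c\<close>. A ball that exceeds the support by 1 allows the local
  Lipschitz bound to be extended to all points.\<close>

lemma weight_constants:
  fixes W :: "(real ^ 3) \<times> (real ^ 3) \<Rightarrow> real"
  assumes "smooth W" and cs: "compactly_supported_on W {(x, y). y $ 1 * y $ 2 * y $ 3 \<noteq> 0}"
  obtains c R L where "0 < c" "c \<le> 1" "1 \<le> R" "0 \<le> L"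
    "\<And>x y i. W (x, y) \<noteq> 0 \<Longrightarrow> \<bar>x $ i\<bar> \<le> R \<and> c \<le> \<bar>y $ i\<bar> \<and> \<bar>y $ i\<bar> \<le> R"
    "\<And>p. \<bar>W p\<bar> \<le> L" "\<And>p q. \<bar>W p - W q\<bar> \<le> L * dist p q"
proof -
  define K where "K = closure {p. W p \<noteq> 0}"
  have cK: "compact K \<and> K \<subseteq> {(x, y). y $ 1 * y $ 2 * y $ 3 \<noteq> 0}"
    using cs unfolding compactly_supported_on_def K_def .
  note K = conjunct1[OF cK] conjunct2[OF cK]
  have WK: "p \<in> K" if "W p \<noteq> 0" for p unfolding K_def by (rule subsetD[OF closure_subset]) (simp add: that)
  have "Cn 0 W" using assms(1) unfolding smooth_def by blast
  hence contW: "continuous_on UNIV W" by simp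
  obtain M where M: "\<And>p. p \<in> K \<Longrightarrow> \<bar>W p\<bar> \<le> M"
    using compact_imp_bounded[OF compact_continuous_image[OF continuous_on_subset[OF contW] K(1)]]
    unfolding bounded_iff by auto
  have M': "\<bar>W p\<bar> \<le> max M 0" for p using M[of p] WK[of p] by (cases "W p = 0") auto
  obtain r where r: "\<And>p. p \<in> K \<Longrightarrow> norm p \<le> r" using compact_imp_bounded[OF K(1)] unfolding bounded_iff by auto
  have "\<exists>d>0. \<forall>p\<in>K. d \<le> \<bar>snd p $ i\<bar>" for i
  proof (cases "K = {}")
    case False
    have "continuous_on K (\<lambda>p. \<bar>snd p $ i\<bar>)" by (intro continuous_intros)
    from continuous_attains_inf[OF K(1) False this] obtain p where p: "p \<in> K" "\<forall>q\<in>K. \<bar>snd p $ i\<bar> \<le> \<bar>snd q $ i\<bar>" by blast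
    have "snd p $ 1 * snd p $ 2 * snd p $ 3 \<noteq> 0" using K(2) p(1) by (auto simp: case_prod_unfold)
    hence "snd p $ i \<noteq> 0" using exhaust_3[of i] by auto
    with p(2) show ?thesis by (intro exI[of _ "\<bar>snd p $ i\<bar>"]) simp
  qed (auto intro: exI[of _ 1])
  then obtain d where d: "\<And>i. d i > 0" "\<And>i p. p \<in> K \<Longrightarrow> d i \<le> \<bar>snd p $ i\<bar>" by metis
  define c where "c = min 1 (min (d 1) (min (d 2) (d 3)))"
  define R where "R = max 1 r"
  obtain L where L: "L \<ge> 0" "\<And>p q. p \<in> cball 0 (R + 1) \<Longrightarrow> q \<in> cball 0 (R + 1) \<Longrightarrow> \<bar>W p - W q\<bar> \<le> L * dist p q"
    using smooth_lipschitz_on_cball[OF assms(1)] by blast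
  have lip: "\<bar>W p - W q\<bar> \<le> (L + max M 0 / 1) * dist p q" for p q
  proof (rule lipschitz_if_lipschitz_near_support[OF _ M' L(1) L(2)])
    fix p q assume Wp: "W p \<noteq> 0" and pq: "dist p q < 1"
    have "norm p \<le> r" by (rule r[OF WK[OF Wp]])
    hence "norm p \<le> R" by (simp add: R_def)
    thus "q \<in> cball 0 (R + 1)" using pq norm_triangle_ineq2[of q p] by (simp add: dist_norm norm_minus_commute)
  qed simp
  show thesis
  proof (rule that[of c R "L + max M 0"])
    show "0 < c" "c \<le> 1" unfolding c_def using d(1) by auto
    show "1 \<le> R" unfolding R_def by simp
    show "0 \<le> L + max M 0" using L(1) by simp
    show "\<bar>W p\<bar> \<le> L + max M 0" for p using M'[of p] L(1) by linarith
    show "\<bar>W p - W q\<bar> \<le> (L + max M 0) * dist p q" for p q using lip[of p q] by simp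
    fix x y :: "real ^ 3" and i :: 3 assume "W (x, y) \<noteq> 0"
    hence k: "(x, y) \<in> K" by (rule WK)
    have n: "norm (x, y) \<le> R" using r[OF k] unfolding R_def by simp
    have "\<bar>x $ i\<bar> \<le> norm x" "\<bar>y $ i\<bar> \<le> norm y" by (rule component_le_norm_cart)+
    moreover have "norm x \<le> norm (x, y)" "norm y \<le> norm (x, y)"
      using norm_fst_le[of x y] norm_snd_le[of y x] by simp_all
    moreover have "c \<le> d i" unfolding c_def using exhaust_3[of i] by auto
    ultimately show "\<bar>x $ i\<bar> \<le> R \<and> c \<le> \<bar>y $ i\<bar> \<and> \<bar>y $ i\<bar> \<le> R" using d(2)[OF k, of i] n by simp
  qed
qed

text \<open>Boundedness and Lipschitz continuity are kept together because products preserve the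
  pair but not Lipschitz continuity alone.\<close>

definition bounded_lipschitz_on :: "'a::metric_space set \<Rightarrow> ('a \<Rightarrow> real) \<Rightarrow> bool" where
  "bounded_lipschitz_on S f \<longleftrightarrow> (\<exists>M\<ge>0. (\<forall>p\<in>S. \<bar>f p\<bar> \<le> M) \<and> (\<forall>p\<in>S. \<forall>q\<in>S. \<bar>f p - f q\<bar> \<le> M * dist p q))"

lemma bounded_lipschitz_onE:
  assumes "bounded_lipschitz_on S f"
  obtains M where "M \<ge> 0" "\<And>p. p \<in> S \<Longrightarrow> \<bar>f p\<bar> \<le> M" "\<And>p q. p \<in> S \<Longrightarrow> q \<in> S \<Longrightarrow> \<bar>f p - f q\<bar> \<le> M * dist p q"
  using assms unfolding bounded_lipschitz_on_def by blast

lemma bounded_lipschitz_onI: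
  assumes "\<And>p. p \<in> S \<Longrightarrow> \<bar>f p\<bar> \<le> M" "\<And>p q. p \<in> S \<Longrightarrow> q \<in> S \<Longrightarrow> \<bar>f p - f q\<bar> \<le> N * dist p q"
  shows "bounded_lipschitz_on S f"
  unfolding bounded_lipschitz_on_def
proof (intro exI[of _ "max 0 (max M N)"] conjI ballI)
  show "\<bar>f p\<bar> \<le> max 0 (max M N)" if "p \<in> S" for p using assms(1)[OF that] by simp
  show "\<bar>f p - f q\<bar> \<le> max 0 (max M N) * dist p q" if "p \<in> S" "q \<in> S" for p q
    by (rule order.trans[OF assms(2)[OF that]]) (intro mult_right_mono; simp)
qed simp

lemma bounded_lipschitz_on_add:
  assumes "bounded_lipschitz_on S f" "bounded_lipschitz_on S g"
  shows "bounded_lipschitz_on S (\<lambda>p. f p + g p)"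
proof -
  obtain M where M: "M \<ge> 0" "\<And>p. p \<in> S \<Longrightarrow> \<bar>f p\<bar> \<le> M" "\<And>p q. p \<in> S \<Longrightarrow> q \<in> S \<Longrightarrow> \<bar>f p - f q\<bar> \<le> M * dist p q"
    using assms(1) by (rule bounded_lipschitz_onE) blast
  obtain N where N: "N \<ge> 0" "\<And>p. p \<in> S \<Longrightarrow> \<bar>g p\<bar> \<le> N" "\<And>p q. p \<in> S \<Longrightarrow> q \<in> S \<Longrightarrow> \<bar>g p - g q\<bar> \<le> N * dist p q"
    using assms(2) by (rule bounded_lipschitz_onE) blast
  show ?thesis
  proof (rule bounded_lipschitz_onI[of _ _ "M + N" "M + N"])
    show "\<bar>f p + g p\<bar> \<le> M + N" if "p \<in> S" for p using M(2)[OF that] N(2)[OF that] by linarith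
    show "\<bar>f p + g p - (f q + g q)\<bar> \<le> (M + N) * dist p q" if "p \<in> S" "q \<in> S" for p q
      using M(3)[OF that] N(3)[OF that] unfolding distrib_right by linarith
  qed
qed

lemma bounded_lipschitz_on_mult:
  assumes "bounded_lipschitz_on S f" "bounded_lipschitz_on S g"
  shows "bounded_lipschitz_on S (\<lambda>p. f p * g p)"
proof -
  obtain M where M: "M \<ge> 0" "\<And>p. p \<in> S \<Longrightarrow> \<bar>f p\<bar> \<le> M" "\<And>p q. p \<in> S \<Longrightarrow> q \<in> S \<Longrightarrow> \<bar>f p - f q\<bar> \<le> M * dist p q"
    using assms(1) by (rule bounded_lipschitz_onE) blast
  obtain N where N: "N \<ge> 0" "\<And>p. p \<in> S \<Longrightarrow> \<bar>g p\<bar> \<le> N" "\<And>p q. p \<in> S \<Longrightarrow> q \<in> S \<Longrightarrow> \<bar>g p - g q\<bar> \<le> N * dist p q"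
    using assms(2) by (rule bounded_lipschitz_onE) blast
  show ?thesis
  proof (rule bounded_lipschitz_onI[of _ _ "M * N" "2 * M * N"])
    show "\<bar>f p * g p\<bar> \<le> M * N" if "p \<in> S" for p
      unfolding abs_mult by (intro mult_mono M(2) N(2) that M(1)) simp
    show "\<bar>f p * g p - f q * g q\<bar> \<le> 2 * M * N * dist p q" if "p \<in> S" "q \<in> S" for p q
    proof -
      have "f p * g p - f q * g q = f p * (g p - g q) + (f p - f q) * g q" by (simp add: algebra_simps)
      also have "\<bar>\<dots>\<bar> \<le> \<bar>f p\<bar> * \<bar>g p - g q\<bar> + \<bar>f p - f q\<bar> * \<bar>g q\<bar>"
        unfolding abs_mult[symmetric] by (rule abs_triangle_ineq)
      also have "\<dots> \<le> M * (N * dist p q) + (M * dist p q) * N"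
        by (intro add_mono mult_mono M(2,3) N(2,3) that M(1) mult_nonneg_nonneg) simp_all
      finally show ?thesis by (simp add: mult_ac)
    qed
  qed
qed

lemma bounded_lipschitz_on_const: "bounded_lipschitz_on S (\<lambda>p. k)"
  by (rule bounded_lipschitz_onI[of _ _ "\<bar>k\<bar>" 0]) simp_all

lemma bounded_lipschitz_on_inverse:
  assumes "bounded_lipschitz_on S f" "d > 0" "\<And>p. p \<in> S \<Longrightarrow> d \<le> \<bar>f p\<bar>"
  shows "bounded_lipschitz_on S (\<lambda>p. inverse (f p))"
proof -
  obtain M where M: "M \<ge> 0" "\<And>p. p \<in> S \<Longrightarrow> \<bar>f p\<bar> \<le> M" "\<And>p q. p \<in> S \<Longrightarrow> q \<in> S \<Longrightarrow> \<bar>f p - f q\<bar> \<le> M * dist p q"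
    using assms(1) by (rule bounded_lipschitz_onE) blast
  have inv: "\<bar>inverse (f p)\<bar> \<le> 1 / d" if "p \<in> S" for p
    using assms(2,3) that unfolding abs_inverse by (simp add: inverse_eq_divide frac_le)
  show ?thesis
  proof (rule bounded_lipschitz_onI[OF inv, where N = "1 / d * (M * (1 / d))"])
    fix p q assume pq: "p \<in> S" "q \<in> S"
    have nz: "f p \<noteq> 0" "f q \<noteq> 0" using assms(2) assms(3)[OF pq(1)] assms(3)[OF pq(2)] by auto
    have "inverse (f p) - inverse (f q) = inverse (f p) * ((f q - f p) * inverse (f q))" using nz by (simp add: field_simps)
    also have "\<bar>\<dots>\<bar> = \<bar>inverse (f p)\<bar> * (\<bar>f p - f q\<bar> * \<bar>inverse (f q)\<bar>)" by (simp add: abs_mult abs_minus_commute)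
    also have "\<dots> \<le> (1 / d) * ((M * dist p q) * (1 / d))"
      by (intro mult_mono inv pq M(3) mult_nonneg_nonneg) (use assms(2) M(1) in simp_all)
    finally show "\<bar>inverse (f p) - inverse (f q)\<bar> \<le> 1 / d * (M * (1 / d)) * dist p q" by (simp add: mult_ac)
  qed
qed

section \<open>The real density\<close>

type_synonym real5 = "real \<times> real \<times> real \<times> real \<times> real"

definition solve_x3 :: "real5 \<Rightarrow> real" where
  "solve_x3 = (\<lambda>(u1, u2, y1, y2, y3). - (u1 * y1\<^sup>2 + u2 * y2\<^sup>2) / y3\<^sup>2)"

text \<open>The coordinates are reordered so that \<open>x3\<close> comes last: Fubini then
  integrates over \<open>x3\<close> for fixed values of the other five, which parametrise the
  solutions of \<open>F x y = 0\<close> with \<open>y3 \<noteq> 0\<close>.\<close>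

definition vec_pair :: "real5 \<times> real \<Rightarrow> (real ^ 3) \<times> (real ^ 3)" where
  "vec_pair = (\<lambda>((u1, u2, y1, y2, y3), t). (vector [u1, u2, t], vector [y1, y2, y3]))"

text \<open>
  The density of the Leray measure on \<open>F x y = 0\<close> after eliminating \<open>x3\<close>. Division by zero is
  harmless: \<open>W\<close> vanishes near \<open>y3 = 0\<close>.
\<close>

definition leray_density :: "((real ^ 3) \<times> (real ^ 3) \<Rightarrow> real) \<Rightarrow> real5 \<Rightarrow> real" where
  "leray_density W p = W (vec_pair (p, solve_x3 p)) / (snd (snd (snd (snd p))))\<^sup>2"

lemma dist_vec_pair_le:
  "dist (vec_pair ((u1, u2, y1, y2, y3), t)) (vec_pair ((u1', u2', y1', y2', y3'), t')) \<le>
    \<bar>u1 - u1'\<bar> + \<bar>u2 - u2'\<bar> + \<bar>t - t'\<bar> + (\<bar>y1 - y1'\<bar> + \<bar>y2 - y2'\<bar> + \<bar>y3 - y3'\<bar>)"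
proof -
  have v: "norm (vector [a, b, c] - vector [a', b', c'] :: real ^ 3) \<le> \<bar>a - a'\<bar> + \<bar>b - b'\<bar> + \<bar>c - c'\<bar>" for a b c a' b' c' :: real
    by (rule order.trans[OF norm_le_l1_cart]) (simp add: sum_3)
  show ?thesis unfolding vec_pair_def dist_norm prod.case diff_Pair
    by (rule order.trans[OF norm_Pair_le]) (intro add_mono v)
qed

lemma abs_coordinate_diff_le_dist:
  fixes u1 u2 y1 y2 y3 u1' u2' y1' y2' y3' :: real
  defines "D \<equiv> dist (u1, u2, y1, y2, y3) (u1', u2', y1', y2', y3')"
  shows "\<bar>u1 - u1'\<bar> \<le> D" "\<bar>u2 - u2'\<bar> \<le> D" "\<bar>y1 - y1'\<bar> \<le> D" "\<bar>y2 - y2'\<bar> \<le> D" "\<bar>y3 - y3'\<bar> \<le> D"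
proof -
  let ?p = "(u1, u2, y1, y2, y3)" and ?q = "(u1', u2', y1', y2', y3')"
  show "\<bar>u1 - u1'\<bar> \<le> D" "\<bar>u2 - u2'\<bar> \<le> D" "\<bar>y1 - y1'\<bar> \<le> D" "\<bar>y2 - y2'\<bar> \<le> D" "\<bar>y3 - y3'\<bar> \<le> D"
    using dist_fst_le[of ?p ?q] order.trans[OF dist_fst_le dist_snd_le, of ?p ?q]
      order.trans[OF dist_fst_le order.trans[OF dist_snd_le dist_snd_le], of ?p ?q]
      order.trans[OF dist_fst_le order.trans[OF dist_snd_le order.trans[OF dist_snd_le dist_snd_le]], of ?p ?q]
      order.trans[OF dist_snd_le order.trans[OF dist_snd_le order.trans[OF dist_snd_le dist_snd_le]], of ?p ?q]
    unfolding D_def by (simp_all add: dist_real_def)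
qed

lemma coordinates_bounded_lipschitz:
  fixes S :: "real5 set"
  assumes "\<And>u1 u2 y1 y2 y3. (u1, u2, y1, y2, y3) \<in> S \<Longrightarrow> \<bar>u1\<bar> \<le> M \<and> \<bar>u2\<bar> \<le> M \<and> \<bar>y1\<bar> \<le> M \<and> \<bar>y2\<bar> \<le> M \<and> \<bar>y3\<bar> \<le> M"
  shows "bounded_lipschitz_on S fst" "bounded_lipschitz_on S (\<lambda>p. fst (snd p))"
    "bounded_lipschitz_on S (\<lambda>p. fst (snd (snd p)))" "bounded_lipschitz_on S (\<lambda>p. fst (snd (snd (snd p))))"
    "bounded_lipschitz_on S (\<lambda>p. snd (snd (snd (snd p))))"
proof -
  have b: "\<bar>fst p\<bar> \<le> M \<and> \<bar>fst (snd p)\<bar> \<le> M \<and> \<bar>fst (snd (snd p))\<bar> \<le> M \<and> \<bar>fst (snd (snd (snd p)))\<bar> \<le> M \<and> \<bar>snd (snd (snd (snd p)))\<bar> \<le> M"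
    if "p \<in> S" for p using assms[of "fst p" "fst (snd p)" "fst (snd (snd p))" "fst (snd (snd (snd p)))" "snd (snd (snd (snd p)))"] that by simp
  have d: "\<bar>x - y\<bar> \<le> 1 * D" if "dist x y \<le> D" for x y D :: real using that by (simp add: dist_real_def)
  show "bounded_lipschitz_on S fst"
    by (rule bounded_lipschitz_onI[where M=M and N=1]) (use b in blast, intro d dist_fst_le)
  show "bounded_lipschitz_on S (\<lambda>p. fst (snd p))"
    by (rule bounded_lipschitz_onI[where M=M and N=1]) (use b in blast, intro d order.trans[OF dist_fst_le dist_snd_le])
  show "bounded_lipschitz_on S (\<lambda>p. fst (snd (snd p)))"
    by (rule bounded_lipschitz_onI[where M=M and N=1])
      (use b in blast, intro d order.trans[OF dist_fst_le order.trans[OF dist_snd_le dist_snd_le]])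
  show "bounded_lipschitz_on S (\<lambda>p. fst (snd (snd (snd p))))"
    by (rule bounded_lipschitz_onI[where M=M and N=1])
      (use b in blast, intro d order.trans[OF dist_fst_le order.trans[OF dist_snd_le order.trans[OF dist_snd_le dist_snd_le]]])
  show "bounded_lipschitz_on S (\<lambda>p. snd (snd (snd (snd p))))"
    by (rule bounded_lipschitz_onI[where M=M and N=1])
      (use b in blast, intro d order.trans[OF dist_snd_le order.trans[OF dist_snd_le order.trans[OF dist_snd_le dist_snd_le]]])
qed

text \<open>Near the support \<open>y3\<close> stays away from 0, so \<open>solve_x3\<close> and the
  quotient are built from bounded Lipschitz functions there;
  \<open>lipschitz_if_lipschitz_near_support\<close> then passes to all points.\<close>

lemma leray_density_lipschitz:
  fixes W :: "(real ^ 3) \<times> (real ^ 3) \<Rightarrow> real" and c R L :: real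
  assumes c: "0 < c" "c \<le> 1" and R: "1 \<le> R" and L: "0 \<le> L"
    and supp: "\<And>x y i. W (x, y) \<noteq> 0 \<Longrightarrow> \<bar>x $ i\<bar> \<le> R \<and> c \<le> \<bar>y $ i\<bar> \<and> \<bar>y $ i\<bar> \<le> R"
    and bound: "\<And>p. \<bar>W p\<bar> \<le> L" and lip: "\<And>p q. \<bar>W p - W q\<bar> \<le> L * dist p q"
  obtains K where "K \<ge> 0" "\<And>p. \<bar>leray_density W p\<bar> \<le> K"
    "\<And>p q. \<bar>leray_density W p - leray_density W q\<bar> \<le> K * dist p q"
    "\<And>u1 u2 y1 y2 y3. leray_density W (u1, u2, y1, y2, y3) \<noteq> 0 \<Longrightarrow>
      \<bar>u1\<bar> \<le> R \<and> \<bar>u2\<bar> \<le> R \<and> \<bar>y1\<bar> \<le> R \<and> \<bar>y2\<bar> \<le> R \<and> \<bar>y3\<bar> \<le> R \<and> c \<le> \<bar>y1\<bar> \<and> c \<le> \<bar>y2\<bar> \<and> c \<le> \<bar>y3\<bar>"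
proof -
  \<comment> \<open>The margins 1 and \<open>c / 2\<close> make \<open>S\<close> contain all points
    at distance less than \<open>c / 2\<close> from a point of the support, as
    \<open>c <= 1\<close>.\<close>
  define S where "S = {(u1 :: real, u2 :: real, y1 :: real, y2 :: real, y3 :: real). \<bar>u1\<bar> \<le> R + 1 \<and> \<bar>u2\<bar> \<le> R + 1 \<and> \<bar>y1\<bar> \<le> R + 1 \<and> \<bar>y2\<bar> \<le> R + 1 \<and> \<bar>y3\<bar> \<le> R + 1 \<and> c / 2 \<le> \<bar>y3\<bar>}"
  have H: "leray_density W (u1, u2, y1, y2, y3) = W (vector [u1, u2, solve_x3 (u1, u2, y1, y2, y3)], vector [y1, y2, y3]) / y3\<^sup>2" for u1 u2 y1 y2 y3
    unfolding leray_density_def vec_pair_def by simp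
  have sH: "\<bar>u1\<bar> \<le> R \<and> \<bar>u2\<bar> \<le> R \<and> \<bar>y1\<bar> \<le> R \<and> \<bar>y2\<bar> \<le> R \<and> \<bar>y3\<bar> \<le> R \<and> c \<le> \<bar>y1\<bar> \<and> c \<le> \<bar>y2\<bar> \<and> c \<le> \<bar>y3\<bar>"
    if "leray_density W (u1, u2, y1, y2, y3) \<noteq> 0" for u1 u2 y1 y2 y3
  proof -
    have "W (vector [u1, u2, solve_x3 (u1, u2, y1, y2, y3)], vector [y1, y2, y3]) \<noteq> 0" using that unfolding H by auto
    from supp[OF this, of 1] supp[OF this, of 2] supp[OF this, of 3] show ?thesis by simp
  qed
  have cS: "bounded_lipschitz_on S fst" "bounded_lipschitz_on S (\<lambda>p. fst (snd p))"
    "bounded_lipschitz_on S (\<lambda>p. fst (snd (snd p)))" "bounded_lipschitz_on S (\<lambda>p. fst (snd (snd (snd p))))"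
    "bounded_lipschitz_on S (\<lambda>p. snd (snd (snd (snd p))))"
    by (rule coordinates_bounded_lipschitz[of S "R + 1"], simp add: S_def)+
  have ySq: "bounded_lipschitz_on S (\<lambda>p. inverse (snd (snd (snd (snd p))) * snd (snd (snd (snd p)))))"
  proof (rule bounded_lipschitz_on_inverse[OF bounded_lipschitz_on_mult[OF cS(5) cS(5)], of "c / 2 * (c / 2)"])
    show "0 < c / 2 * (c / 2)" using c by simp
    fix p assume "p \<in> S"
    hence "c / 2 \<le> \<bar>snd (snd (snd (snd p)))\<bar>" unfolding S_def by (cases p) simp
    thus "c / 2 * (c / 2) \<le> \<bar>snd (snd (snd (snd p))) * snd (snd (snd (snd p)))\<bar>"
      unfolding abs_mult using c by (intro mult_mono) simp_all
  qed
  have "bounded_lipschitz_on S (\<lambda>p. (-1) * (fst p * (fst (snd (snd p)) * fst (snd (snd p))) +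
      fst (snd p) * (fst (snd (snd (snd p))) * fst (snd (snd (snd p))))) * inverse (snd (snd (snd (snd p))) * snd (snd (snd (snd p)))))"
    by (intro bounded_lipschitz_on_mult bounded_lipschitz_on_add bounded_lipschitz_on_const cS ySq)
  moreover have "solve_x3 = (\<lambda>p. (-1) * (fst p * (fst (snd (snd p)) * fst (snd (snd p))) +
      fst (snd p) * (fst (snd (snd (snd p))) * fst (snd (snd (snd p))))) * inverse (snd (snd (snd (snd p))) * snd (snd (snd (snd p)))))"
    unfolding solve_x3_def by (rule ext) (simp add: case_prod_unfold power2_eq_square divide_inverse)
  ultimately have T: "bounded_lipschitz_on S solve_x3" by simp
  obtain M where M: "M \<ge> 0" "\<And>p q. p \<in> S \<Longrightarrow> q \<in> S \<Longrightarrow> \<bar>solve_x3 p - solve_x3 q\<bar> \<le> M * dist p q"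
    using T by (rule bounded_lipschitz_onE) blast
  have WS: "bounded_lipschitz_on S (\<lambda>p. W (vec_pair (p, solve_x3 p)))"
  proof (rule bounded_lipschitz_onI[where M=L and N="L * (5 + M)"])
    show "\<bar>W (vec_pair (p, solve_x3 p))\<bar> \<le> L" for p by (rule bound)
    fix p q assume pq: "p \<in> S" "q \<in> S"
    obtain u1 u2 y1 y2 y3 where p: "p = (u1, u2, y1, y2, y3)" by (cases p)
    obtain u1' u2' y1' y2' y3' where q: "q = (u1', u2', y1', y2', y3')" by (cases q)
    have d: "\<bar>u1 - u1'\<bar> \<le> dist p q" "\<bar>u2 - u2'\<bar> \<le> dist p q" "\<bar>y1 - y1'\<bar> \<le> dist p q" "\<bar>y2 - y2'\<bar> \<le> dist p q" "\<bar>y3 - y3'\<bar> \<le> dist p q"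
      unfolding p q by (rule abs_coordinate_diff_le_dist)+
    have "\<bar>W (vec_pair (p, solve_x3 p)) - W (vec_pair (q, solve_x3 q))\<bar> \<le> L * dist (vec_pair (p, solve_x3 p)) (vec_pair (q, solve_x3 q))"
      by (rule lip)
    also have "dist (vec_pair (p, solve_x3 p)) (vec_pair (q, solve_x3 q)) \<le>
      \<bar>u1 - u1'\<bar> + \<bar>u2 - u2'\<bar> + \<bar>solve_x3 p - solve_x3 q\<bar> + (\<bar>y1 - y1'\<bar> + \<bar>y2 - y2'\<bar> + \<bar>y3 - y3'\<bar>)"
      using dist_vec_pair_le[of u1 u2 y1 y2 y3 "solve_x3 p" u1' u2' y1' y2' y3' "solve_x3 q"] unfolding p q .
    also have "\<dots> \<le> (5 + M) * dist p q" using d M(2)[OF pq] unfolding distrib_right by linarith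
    finally show "\<bar>W (vec_pair (p, solve_x3 p)) - W (vec_pair (q, solve_x3 q))\<bar> \<le> L * (5 + M) * dist p q"
      using L by (simp add: mult.assoc mult_left_mono)
  qed
  have "bounded_lipschitz_on S (\<lambda>p. W (vec_pair (p, solve_x3 p)) * inverse (snd (snd (snd (snd p))) * snd (snd (snd (snd p)))))"
    by (rule bounded_lipschitz_on_mult[OF WS ySq])
  moreover have "leray_density W = (\<lambda>p. W (vec_pair (p, solve_x3 p)) * inverse (snd (snd (snd (snd p))) * snd (snd (snd (snd p)))))"
    unfolding leray_density_def by (rule ext) (simp add: power2_eq_square divide_inverse)
  ultimately have "bounded_lipschitz_on S (leray_density W)" by simp
  then obtain N where N: "N \<ge> 0" "\<And>p q. p \<in> S \<Longrightarrow> q \<in> S \<Longrightarrow> \<bar>leray_density W p - leray_density W q\<bar> \<le> N * dist p q"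
    by (rule bounded_lipschitz_onE) blast
  have bH: "\<bar>leray_density W p\<bar> \<le> L / c\<^sup>2" for p
  proof (cases "leray_density W p = 0")
    case True
    thus ?thesis using L by simp
  next
    case False
    obtain u1 u2 y1 y2 y3 where p: "p = (u1, u2, y1, y2, y3)" by (cases p)
    have "c \<le> \<bar>y3\<bar>" using sH False unfolding p by blast
    hence "c\<^sup>2 \<le> y3\<^sup>2" using c power_mono[of c "\<bar>y3\<bar>" 2] by simp
    thus ?thesis unfolding p H abs_divide using c bound L by (intro frac_le) simp_all
  qed
  have lH: "\<bar>leray_density W p - leray_density W q\<bar> \<le> (N + (L / c\<^sup>2) / (c / 2)) * dist p q" for p q
  proof (rule lipschitz_if_lipschitz_near_support[OF _ bH N])
    show "0 < c / 2" using c by simp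
    fix p q assume "leray_density W p \<noteq> 0" and dpq: "dist p q < c / 2"
    obtain u1 u2 y1 y2 y3 where p: "p = (u1, u2, y1, y2, y3)" by (cases p)
    obtain u1' u2' y1' y2' y3' where q: "q = (u1', u2', y1', y2', y3')" by (cases q)
    have s: "\<bar>u1\<bar> \<le> R" "\<bar>u2\<bar> \<le> R" "\<bar>y1\<bar> \<le> R" "\<bar>y2\<bar> \<le> R" "\<bar>y3\<bar> \<le> R" "c \<le> \<bar>y3\<bar>"
      using sH \<open>leray_density W p \<noteq> 0\<close> unfolding p by blast+
    have d: "\<bar>u1 - u1'\<bar> \<le> dist p q" "\<bar>u2 - u2'\<bar> \<le> dist p q" "\<bar>y1 - y1'\<bar> \<le> dist p q" "\<bar>y2 - y2'\<bar> \<le> dist p q" "\<bar>y3 - y3'\<bar> \<le> dist p q"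
      unfolding p q by (rule abs_coordinate_diff_le_dist)+
    have a: "\<bar>x'\<bar> \<le> R + 1" if "\<bar>x\<bar> \<le> R" "\<bar>x - x'\<bar> \<le> dist p q" for x x' :: real
      using that dpq c by linarith
    have "c / 2 \<le> \<bar>y3'\<bar>" using s(6) d(5) dpq by linarith
    with a[OF s(1) d(1)] a[OF s(2) d(2)] a[OF s(3) d(3)] a[OF s(4) d(4)] a[OF s(5) d(5)]
    show "q \<in> S" unfolding q S_def by simp
  qed
  define K where "K = max (L / c\<^sup>2) (N + (L / c\<^sup>2) / (c / 2))"
  show thesis
  proof (rule that[of K])
    show "0 \<le> K" unfolding K_def using L by (simp add: le_max_iff_disj)
    show "\<bar>leray_density W p\<bar> \<le> K" for p using bH[of p] unfolding K_def by simp
    show "\<bar>leray_density W p - leray_density W q\<bar> \<le> K * dist p q" for p q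
      by (rule order.trans[OF lH]) (intro mult_right_mono; simp add: K_def)
  qed (rule sH)
qed

section \<open>Lebesgue measure in the reordered coordinates\<close>

lemma prod_Basis_Pair:
  fixes f :: "'a::euclidean_space \<times> 'b::euclidean_space \<Rightarrow> real"
  shows "(\<Prod>b\<in>Basis. f b) = (\<Prod>b\<in>Basis. f (b, 0)) * (\<Prod>b\<in>Basis. f (0, b))"
proof -
  have "inj_on (\<lambda>u::'a. (u, 0::'b)) Basis" "inj_on (\<lambda>u::'b. (0::'a, u)) Basis"
    "(\<lambda>u::'a. (u, 0::'b)) ` Basis \<inter> (\<lambda>u::'b. (0::'a, u)) ` Basis = {}"
    by (auto intro!: inj_onI)
  thus ?thesis by (simp add: Basis_prod_def prod.union_disjoint prod.reindex)
qed

lemma sum_Basis_Pair: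
  fixes f :: "'a::euclidean_space \<times> 'b::euclidean_space \<Rightarrow> real"
  shows "(\<Sum>b\<in>Basis. f b) = (\<Sum>b\<in>Basis. f (b, 0)) + (\<Sum>b\<in>Basis. f (0, b))"
proof -
  have "inj_on (\<lambda>u::'a. (u, 0::'b)) Basis" "inj_on (\<lambda>u::'b. (0::'a, u)) Basis"
    "(\<lambda>u::'a. (u, 0::'b)) ` Basis \<inter> (\<lambda>u::'b. (0::'a, u)) ` Basis = {}"
    by (auto intro!: inj_onI)
  thus ?thesis by (simp add: Basis_prod_def sum.union_disjoint sum.reindex)
qed

lemma ball_Basis_Pair:
  "(\<forall>b\<in>Basis. P b) \<longleftrightarrow> (\<forall>b\<in>Basis. P (b, 0)) \<and> (\<forall>b\<in>Basis. P (0, b))"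
  for P :: "'a::euclidean_space \<times> 'b::euclidean_space \<Rightarrow> bool"
  by (auto simp: Basis_prod_def)

lemma Basis_real3: "(Basis :: (real ^ 3) set) = {axis 1 1, axis 2 1, axis 3 1}"
  unfolding Basis_vec_def by (auto simp: UNIV_3)

lemma prod_Basis_real3:
  fixes f :: "real ^ 3 \<Rightarrow> real"
  shows "(\<Prod>b\<in>Basis. f b) = f (axis 1 1) * f (axis 2 1) * f (axis 3 1)"
  unfolding Basis_real3 by (simp add: axis_eq_axis mult.assoc)

lemma linear_vec_pair: "linear vec_pair"
  by (rule linearI) (auto simp: vec_pair_def vec_eq_iff forall_3 case_prod_unfold)

lemma measurable_vec_pair: "vec_pair \<in> borel_measurable borel"
  by (rule borel_measurable_continuous_onI)
    (intro linear_continuous_on linear_conv_bounded_linear[THEN iffD1] linear_vec_pair)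

text \<open>A permutation of the coordinates carries boxes to boxes of the same volume, and Lebesgue
  measure is determined by its values on boxes.\<close>

lemma distr_vec_pair: "distr lborel borel vec_pair = lborel"
proof (rule lborel_eqI[symmetric])
  fix l u :: "(real ^ 3) \<times> (real ^ 3)"
  assume lu: "\<And>b. b \<in> Basis \<Longrightarrow> l \<bullet> b \<le> u \<bullet> b"
  obtain l1 l2 where l: "l = (l1, l2)" by (cases l)
  obtain u1 u2 where u: "u = (u1, u2)" by (cases u)
  have le: "l1 $ i \<le> u1 $ i" "l2 $ i \<le> u2 $ i" for i
    using lu[of "(axis i 1, 0)"] lu[of "(0, axis i 1)"] unfolding l u by (simp_all add: Basis_prod_def inner_axis)
  define a where "a = ((l1 $ 1, l1 $ 2, l2 $ 1, l2 $ 2, l2 $ 3), l1 $ 3)"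
  define b where "b = ((u1 $ 1, u1 $ 2, u2 $ 1, u2 $ 2, u2 $ 3), u1 $ 3)"
  have pre: "vec_pair -` box l u = box a b"
  proof (unfold set_eq_iff, rule allI)
    fix p :: "real5 \<times> real"
    obtain v1 v2 y1 y2 y3 t where p: "p = ((v1, v2, y1, y2, y3), t)" by (cases p) auto
    show "p \<in> vec_pair -` box l u \<longleftrightarrow> p \<in> box a b"
      unfolding p l u a_def b_def vec_pair_def by (auto simp: mem_box ball_Basis_Pair Basis_real3 inner_axis)
  qed
  have ab: "a \<bullet> i \<le> b \<bullet> i" if "i \<in> Basis" for i
  proof -
    have "\<forall>i\<in>Basis. a \<bullet> i \<le> b \<bullet> i" unfolding a_def b_def by (simp add: ball_Basis_Pair le)
    thus ?thesis using that by blast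
  qed
  have "emeasure (distr lborel borel vec_pair) (box l u) = emeasure lborel (box a b)"
    using measurable_vec_pair by (subst emeasure_distr) (simp_all add: pre)
  also have "\<dots> = ennreal (\<Prod>i\<in>Basis. (b - a) \<bullet> i)" by (rule emeasure_lborel_box[OF ab])
  also have "(\<Prod>i\<in>Basis. (b - a) \<bullet> i) = (\<Prod>i\<in>Basis. (u - l) \<bullet> i)"
    unfolding a_def b_def l u by (simp add: prod_Basis_Pair prod_Basis_real3 inner_axis mult_ac)
  finally show "emeasure (distr lborel borel vec_pair) (box l u) = ennreal (\<Prod>i\<in>Basis. (u - l) \<bullet> i)" .
qed simp

lemma integral_vec_pair:
  fixes f :: "(real ^ 3) \<times> (real ^ 3) \<Rightarrow> real"
  assumes f: "integrable lborel f"
  shows "(LINT z|lborel. f z) = (LINT p|lborel. LINT t|lborel. f (vec_pair (p, t)))"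
    "integrable lborel (\<lambda>p. LINT t|lborel. f (vec_pair (p, t)))"
proof -
  have m: "f \<in> borel_measurable borel" using borel_measurable_integrable[OF f] by simp
  have mv: "vec_pair \<in> measurable lborel borel" using measurable_vec_pair by simp
  have "integrable (distr lborel borel vec_pair) f" unfolding distr_vec_pair by (rule f)
  hence i: "integrable (lborel \<Otimes>\<^sub>M lborel) (\<lambda>q. f (vec_pair q))"
    unfolding lborel_prod by (simp only: integrable_distr_eq[OF mv m])
  have "(LINT z|lborel. f z) = (LINT z|distr lborel borel vec_pair. f z)" unfolding distr_vec_pair ..
  also have "\<dots> = (LINT q|lborel. f (vec_pair q))" by (rule integral_distr[OF mv m])
  also have "\<dots> = (LINT q|(lborel \<Otimes>\<^sub>M lborel). f (vec_pair q))" unfolding lborel_prod ..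
  also have "\<dots> = (LINT p|lborel. LINT t|lborel. f (vec_pair (p, t)))" by (rule lborel_pair.integral_fst'[OF i, symmetric])
  finally show "(LINT z|lborel. f z) = (LINT p|lborel. LINT t|lborel. f (vec_pair (p, t)))" .
  show "integrable lborel (\<lambda>p. LINT t|lborel. f (vec_pair (p, t)))" by (rule lborel_pair.integrable_fst'[OF i])
qed

lemma integrable_bounded_support:
  fixes f :: "'a::euclidean_space \<Rightarrow> real"
  assumes "f \<in> borel_measurable borel" "\<And>x. \<bar>f x\<bar> \<le> M" "\<And>x. f x \<noteq> 0 \<Longrightarrow> x \<in> cbox a b"
  shows "integrable lborel f"
proof (rule Bochner_Integration.integrable_bound)
  show "integrable lborel (\<lambda>x. M * indicator (cbox a b) x :: real)"
    by (intro integrable_mult_right integrable_real_indicator) (simp_all add: emeasure_lborel_cbox_eq)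
  show "f \<in> borel_measurable lborel" using assms(1) by simp
  show "AE x in lborel. norm (f x) \<le> norm (M * indicator (cbox a b) x)"
  proof (rule AE_I2)
    fix x
    show "norm (f x) \<le> norm (M * indicator (cbox a b) x)"
    proof (cases "f x = 0")
      case False
      thus ?thesis using assms(2)[of x] assms(3)[of x] by simp
    qed simp
  qed
qed

lemma continuous_on_if_lipschitz:
  fixes f :: "'a::metric_space \<Rightarrow> real"
  assumes "\<And>p q. \<bar>f p - f q\<bar> \<le> L * dist p q" "0 \<le> L"
  shows "continuous_on UNIV f"
proof -
  have "L-lipschitz_on UNIV f" by (rule lipschitz_onI) (use assms in \<open>simp_all add: dist_real_def\<close>)
  thus ?thesis by (rule lipschitz_on_continuous_on)
qed

lemma F_vec_pair: "F (fst (vec_pair ((u1, u2, y1, y2, y3), t))) (snd (vec_pair ((u1, u2, y1, y2, y3), t))) = u1 * y1\<^sup>2 + u2 * y2\<^sup>2 + t * y3\<^sup>2"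
  unfolding vec_pair_def F_def by simp

text \<open>For fixed values of the other five coordinates,
  \<open>\<bar>F x y\<bar> <= \<epsilon>\<close> describes an interval in \<open>x3\<close> centred
  at \<open>solve_x3\<close> with half-length \<open>\<delta> = \<epsilon> / y3^2\<close>. On it
  \<open>W\<close> differs from its value at the centre by at most \<open>L * \<delta>\<close>, and
  \<open>2 * \<delta> / (2 * \<epsilon>)\<close> is the factor \<open>1 / y3^2\<close> of the Leray
  density. The error \<open>L * \<epsilon> / y3^4\<close> is integrated over a cube of volume
  \<open>(2 * R) ^ 5\<close>.\<close>

lemma density_approx_estimate:
  fixes W :: "(real ^ 3) \<times> (real ^ 3) \<Rightarrow> real" and c R L \<epsilon> :: real
  assumes c: "0 < c" "c \<le> 1" and R: "1 \<le> R" and L: "0 \<le> L"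
    and supp: "\<And>x y i. W (x, y) \<noteq> 0 \<Longrightarrow> \<bar>x $ i\<bar> \<le> R \<and> c \<le> \<bar>y $ i\<bar> \<and> \<bar>y $ i\<bar> \<le> R"
    and bound: "\<And>p. \<bar>W p\<bar> \<le> L" and lip: "\<And>p q. \<bar>W p - W q\<bar> \<le> L * dist p q"
    and int: "integrable lborel (leray_density W)" and \<epsilon>: "\<epsilon> > 0"
  shows "\<bar>density_approx W \<epsilon> - (LINT p|lborel. leray_density W p)\<bar> \<le> L / c ^ 4 * (2 * R) ^ 5 * \<epsilon>"
proof -
  define A where "A = {(x :: real ^ 3, y :: real ^ 3). \<bar>F x y\<bar> \<le> \<epsilon>}"
  define f where "f = (\<lambda>z. indicator A z * W z)"
  have "closed A"
  proof -
    have "A = {z. \<bar>F (fst z) (snd z)\<bar> \<le> \<epsilon>}" unfolding A_def by auto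
    also have "closed \<dots>" unfolding F_def by (intro closed_Collect_le continuous_intros)
    finally show ?thesis .
  qed
  hence Ab: "A \<in> sets borel" by (rule borel_closed)
  have mW: "W \<in> borel_measurable borel" by (rule borel_measurable_continuous_onI[OF continuous_on_if_lipschitz[OF lip L]])
  define Rv :: "real ^ 3" where "Rv = (\<chi> i. R)"
  have fi: "integrable lborel f"
  proof (rule integrable_bounded_support[of f L "(- Rv, - Rv)" "(Rv, Rv)"])
    show "f \<in> borel_measurable borel" unfolding f_def using Ab mW by measurable
    show "\<bar>f x\<bar> \<le> L" for x unfolding f_def using bound[of x] L by (simp add: indicator_def)
    fix z assume "f z \<noteq> 0"
    obtain x y where z: "z = (x, y)" by (cases z)
    have Wz: "W (x, y) \<noteq> 0"
    proof
      assume "W (x, y) = 0"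
      hence "f z = 0" unfolding f_def z by simp
      thus False using \<open>f z \<noteq> 0\<close> by simp
    qed
    have "- R \<le> x $ i \<and> x $ i \<le> R" "- R \<le> y $ i \<and> y $ i \<le> R" for i using supp[OF Wz, of i] by linarith+
    hence "x \<in> cbox (- Rv) Rv" "y \<in> cbox (- Rv) Rv" unfolding mem_box_cart Rv_def by simp_all
    thus "z \<in> cbox (- Rv, - Rv) (Rv, Rv)" unfolding z cbox_Pair_eq by simp
  qed
  define g where "g = (\<lambda>p. LINT t|lborel. f (vec_pair (p, t)))"
  have gi: "integrable lborel g" and gf: "(LINT z|lborel. f z) = (LINT p|lborel. g p)"
    unfolding g_def by (rule integral_vec_pair[OF fi])+
  have da: "density_approx W \<epsilon> = (LINT p|lborel. g p / (2 * \<epsilon>))"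
  proof -
    have "density_approx W \<epsilon> = inverse (2 * \<epsilon>) * (LINT z|lborel. f z)"
      unfolding density_approx_def set_lebesgue_integral_def A_def[symmetric] f_def real_scaleR_def ..
    also have "\<dots> = (LINT p|lborel. inverse (2 * \<epsilon>) * g p)"
      unfolding gf by (rule integral_mult_right_zero[symmetric])
    also have "\<dots> = (LINT p|lborel. g p / (2 * \<epsilon>))" by (simp only: divide_inverse mult.commute)
    finally show ?thesis .
  qed
  define Q where "Q = cbox (- R, - R, - R, - R, - R) (R, R, R, R, R)"
  define C where "C = L / c ^ 4 * \<epsilon>"
  have C0: "C \<ge> 0" unfolding C_def using L c \<epsilon> by simp
  have pt: "\<bar>g p / (2 * \<epsilon>) - leray_density W p\<bar> \<le> C * indicator Q p" for p
  proof -
    obtain u1 u2 y1 y2 y3 where p: "p = (u1, u2, y1, y2, y3)" by (cases p)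
    show ?thesis
    proof (cases "\<bar>u1\<bar> \<le> R \<and> \<bar>u2\<bar> \<le> R \<and> \<bar>y1\<bar> \<le> R \<and> \<bar>y2\<bar> \<le> R \<and> \<bar>y3\<bar> \<le> R \<and> c \<le> \<bar>y3\<bar>")
      case False
      have W0: "W (vec_pair (p, t)) = 0" for t
      proof (rule ccontr)
        assume "W (vec_pair (p, t)) \<noteq> 0"
        hence "W (vector [u1, u2, t], vector [y1, y2, y3]) \<noteq> 0" unfolding p vec_pair_def by simp
        from supp[OF this, of 1] supp[OF this, of 2] supp[OF this, of 3] show False using False by simp
      qed
      have "g p = 0" unfolding g_def f_def W0 by simp
      moreover have "leray_density W p = 0" unfolding leray_density_def W0 by simp
      ultimately show ?thesis using C0 by simp
    next
      case True
      define T where "T = solve_x3 p"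
      define \<delta> where "\<delta> = \<epsilon> / y3\<^sup>2"
      have c2: "c\<^sup>2 \<le> y3\<^sup>2" using True c power_mono[of c "\<bar>y3\<bar>" 2] by simp
      have y0: "y3\<^sup>2 > 0" using c2 c zero_less_power[of c 2] by linarith
      have \<delta>0: "\<delta> > 0" unfolding \<delta>_def using \<epsilon> y0 by simp
      have memA: "vec_pair (p, t) \<in> A \<longleftrightarrow> t \<in> {T - \<delta>..T + \<delta>}" for t
      proof -
        have "u1 * y1\<^sup>2 + u2 * y2\<^sup>2 + t * y3\<^sup>2 = (t - T) * y3\<^sup>2"
          unfolding T_def p solve_x3_def using y0 by (simp add: field_simps)
        hence "vec_pair (p, t) \<in> A \<longleftrightarrow> \<bar>(t - T) * y3\<^sup>2\<bar> \<le> \<epsilon>"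
          unfolding A_def using F_vec_pair[of u1 u2 y1 y2 y3 t] unfolding p by (simp add: case_prod_unfold)
        also have "\<dots> \<longleftrightarrow> \<bar>t - T\<bar> \<le> \<delta>" unfolding \<delta>_def using y0 by (simp add: abs_mult pos_le_divide_eq)
        finally show ?thesis by (auto simp: abs_le_iff)
      qed
      have fv: "f (vec_pair (p, t)) = indicator {T - \<delta>..T + \<delta>} t * W (vec_pair (p, t))" for t
        unfolding f_def using memA[of t] by (simp add: indicator_def)
      have lipt: "\<bar>W (vec_pair (p, t)) - W (vec_pair (p, T))\<bar> \<le> L * \<bar>t - T\<bar>" for t
      proof -
        have "\<bar>W (vec_pair (p, t)) - W (vec_pair (p, T))\<bar> \<le> L * dist (vec_pair (p, t)) (vec_pair (p, T))" by (rule lip)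
        also have "dist (vec_pair (p, t)) (vec_pair (p, T)) \<le> \<bar>t - T\<bar>"
          using dist_vec_pair_le[of u1 u2 y1 y2 y3 t u1 u2 y1 y2 y3 T] unfolding p by simp
        finally show ?thesis using L by (simp add: mult_left_mono)
      qed
      have ii: "integrable lborel (\<lambda>t. indicator {T - \<delta>..T + \<delta>} t * k :: real)" for k
        by (intro integrable_mult_left integrable_real_indicator) (simp_all add: \<delta>0 less_imp_le)
      have cW: "continuous_on UNIV (\<lambda>t. W (vec_pair (p, t)))"
        by (intro continuous_on_compose2[OF continuous_on_if_lipschitz[OF lip L]]
          continuous_on_compose2[OF linear_continuous_on[OF linear_conv_bounded_linear[THEN iffD1, OF linear_vec_pair]]] continuous_intros) auto
      have iw: "integrable lborel (\<lambda>t. indicator {T - \<delta>..T + \<delta>} t * W (vec_pair (p, t)))"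
      proof (rule integrable_bounded_support[of _ L "T - \<delta>" "T + \<delta>"])
        have "(\<lambda>t. W (vec_pair (p, t))) \<in> borel_measurable borel" by (rule borel_measurable_continuous_onI[OF cW])
        thus "(\<lambda>t. indicator {T - \<delta>..T + \<delta>} t * W (vec_pair (p, t))) \<in> borel_measurable borel" by measurable
        show "\<bar>indicator {T - \<delta>..T + \<delta>} t * W (vec_pair (p, t))\<bar> \<le> L" for t
          using bound L by (simp add: indicator_def)
        show "t \<in> cbox (T - \<delta>) (T + \<delta>)" if "indicator {T - \<delta>..T + \<delta>} t * W (vec_pair (p, t)) \<noteq> 0" for t
          using that by (simp add: indicator_def split: if_splits)
      qed
      have mi: "(LINT t|lborel. indicator {T - \<delta>..T + \<delta>} t * k :: real) = 2 * \<delta> * k" for k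
        using \<delta>0 by simp
      have e1: "g p - 2 * \<delta> * W (vec_pair (p, T)) = (LINT t|lborel. indicator {T - \<delta>..T + \<delta>} t * W (vec_pair (p, t))
          - indicator {T - \<delta>..T + \<delta>} t * W (vec_pair (p, T)))"
        unfolding g_def fv mi[symmetric] by (rule Bochner_Integration.integral_diff[symmetric], rule iw, rule ii)
      have "\<bar>g p - 2 * \<delta> * W (vec_pair (p, T))\<bar> \<le> (LINT t|lborel. \<bar>indicator {T - \<delta>..T + \<delta>} t * W (vec_pair (p, t))
          - indicator {T - \<delta>..T + \<delta>} t * W (vec_pair (p, T))\<bar>)" unfolding e1 by (rule integral_abs_bound)
      also have "\<dots> \<le> (LINT t|lborel. indicator {T - \<delta>..T + \<delta>} t * (L * \<delta>))"
      proof (rule integral_mono)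
        show "integrable lborel (\<lambda>t. \<bar>indicator {T - \<delta>..T + \<delta>} t * W (vec_pair (p, t))
          - indicator {T - \<delta>..T + \<delta>} t * W (vec_pair (p, T))\<bar>)"
          by (rule integrable_abs, rule Bochner_Integration.integrable_diff, rule iw, rule ii)
        show "integrable lborel (\<lambda>t. indicator {T - \<delta>..T + \<delta>} t * (L * \<delta>))" by (rule ii)
        fix t
        show "\<bar>indicator {T - \<delta>..T + \<delta>} t * W (vec_pair (p, t)) - indicator {T - \<delta>..T + \<delta>} t * W (vec_pair (p, T))\<bar>
          \<le> indicator {T - \<delta>..T + \<delta>} t * (L * \<delta>)"
        proof (cases "t \<in> {T - \<delta>..T + \<delta>}")
          case True
          hence "\<bar>t - T\<bar> \<le> \<delta>" by (auto simp: abs_le_iff)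
          hence "L * \<bar>t - T\<bar> \<le> L * \<delta>" using L by (rule mult_left_mono)
          thus ?thesis using True lipt[of t] by simp
        qed simp
      qed
      also have "\<dots> = 2 * \<delta> * (L * \<delta>)" by (rule mi)
      finally have main: "\<bar>g p - 2 * \<delta> * W (vec_pair (p, T))\<bar> \<le> 2 * \<delta> * (L * \<delta>)" .
      have e: "g p / (2 * \<epsilon>) - leray_density W p = (g p - 2 * \<delta> * W (vec_pair (p, T))) / (2 * \<epsilon>)"
        unfolding leray_density_def T_def[symmetric] \<delta>_def using \<epsilon> y0 unfolding p by (simp add: field_simps)
      have pQ: "p \<in> Q" using True unfolding p Q_def cbox_Pair_eq by (simp add: abs_le_iff)
      have "\<bar>g p / (2 * \<epsilon>) - leray_density W p\<bar> \<le> 2 * \<delta> * (L * \<delta>) / (2 * \<epsilon>)"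
      proof -
        have "\<bar>(g p - 2 * \<delta> * W (vec_pair (p, T))) / (2 * \<epsilon>)\<bar> = \<bar>g p - 2 * \<delta> * W (vec_pair (p, T))\<bar> / (2 * \<epsilon>)"
          using \<epsilon> by simp
        also have "\<dots> \<le> 2 * \<delta> * (L * \<delta>) / (2 * \<epsilon>)" by (rule divide_right_mono[OF main]) (use \<epsilon> in simp)
        finally show ?thesis unfolding e .
      qed
      also have "\<dots> = L * \<epsilon> / (y3\<^sup>2 * y3\<^sup>2)" unfolding \<delta>_def using \<epsilon> by (simp add: field_simps)
      also have "\<dots> \<le> L * \<epsilon> / (c\<^sup>2 * c\<^sup>2)"
        using c2 c L \<epsilon> y0 by (intro divide_left_mono mult_mono mult_pos_pos mult_nonneg_nonneg) simp_all
      also have "\<dots> = C" unfolding C_def by (simp flip: power_add)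
      also have "\<dots> = C * indicator Q p" using pQ by simp
      finally show ?thesis .
    qed
  qed
  have Qm: "emeasure lborel Q = ennreal ((2 * R) ^ 5)"
  proof -
    have "\<forall>i\<in>Basis. (- R, - R, - R, - R, - R) \<bullet> i \<le> (R, R, R, R, R) \<bullet> i" using R by (simp add: ball_Basis_Pair)
    hence le: "(- R, - R, - R, - R, - R) \<bullet> i \<le> (R, R, R, R, R) \<bullet> i" if "i \<in> Basis" for i using that by (rule bspec)
    have "emeasure lborel Q = ennreal (\<Prod>i\<in>Basis. ((R, R, R, R, R) - (- R, - R, - R, - R, - R)) \<bullet> i)"
      unfolding Q_def by (rule emeasure_lborel_cbox) (rule le)
    also have "(\<Prod>i\<in>Basis. ((R, R, R, R, R) - (- R, - R, - R, - R, - R)) \<bullet> i) = (2 * R) ^ 5"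
      by (simp add: prod_Basis_Pair eval_nat_numeral)
    finally show ?thesis .
  qed
  have "\<bar>density_approx W \<epsilon> - (LINT p|lborel. leray_density W p)\<bar> = \<bar>LINT p|lborel. g p / (2 * \<epsilon>) - leray_density W p\<bar>"
    unfolding da by (subst Bochner_Integration.integral_diff[OF integrable_divide[OF gi] int]) simp
  also have "\<dots> \<le> (LINT p|lborel. \<bar>g p / (2 * \<epsilon>) - leray_density W p\<bar>)" by (rule integral_abs_bound)
  also have "\<dots> \<le> (LINT p|lborel. C * indicator Q p)"
  proof (rule integral_mono)
    show "integrable lborel (\<lambda>p. \<bar>g p / (2 * \<epsilon>) - leray_density W p\<bar>)"
      by (intro integrable_abs Bochner_Integration.integrable_diff integrable_divide gi int)
    show "integrable lborel (\<lambda>p. C * indicator Q p :: real)"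
      by (intro integrable_mult_right integrable_real_indicator) (simp_all add: Qm, simp add: Q_def)
  qed (rule pt)
  also have "\<dots> = C * (2 * R) ^ 5" using R Qm by (simp add: measure_def)
  finally show ?thesis by (simp add: C_def mult_ac)
qed

text \<open>The linear estimate also proves that the limit exists, without which the value of
  \<open>Lim\<close> would carry no information.\<close>

lemma real_density_eq_integral:
  fixes W :: "(real ^ 3) \<times> (real ^ 3) \<Rightarrow> real"
  assumes est: "\<And>\<epsilon>. \<epsilon> > 0 \<Longrightarrow> \<bar>density_approx W \<epsilon> - I\<bar> \<le> C * \<epsilon>"
  shows "(density_approx W \<longlongrightarrow> I) (at_right 0)" "real_density W = I"
proof -
  show lim: "(density_approx W \<longlongrightarrow> I) (at_right 0)"
  proof (rule LIM_zero_cancel, rule Lim_null_comparison)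
    show "\<forall>\<^sub>F \<epsilon> in at_right 0. norm (density_approx W \<epsilon> - I) \<le> C * \<epsilon>"
      using eventually_at_right_less[of "0::real"] by eventually_elim (use est in simp)
    have "((\<lambda>\<epsilon>. C * \<epsilon>) \<longlongrightarrow> C * 0) (at_right 0)" by (intro tendsto_intros)
    thus "((\<lambda>\<epsilon>. C * \<epsilon>) \<longlongrightarrow> 0) (at_right 0)" by simp
  qed
  show "real_density W = I" unfolding real_density_def by (rule tendsto_Lim[OF _ lim]) simp
qed

section \<open>The counting function\<close>

definition scaled_point :: "real \<Rightarrow> int \<times> int \<times> int \<Rightarrow> int \<times> int \<Rightarrow> real5" where
  "scaled_point B = (\<lambda>(y1, y2, y3) (a, b). (a / B, b / B, y1 / B, y2 / B, y3 / B))"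

text \<open>Defined for every integer pair, also where the solved third coordinate is not an
  integer: the lattice sum is to be compared with the sum over all pairs of the box.\<close>

definition weight_on_lattice :: "((real ^ 3) \<times> (real ^ 3) \<Rightarrow> real) \<Rightarrow> real \<Rightarrow> int \<times> int \<times> int \<Rightarrow> int \<times> int \<Rightarrow> real" where
  "weight_on_lattice W B y p = W (vec_pair (scaled_point B y p, solve_x3 (scaled_point B y p)))"

text \<open>\<open>solve_x3\<close> is homogeneous of degree 1 in the first two coordinates and of
  degree 0 in those of \<open>y\<close>.\<close>

lemma solve_x3_scaled:
  fixes k a b y1 y2 y3 :: int
  assumes "B > 0" "y3 \<noteq> 0" "a * y1\<^sup>2 + b * y2\<^sup>2 + k * y3\<^sup>2 = 0"
  shows "solve_x3 (scaled_point B (y1, y2, y3) (a, b)) = k / B"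
proof -
  have "real_of_int (a * y1\<^sup>2 + b * y2\<^sup>2 + k * y3\<^sup>2) = 0" using assms(3) by simp
  hence e: "- (real_of_int a * (real_of_int y1)\<^sup>2 + real_of_int b * (real_of_int y2)\<^sup>2) = real_of_int k * (real_of_int y3)\<^sup>2" by simp
  have y: "(real_of_int y3)\<^sup>2 \<noteq> 0" using assms(2) by simp
  have "solve_x3 (scaled_point B (y1, y2, y3) (a, b)) =
      - (real_of_int a * (real_of_int y1)\<^sup>2 + real_of_int b * (real_of_int y2)\<^sup>2) / (B * (real_of_int y3)\<^sup>2)"
    unfolding solve_x3_def scaled_point_def using assms(1) y by (simp add: field_simps power2_eq_square)
  also have "\<dots> = k / B" unfolding e using y by simp
  finally show ?thesis .
qed

text \<open>\<open>j\<close> supplies \<open>x3\<close> by an exact division. It is injective, and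
  at a solution outside its image the weight vanishes, which turns the infinite sum into a finite
  one.\<close>

lemma counting_function_eq_sum:
  fixes W :: "(real ^ 3) \<times> (real ^ 3) \<Rightarrow> real" and N :: int and c R B :: real
  assumes c: "0 < c" and B: "0 < B" and N: "R * B \<le> N" and R: "0 < R"
    and supp: "\<And>x y i. W (x, y) \<noteq> 0 \<Longrightarrow> \<bar>x $ i\<bar> \<le> R \<and> c \<le> \<bar>y $ i\<bar> \<and> \<bar>y $ i\<bar> \<le> R"
  shows "counting_function W B = (\<Sum>y\<in>box3 (c * B) (R * B).
    \<Sum>p\<in>{(a, b) \<in> {-N..N} \<times> {-N..N}. is_lattice_vector (fst y) (fst (snd y)) (snd (snd y)) a b}. weight_on_lattice W B y p)"
proof -
  define Y where "Y = box3 (c * B) (R * B)"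
  define Lt where "Lt = (\<lambda>y. {(a, b) \<in> {-N..N} \<times> {-N..N}. is_lattice_vector (fst y) (fst (snd y)) (snd (snd y)) a b})"
  define f where "f = (\<lambda>(x, y). W ((1 / B) *\<^sub>R (real_vec x, real_vec y)))"
  define A where "A = {(x :: int ^ 3, y :: int ^ 3). F x y = 0}"
  define j where "j = (\<lambda>((y1, y2, y3), (a, b)). (vector [a, b, - (a * y1\<^sup>2 + b * y2\<^sup>2) div y3\<^sup>2] :: int ^ 3, vector [y1, y2, y3] :: int ^ 3))"
  define D where "D = Sigma Y Lt"
  have finY: "finite Y" unfolding Y_def using c B R by (intro card_box3(1)) simp_all
  have finL: "finite (Lt y)" for y unfolding Lt_def by (rule finite_subset[of _ "{-N..N} \<times> {-N..N}"]) blast+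
  have finD: "finite D" unfolding D_def using finY finL by blast
  have vec_eq: "(vector [a, b, k] :: int ^ 3) = vector [a', b', k'] \<longleftrightarrow> a = a' \<and> b = b' \<and> k = k'" for a b k a' b' k'
    by (simp add: vec_eq_iff forall_3)
  have inj: "inj_on j D"
  proof (rule inj_onI)
    fix p q assume "j p = j q"
    obtain y1 y2 y3 a b where p: "p = ((y1, y2, y3), (a, b))" by (cases p) auto
    obtain y1' y2' y3' a' b' where q: "q = ((y1', y2', y3'), (a', b'))" by (cases q) auto
    show "p = q" using \<open>j p = j q\<close> unfolding p q j_def by (simp add: vec_eq)
  qed
  have dat: "y3 \<noteq> 0 \<and> a * y1\<^sup>2 + b * y2\<^sup>2 + (- (a * y1\<^sup>2 + b * y2\<^sup>2) div y3\<^sup>2) * y3\<^sup>2 = 0"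
    if "((y1, y2, y3), (a, b)) \<in> D" for y1 y2 y3 a b
  proof -
    have y: "c * B \<le> \<bar>real_of_int y3\<bar>" and l: "y3\<^sup>2 dvd a * y1\<^sup>2 + b * y2\<^sup>2"
      using that unfolding D_def Y_def box3_def Lt_def is_lattice_vector_def by simp_all
    have "0 < c * B" using c B by simp
    hence "y3 \<noteq> 0" using y by (cases "y3 = 0") simp_all
    moreover have "(- (a * y1\<^sup>2 + b * y2\<^sup>2) div y3\<^sup>2) * y3\<^sup>2 = - (a * y1\<^sup>2 + b * y2\<^sup>2)"
      using l by (intro dvd_div_mult_self) (simp only: dvd_minus_iff)
    ultimately show ?thesis by simp
  qed
  have jA: "j ` D \<subseteq> A"
  proof (rule image_subsetI)
    fix p assume pD: "p \<in> D"
    obtain y1 y2 y3 a b where p: "p = ((y1, y2, y3), (a, b))" by (cases p) auto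
    show "j p \<in> A" using dat[OF pD[unfolded p]] unfolding p j_def A_def F_def by simp
  qed
  have zero: "f z = 0" if z: "z \<in> A - j ` D" for z
  proof (rule ccontr)
    assume nz: "f z \<noteq> 0"
    obtain x y where zz: "z = (x, y)" by (cases z)
    have Fz: "F x y = 0" using z unfolding A_def zz by simp
    have "W ((1 / B) *\<^sub>R real_vec x, (1 / B) *\<^sub>R real_vec y) \<noteq> 0" using nz unfolding f_def zz by simp
    from supp[OF this] have s: "\<bar>real_of_int (x $ i) / B\<bar> \<le> R" "c \<le> \<bar>real_of_int (y $ i) / B\<bar>" "\<bar>real_of_int (y $ i) / B\<bar> \<le> R" for i
      by (simp_all add: real_vec_def)
    have xi: "\<bar>real_of_int (x $ i)\<bar> \<le> R * B" and yi: "c * B \<le> \<bar>real_of_int (y $ i)\<bar>" "\<bar>real_of_int (y $ i)\<bar> \<le> R * B" for i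
      using s[of i] B by (simp_all add: abs_divide pos_divide_le_eq pos_le_divide_eq)
    have "y $ 3 \<noteq> 0" using yi(1)[of 3] mult_pos_pos[OF c B] by (cases "y $ 3 = 0") simp_all
    have e: "x $ 1 * (y $ 1)\<^sup>2 + x $ 2 * (y $ 2)\<^sup>2 = - (x $ 3) * (y $ 3)\<^sup>2" using Fz unfolding F_def by simp
    have xN: "- N \<le> x $ i \<and> x $ i \<le> N" for i using xi[of i] N by linarith
    have "((y $ 1, y $ 2, y $ 3), (x $ 1, x $ 2)) \<in> D"
      unfolding D_def Y_def box3_def Lt_def is_lattice_vector_def using yi xN e by simp
    moreover have "j ((y $ 1, y $ 2, y $ 3), (x $ 1, x $ 2)) = z"
    proof -
      have "- (x $ 1 * (y $ 1)\<^sup>2 + x $ 2 * (y $ 2)\<^sup>2) div (y $ 3)\<^sup>2 = x $ 3" unfolding e using \<open>y $ 3 \<noteq> 0\<close> by simp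
      thus ?thesis unfolding j_def zz by (simp add: vec_eq_iff forall_3)
    qed
    ultimately show False using z by (metis DiffD2 image_eqI)
  qed
  have "counting_function W B = infsum f A" unfolding counting_function_def A_def f_def ..
  also have "\<dots> = infsum f (j ` D)" by (rule infsum_cong_neutral) (use zero jA in auto)
  also have "\<dots> = sum f (j ` D)" using finD by (intro infsum_finite) simp
  also have "\<dots> = (\<Sum>p\<in>D. f (j p))" using sum.reindex[OF inj, of f] by simp
  also have "\<dots> = (\<Sum>(y, p)\<in>D. weight_on_lattice W B y p)"
  proof (rule sum.cong[OF refl])
    fix q assume qD: "q \<in> D"
    obtain y1 y2 y3 a b where q: "q = ((y1, y2, y3), (a, b))" by (cases q) auto
    define k where "k = - (a * y1\<^sup>2 + b * y2\<^sup>2) div y3\<^sup>2"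
    have d: "y3 \<noteq> 0" "a * y1\<^sup>2 + b * y2\<^sup>2 + k * y3\<^sup>2 = 0" using dat[OF qD[unfolded q]] unfolding k_def by simp_all
    have "f (j q) = W ((1 / B) *\<^sub>R real_vec (vector [a, b, k]), (1 / B) *\<^sub>R real_vec (vector [y1, y2, y3]))"
      unfolding q j_def f_def k_def by simp
    also have "((1 / B) *\<^sub>R real_vec (vector [a, b, k]), (1 / B) *\<^sub>R real_vec (vector [y1, y2, y3])) =
        vec_pair (scaled_point B (y1, y2, y3) (a, b), k / B)"
      unfolding vec_pair_def scaled_point_def real_vec_def by (simp add: vec_eq_iff forall_3)
    finally show "f (j q) = (case q of (y, p) \<Rightarrow> weight_on_lattice W B y p)"
      unfolding q weight_on_lattice_def prod.case solve_x3_scaled[OF B d] .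
  qed
  also have "\<dots> = (\<Sum>y\<in>Y. \<Sum>p\<in>Lt y. weight_on_lattice W B y p)" unfolding D_def
    by (rule sum.Sigma[symmetric]) (use finY finL in blast)+
  finally show ?thesis unfolding Y_def Lt_def .
qed

section \<open>Passage to the primitive part of y\<close>

definition primitive_decomposition :: "int \<times> int \<times> int \<Rightarrow> int \<times> int \<times> int \<times> int" where
  "primitive_decomposition = (\<lambda>(y1, y2, y3). let d = gcd y1 (gcd y2 y3) in (d, y1 div d, y2 div d, y3 div d))"

lemma primitive_decomposition_props:
  assumes "primitive_decomposition (y1, y2, y3) = (d, z1, z2, z3)" "y1 \<noteq> 0"
  shows "d > 0" "y1 = d * z1" "y2 = d * z2" "y3 = d * z3" "gcd z1 (gcd z2 z3) = 1" "d = gcd y1 (gcd y2 y3)"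
proof -
  show d: "d = gcd y1 (gcd y2 y3)" using assms(1) unfolding primitive_decomposition_def Let_def by simp
  have z: "z1 = y1 div d" "z2 = y2 div d" "z3 = y3 div d" using assms(1) unfolding primitive_decomposition_def Let_def by auto
  show d0: "d > 0" unfolding d using assms(2) by (simp add: gcd_pos_int)
  have "d dvd y1" "d dvd y2" "d dvd y3" unfolding d by (meson gcd_dvd1 gcd_dvd2 dvd_trans)+
  thus e: "y1 = d * z1" "y2 = d * z2" "y3 = d * z3" unfolding z by simp_all
  have "d * gcd z1 (gcd z2 z3) = d"
  proof -
    have a: "\<bar>d\<bar> = d" using d0 by simp
    have "gcd (d * z1) (gcd (d * z2) (d * z3)) = d * gcd z1 (gcd z2 z3)"
      by (simp only: gcd_mult_distrib_int[of d, symmetric, unfolded a])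
    thus ?thesis using d0 d unfolding e[symmetric] by simp
  qed
  thus "gcd z1 (gcd z2 z3) = 1" using d0 by simp
qed

lemma is_lattice_vector_scale:
  assumes "d \<noteq> 0"
  shows "is_lattice_vector (d * y1) (d * y2) (d * y3) a b \<longleftrightarrow> is_lattice_vector y1 y2 y3 a b"
proof -
  have e: "a * (d * y1)\<^sup>2 + b * (d * y2)\<^sup>2 = d\<^sup>2 * (a * y1\<^sup>2 + b * y2\<^sup>2)" by (simp add: algebra_simps power2_eq_square)
  have "d\<^sup>2 \<noteq> 0" using assms by simp
  thus ?thesis unfolding is_lattice_vector_def e power_mult_distrib[of d y3] by simp
qed

definition primitive_min :: "int \<times> int \<times> int \<Rightarrow> nat" where
  "primitive_min y = (case primitive_decomposition y of (d, z1, z2, z3) \<Rightarrow> lattice_min z1 z2 z3)"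

text \<open>Sorted by \<open>d\<close>, the primitive parts lie in boxes of size
  \<open>R * B / d\<close>, each contributing \<open>O((R * B / d)^2)\<close>, and the sum of
  \<open>1 / d^2\<close> is at most 2. Measured against the size \<open>R * B / d\<close>, the lower
  bound \<open>c\<close> becomes \<open>c / R\<close>.\<close>

lemma sum_inverse_primitive_min:
  fixes c R :: real
  assumes c: "0 < c" "c \<le> R" and R: "1 \<le> R"
  obtains K where "K \<ge> 0" "\<And>B. 1 \<le> B \<Longrightarrow> (\<Sum>y\<in>box3 (c * B) (R * B). 1 / real (primitive_min y)) \<le> K * B\<^sup>2"
proof -
  have cR: "0 < c / R" "c / R \<le> 1" using c R by simp_all
  obtain K where K: "K \<ge> 0" "\<And>Y. 1 \<le> Y \<Longrightarrow>
    (\<Sum>(y1, y2, y3)\<in>primitive_box (c / R) Y. 1 / real (lattice_min y1 y2 y3)) \<le> K * Y\<^sup>2"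
    by (rule sum_inverse_lattice_min[OF cR]) blast
  show thesis
  proof (rule that[of "2 * K * R\<^sup>2"])
    show "0 \<le> 2 * K * R\<^sup>2" using K(1) by simp
    fix B :: real assume B: "1 \<le> B"
    have RB: "1 \<le> R * B" using R B mult_mono[of 1 R 1 B] by simp
    define I where "I = {1..\<lfloor>R * B\<rfloor>}"
    define P where "P = (\<lambda>d :: int. primitive_box (c / R) (R * B / d))"
    define h where "h = (\<lambda>(d :: int, z1, z2, z3). 1 / real (lattice_min z1 z2 z3))"
    have finP: "finite (P d)" if "d \<in> I" for d unfolding P_def
      by (rule card_primitive_box(1)) (use cR that RB in \<open>simp_all add: I_def\<close>)
    have finI: "finite I" by (simp add: I_def)
    have mem: "primitive_decomposition y \<in> Sigma I P \<and> (\<exists>d z1 z2 z3. primitive_decomposition y = (d, z1, z2, z3) \<and> y = (d * z1, d * z2, d * z3))"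
      if y: "y \<in> box3 (c * B) (R * B)" for y
    proof -
      obtain y1 y2 y3 where yy: "y = (y1, y2, y3)" by (cases y)
      obtain d z1 z2 z3 where pp: "primitive_decomposition y = (d, z1, z2, z3)" by (cases "primitive_decomposition y")
      have b: "c * B \<le> \<bar>real_of_int y1\<bar>" "\<bar>real_of_int y1\<bar> \<le> R * B" "c * B \<le> \<bar>real_of_int y2\<bar>" "\<bar>real_of_int y2\<bar> \<le> R * B"
        "c * B \<le> \<bar>real_of_int y3\<bar>" "\<bar>real_of_int y3\<bar> \<le> R * B" using y unfolding yy box3_def by simp_all
      have "0 < c * B" using c B by simp
      hence y1: "y1 \<noteq> 0" using b(1) by (cases "y1 = 0") simp_all
      note pr = primitive_decomposition_props[OF pp[unfolded yy] y1]
      have dr: "0 < real_of_int d" using pr(1) by simp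
      have "d \<le> \<bar>y1\<bar>" using dvd_imp_le_int[OF y1, of d] pr(1,2) by simp
      hence "real_of_int d \<le> R * B" using b(2) by linarith
      hence dI: "d \<in> I" using pr(1) unfolding I_def by (simp add: le_floor_iff)
      have sc: "c / R * (R * B / d) \<le> \<bar>real_of_int z\<bar> \<and> \<bar>real_of_int z\<bar> \<le> R * B / d"
        if "y = d * z" "c * B \<le> \<bar>real_of_int y\<bar>" "\<bar>real_of_int y\<bar> \<le> R * B" for y z
      proof -
        have "\<bar>real_of_int y\<bar> = d * \<bar>real_of_int z\<bar>" using dr unfolding that(1) by (simp add: abs_mult)
        thus ?thesis using that(2,3) dr R by (simp add: pos_divide_le_eq pos_le_divide_eq mult.commute)
      qed
      have "(z1, z2, z3) \<in> P d" unfolding P_def primitive_box_def box3_def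
        using sc[OF pr(2) b(1,2)] sc[OF pr(3) b(3,4)] sc[OF pr(4) b(5,6)] pr(5) by simp
      hence "primitive_decomposition y \<in> Sigma I P" unfolding pp using dI by simp
      moreover have "y = (d * z1, d * z2, d * z3)" unfolding yy using pr(2-4) by simp
      ultimately show ?thesis using pp by (intro conjI exI)
    qed
    have inj: "inj_on primitive_decomposition (box3 (c * B) (R * B))"
    proof (rule inj_onI)
      fix y y' assume y: "y \<in> box3 (c * B) (R * B)" "y' \<in> box3 (c * B) (R * B)" and e: "primitive_decomposition y = primitive_decomposition y'"
      show "y = y'" using mem[OF y(1)] mem[OF y(2)] e by (metis prod.inject)
    qed
    have "(\<Sum>y\<in>box3 (c * B) (R * B). 1 / real (primitive_min y)) = (\<Sum>y\<in>box3 (c * B) (R * B). h (primitive_decomposition y))"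
      unfolding primitive_min_def h_def by (rule sum.cong[OF refl]) (simp split: prod.splits)
    also have "\<dots> = sum h (primitive_decomposition ` box3 (c * B) (R * B))" using sum.reindex[OF inj, of h] by simp
    also have "\<dots> \<le> sum h (Sigma I P)"
    proof (rule sum_mono2)
      show "finite (Sigma I P)" using finI finP by blast
      show "primitive_decomposition ` box3 (c * B) (R * B) \<subseteq> Sigma I P" using mem by blast
      show "0 \<le> h q" for q unfolding h_def by (cases q) simp
    qed
    also have "\<dots> = (\<Sum>d\<in>I. \<Sum>z\<in>P d. h (d, z))"
      using sum.Sigma[of I P "\<lambda>d z. h (d, z)"] finI finP by simp
    also have "\<dots> \<le> (\<Sum>d\<in>I. K * (R * B)\<^sup>2 * (1 / (real_of_int d)\<^sup>2))"
    proof (rule sum_mono)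
      fix d assume d: "d \<in> I"
      have d1: "1 \<le> R * B / d" using d unfolding I_def by (simp add: le_floor_iff)
      have "(\<Sum>z\<in>P d. h (d, z)) = (\<Sum>(y1, y2, y3)\<in>P d. 1 / real (lattice_min y1 y2 y3))"
        by (rule sum.cong[OF refl]) (simp add: h_def split: prod.splits)
      also have "\<dots> \<le> K * (R * B / d)\<^sup>2" unfolding P_def by (rule K(2)[OF d1])
      finally show "(\<Sum>z\<in>P d. h (d, z)) \<le> K * (R * B)\<^sup>2 * (1 / (real_of_int d)\<^sup>2)" by (simp add: power_divide)
    qed
    also have "\<dots> = K * (R * B)\<^sup>2 * (\<Sum>d\<in>I. 1 / (real_of_int d)\<^sup>2)" by (simp only: sum_distrib_left)
    also have "\<dots> \<le> K * (R * B)\<^sup>2 * 2"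
    proof (rule mult_left_mono)
      have "{g \<in> {1..\<lfloor>R * B\<rfloor>}. (1::real) \<le> real_of_int g} = I" unfolding I_def by auto
      thus "(\<Sum>d\<in>I. 1 / (real_of_int d)\<^sup>2) \<le> 2" using sum_inverse_squares_tail[of 1 "\<lfloor>R * B\<rfloor>"] by simp
      show "0 \<le> K * (R * B)\<^sup>2" using K(1) by simp
    qed
    finally show "(\<Sum>y\<in>box3 (c * B) (R * B). 1 / real (primitive_min y)) \<le> 2 * K * R\<^sup>2 * B\<^sup>2"
      by (simp add: power_mult_distrib mult_ac)
  qed
qed

text \<open>\<open>y\<close> and its primitive part \<open>z\<close> have the same lattice, of index
  \<open>z3^2\<close>; since \<open>y3 = d * z3\<close>, dividing by the index produces the factor
  \<open>d^2 / y3^2\<close>. The ratio \<open>(R / c)^2\<close> bounds how fast the solved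
  coordinate moves with \<open>a\<close> and \<open>b\<close>.\<close>

lemma weight_on_lattice_approx:
  fixes W :: "(real ^ 3) \<times> (real ^ 3) \<Rightarrow> real" and c R L B :: real and N y1 y2 y3 :: int
  assumes c: "0 < c" "c \<le> 1" and R: "1 \<le> R" and L: "0 \<le> L" and B: "1 \<le> B"
    and N: "R * B \<le> N" "N \<le> R * B + 1"
    and supp: "\<And>x y i. W (x, y) \<noteq> 0 \<Longrightarrow> \<bar>x $ i\<bar> \<le> R \<and> c \<le> \<bar>y $ i\<bar> \<and> \<bar>y $ i\<bar> \<le> R"
    and bound: "\<And>p. \<bar>W p\<bar> \<le> L" and lip: "\<And>p q. \<bar>W p - W q\<bar> \<le> L * dist p q"
    and y: "(y1, y2, y3) \<in> box3 (c * B) (R * B)"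
  shows "\<bar>(\<Sum>p\<in>{(a, b) \<in> {-N..N} \<times> {-N..N}. is_lattice_vector y1 y2 y3 a b}. weight_on_lattice W B (y1, y2, y3) p) -
      (real_of_int (gcd y1 (gcd y2 y3)))\<^sup>2 * (\<Sum>p\<in>{-N..N} \<times> {-N..N}. weight_on_lattice W B (y1, y2, y3) p / (real_of_int y3)\<^sup>2)\<bar>
    \<le> (38 * L + 4000 * (L * (1 + (R / c)\<^sup>2) * (R + 1))) * (1 + N / primitive_min (y1, y2, y3))"
proof -
  have b: "c * B \<le> \<bar>real_of_int y1\<bar>" "\<bar>real_of_int y1\<bar> \<le> R * B" "\<bar>real_of_int y2\<bar> \<le> R * B" "c * B \<le> \<bar>real_of_int y3\<bar>"
    using y unfolding box3_def by simp_all
  have cB: "0 < c * B" using c B by simp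
  have nz: "y1 \<noteq> 0" using b(1) cB by (cases "y1 = 0") simp_all
  have nz3: "y3 \<noteq> 0" using b(4) cB by (cases "y3 = 0") simp_all
  obtain d z1 z2 z3 where pp: "primitive_decomposition (y1, y2, y3) = (d, z1, z2, z3)" by (cases "primitive_decomposition (y1, y2, y3)")
  note pr = primitive_decomposition_props[OF pp nz]
  define \<phi> where "\<phi> = weight_on_lattice W B (y1, y2, y3)"
  define Q where "Q = (\<lambda>a b. (a / B, b / B, y1 / B, y2 / B, y3 / B) :: real5)"
  have \<phi>: "\<phi> (a, b) = W (vec_pair (Q a b, solve_x3 (Q a b)))" for a b :: int
    unfolding \<phi>_def weight_on_lattice_def scaled_point_def Q_def by simp
  define C where "C = L * (1 + (R / c)\<^sup>2) * (R + 1)"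
  have N1: "N \<ge> 1"
  proof -
    have "1 \<le> R * B" using R B mult_mono[of 1 R 1 B] by simp
    thus ?thesis using N(1) by linarith
  qed
  have z3: "z3 \<noteq> 0" using nz3 pr(4) by auto
  have ratio: "(real_of_int y)\<^sup>2 / (real_of_int y3)\<^sup>2 \<le> (R / c)\<^sup>2" if "\<bar>real_of_int y\<bar> \<le> R * B" for y
  proof -
    have "(real_of_int y)\<^sup>2 \<le> (R * B)\<^sup>2" using that R B by (simp add: abs_le_square_iff[symmetric])
    moreover have "(c * B)\<^sup>2 \<le> (real_of_int y3)\<^sup>2" using b(4) cB by (simp add: abs_le_square_iff[symmetric])
    ultimately have "(real_of_int y)\<^sup>2 / (real_of_int y3)\<^sup>2 \<le> (R * B)\<^sup>2 / (c * B)\<^sup>2" using c B by (intro frac_le) simp_all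
    also have "\<dots> = (R / c)\<^sup>2" using B by (simp add: power_divide[symmetric])
    finally show ?thesis .
  qed
  have lip\<phi>: "\<bar>\<phi> (a, b) - \<phi> (a', b')\<bar> \<le> C / N * (\<bar>real_of_int (a - a')\<bar> + \<bar>real_of_int (b - b')\<bar>)" for a b a' b'
  proof -
    define s where "s = \<bar>real_of_int (a - a')\<bar> + \<bar>real_of_int (b - b')\<bar>"
    have s0: "0 \<le> s" by (simp add: s_def)
    have "\<bar>\<phi> (a, b) - \<phi> (a', b')\<bar> \<le> L * dist (vec_pair (Q a b, solve_x3 (Q a b))) (vec_pair (Q a' b', solve_x3 (Q a' b')))"
      unfolding \<phi> by (rule lip)
    also have "dist (vec_pair (Q a b, solve_x3 (Q a b))) (vec_pair (Q a' b', solve_x3 (Q a' b'))) \<le>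
        \<bar>a / B - a' / B\<bar> + \<bar>b / B - b' / B\<bar> + \<bar>solve_x3 (Q a b) - solve_x3 (Q a' b')\<bar> + (0 + 0 + 0)"
      using dist_vec_pair_le[of "a / B" "b / B" "y1 / B" "y2 / B" "y3 / B" "solve_x3 (Q a b)" "a' / B" "b' / B" "y1 / B" "y2 / B" "y3 / B" "solve_x3 (Q a' b')"]
      unfolding Q_def by simp
    also have "\<bar>a / B - a' / B\<bar> + \<bar>b / B - b' / B\<bar> = s / B"
      unfolding s_def using B by (simp add: add_divide_distrib diff_divide_distrib[symmetric])
    also have "\<bar>solve_x3 (Q a b) - solve_x3 (Q a' b')\<bar> \<le> (R / c)\<^sup>2 * (s / B)"
    proof -
      have "solve_x3 (Q a b) - solve_x3 (Q a' b') =
          - ((real_of_int (a - a') / B) * ((real_of_int y1)\<^sup>2 / (real_of_int y3)\<^sup>2) + (real_of_int (b - b') / B) * ((real_of_int y2)\<^sup>2 / (real_of_int y3)\<^sup>2))"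
        unfolding solve_x3_def Q_def using B nz3 by (simp add: field_simps power2_eq_square)
      also have "\<bar>\<dots>\<bar> \<le> \<bar>(real_of_int (a - a') / B) * ((real_of_int y1)\<^sup>2 / (real_of_int y3)\<^sup>2)\<bar> + \<bar>(real_of_int (b - b') / B) * ((real_of_int y2)\<^sup>2 / (real_of_int y3)\<^sup>2)\<bar>"
        unfolding abs_minus_cancel by (rule abs_triangle_ineq)
      also have "\<dots> = (\<bar>real_of_int (a - a')\<bar> / B) * ((real_of_int y1)\<^sup>2 / (real_of_int y3)\<^sup>2) + (\<bar>real_of_int (b - b')\<bar> / B) * ((real_of_int y2)\<^sup>2 / (real_of_int y3)\<^sup>2)"
        using B by (simp add: abs_mult)
      also have "\<dots> \<le> (\<bar>real_of_int (a - a')\<bar> / B) * (R / c)\<^sup>2 + (\<bar>real_of_int (b - b')\<bar> / B) * (R / c)\<^sup>2"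
        using B by (intro add_mono mult_left_mono ratio b) simp_all
      also have "\<dots> = (R / c)\<^sup>2 * (s / B)" unfolding s_def by (simp add: add_divide_distrib distrib_left mult.commute)
      finally show ?thesis .
    qed
    also have "L * (s / B + (R / c)\<^sup>2 * (s / B) + (0 + 0 + 0)) = L * (1 + (R / c)\<^sup>2) * s * (1 / B)"
    proof -
      have "L * (s / B + q * (s / B) + (0 + 0 + 0)) = L * (1 + q) * s * (1 / B)" for q
        by (simp add: algebra_simps add_divide_distrib)
      thus ?thesis .
    qed
    \<comment> \<open>The Lipschitz bound is needed in units of \<open>1 / N\<close>, and
      \<open>N <= (R + 1) * B\<close> because \<open>B >= 1\<close>.\<close>
    also have "\<dots> \<le> L * (1 + (R / c)\<^sup>2) * s * ((R + 1) / N)"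
    proof (rule mult_left_mono)
      have "real_of_int N \<le> (R + 1) * B" using N(2) B by (simp add: distrib_right)
      thus "1 / B \<le> (R + 1) / N" using B N1 by (simp add: field_simps)
      show "0 \<le> L * (1 + (R / c)\<^sup>2) * s" using L s0 by simp
    qed
    also have "\<dots> = C / N * s" unfolding C_def by simp
    finally show ?thesis using L unfolding s_def by (simp add: mult_left_mono)
  qed
  have sup\<phi>: "\<phi> (a, b) = 0" if "\<bar>a\<bar> > N \<or> \<bar>b\<bar> > N" for a b
  proof (rule ccontr)
    assume "\<phi> (a, b) \<noteq> 0"
    hence "W (vector [a / B, b / B, solve_x3 (Q a b)], vector [y1 / B, y2 / B, y3 / B]) \<noteq> 0"
      unfolding \<phi> Q_def vec_pair_def by simp
    from supp[OF this, of 1] supp[OF this, of 2] have "\<bar>a / B\<bar> \<le> R" "\<bar>b / B\<bar> \<le> R" by simp_all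
    hence "\<bar>real_of_int a\<bar> \<le> R * B" "\<bar>real_of_int b\<bar> \<le> R * B" using B by (simp_all add: pos_divide_le_eq)
    thus False using that N(1) by linarith
  qed
  have "\<bar>(\<Sum>(a, b)\<in>{(a, b) \<in> {-N..N} \<times> {-N..N}. is_lattice_vector z1 z2 z3 a b}. \<phi> (a, b)) - (\<Sum>p\<in>{-N..N} \<times> {-N..N}. \<phi> p) / real_of_int (z3\<^sup>2)\<bar>
    \<le> (38 * L + 4000 * C) * (1 + N / lattice_min z1 z2 z3)"
  proof (rule lattice_sum_approx[OF pr(5) z3 N1 _ _ lip\<phi>])
    show "\<phi> (a, b) = 0" if "\<bar>a\<bar> > N \<or> \<bar>b\<bar> > N" for a b using that by (rule sup\<phi>)
    show "\<bar>\<phi> p\<bar> \<le> L" for p unfolding \<phi>_def weight_on_lattice_def by (rule bound)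
  qed
  moreover have "(\<Sum>(a, b)\<in>{(a, b) \<in> {-N..N} \<times> {-N..N}. is_lattice_vector z1 z2 z3 a b}. \<phi> (a, b)) =
      (\<Sum>p\<in>{(a, b) \<in> {-N..N} \<times> {-N..N}. is_lattice_vector y1 y2 y3 a b}. \<phi> p)"
  proof -
    have "is_lattice_vector y1 y2 y3 a b \<longleftrightarrow> is_lattice_vector z1 z2 z3 a b" for a b
      unfolding pr(2-4) by (rule is_lattice_vector_scale) (use pr(1) in simp)
    thus ?thesis by simp
  qed
  moreover have "(\<Sum>p\<in>{-N..N} \<times> {-N..N}. \<phi> p) / real_of_int (z3\<^sup>2) =
      (real_of_int (gcd y1 (gcd y2 y3)))\<^sup>2 * (\<Sum>p\<in>{-N..N} \<times> {-N..N}. \<phi> p / (real_of_int y3)\<^sup>2)"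
  proof -
    have "(real_of_int y3)\<^sup>2 = (real_of_int d)\<^sup>2 * (real_of_int z3)\<^sup>2" unfolding pr(4) by (simp add: power_mult_distrib)
    thus ?thesis unfolding pr(6)[symmetric] sum_divide_distrib[symmetric] using pr(1) by simp
  qed
  moreover have "primitive_min (y1, y2, y3) = lattice_min z1 z2 z3" unfolding primitive_min_def pp by simp
  ultimately show ?thesis unfolding \<phi>_def C_def by simp
qed

text \<open>The grid has mesh \<open>1 / B\<close> in the two \<open>x\<close> coordinates and
  \<open>e / B\<close> in the three \<open>y\<close> coordinates, so a cell has volume
  \<open>e^3 / B^5\<close>. The condition \<open>e <= R * B\<close> keeps the mesh at most
  \<open>R\<close>, so that everything takes place in a cube of side \<open>4 * R\<close>.\<close>

lemma leray_density_riemann_sum: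
  fixes H :: "real5 \<Rightarrow> real" and c R K B :: real and N :: int and e :: nat
  assumes c: "0 < c" and R: "1 \<le> R" and K: "0 \<le> K" and B: "1 \<le> B" and N: "R * B \<le> N" and e: "1 \<le> e" "e \<le> R * B"
    and lip: "\<And>p q. \<bar>H p - H q\<bar> \<le> K * dist p q" and int: "integrable lborel H"
    and supp: "\<And>u1 u2 y1 y2 y3. H (u1, u2, y1, y2, y3) \<noteq> 0 \<Longrightarrow>
      \<bar>u1\<bar> \<le> R \<and> \<bar>u2\<bar> \<le> R \<and> \<bar>y1\<bar> \<le> R \<and> \<bar>y2\<bar> \<le> R \<and> \<bar>y3\<bar> \<le> R \<and> c \<le> \<bar>y1\<bar> \<and> c \<le> \<bar>y2\<bar> \<and> c \<le> \<bar>y3\<bar>"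
  shows "\<bar>(real e ^ 3 / B ^ 5) * (\<Sum>y\<in>{(y1, y2, y3) \<in> box3 (c * B) (R * B). int e dvd y1 \<and> int e dvd y2 \<and> int e dvd y3}.
      \<Sum>p\<in>{-N..N} \<times> {-N..N}. H (scaled_point B y p)) - (LINT z|lborel. H z)\<bar> \<le> K * (5 * e / B) * (4 * R) ^ 5"
proof -
  define Y where "Y = {(y1, y2, y3) \<in> box3 (c * B) (R * B). int e dvd y1 \<and> int e dvd y2 \<and> int e dvd y3}"
  define X where "X = {-N..N} \<times> {-N..N}"
  define h :: real5 where "h = (1 / B, 1 / B, e / B, e / B, e / B)"
  define s where "s = (\<lambda>(y, p). scaled_point B y p)"
  define G where "G = s ` (Y \<times> X)"
  have finY: "finite Y" unfolding Y_def
    by (rule finite_subset[OF _ card_box3(1)[of "c * B" "R * B"]]) (use c R B in auto)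
  have finX: "finite X" unfolding X_def by blast
  have inj: "inj_on s (Y \<times> X)"
  proof (rule inj_onI)
    fix p q assume e: "s p = s q"
    obtain y1 y2 y3 a b where p: "p = ((y1, y2, y3), (a, b))" by (cases p) auto
    obtain y1' y2' y3' a' b' where q: "q = ((y1', y2', y3'), (a', b'))" by (cases q) auto
    show "p = q" using e B unfolding p q s_def scaled_point_def by simp
  qed
  have RB: "1 \<le> R * B" using R B mult_mono[of 1 R 1 B] by simp
  have hb: "\<forall>b\<in>Basis. 0 < h \<bullet> b \<and> h \<bullet> b \<le> R"
    unfolding h_def using B e RB by (simp add: ball_Basis_Pair pos_divide_le_eq)
  have pd: "(\<Prod>b\<in>Basis. h \<bullet> b) = real e ^ 3 / B ^ 5" unfolding h_def by (simp add: prod_Basis_Pair eval_nat_numeral)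
  have sm: "(\<Sum>b\<in>Basis. h \<bullet> b) = (2 + 3 * real e) / B" unfolding h_def by (simp add: sum_Basis_Pair add_divide_distrib)
  have fl: "\<bar>H z - H z'\<bar> \<le> K * (\<Sum>b\<in>Basis. \<bar>(z - z') \<bullet> b\<bar>)" for z z'
    by (rule order.trans[OF lip]) (intro mult_left_mono K, simp add: dist_norm norm_le_l1)
  have "\<bar>(\<Prod>b\<in>Basis. h \<bullet> b) * (\<Sum>x\<in>G. H x) - (LINT z|lborel. H z)\<bar> \<le> K * (\<Sum>b\<in>Basis. h \<bullet> b) * (2 * R + 2 * R) ^ DIM(real5)"
  proof (rule riemann_sum_lipschitz[OF _ _ _ _ K _ fl int])
    show "0 < h \<bullet> b" "h \<bullet> b \<le> R" if "b \<in> Basis" for b using hb that by blast+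
    show "0 \<le> R" "0 \<le> R" using R by simp_all
    show "\<bar>z \<bullet> b\<bar> \<le> R" if "H z \<noteq> 0" "b \<in> Basis" for z b
    proof -
      obtain u1 u2 y1 y2 y3 where z: "z = (u1, u2, y1, y2, y3)" by (cases z)
      have "\<forall>b\<in>Basis. \<bar>z \<bullet> b\<bar> \<le> R" using supp[OF that(1)[unfolded z]] unfolding z by (simp add: ball_Basis_Pair)
      thus ?thesis using that(2) by blast
    qed
    show "finite G" unfolding G_def using finX finY by blast
    show "\<exists>k::int. x \<bullet> b = k * (h \<bullet> b)" if x: "x \<in> G" and b: "b \<in> Basis" for x b
    proof -
      obtain y1 y2 y3 a b' where q: "x = s ((y1, y2, y3), (a, b'))" "(y1, y2, y3) \<in> Y" using x unfolding G_def by auto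
      have "int e dvd y1" "int e dvd y2" "int e dvd y3" using q(2) unfolding Y_def by simp_all
      then obtain k1 k2 k3 where k: "y1 = int e * k1" "y2 = int e * k2" "y3 = int e * k3" by (elim dvdE)
      have ex: "\<exists>k::int. real_of_int a / B = k / B" "\<exists>k::int. real e * real_of_int k1 / B = k * real e / B" for a k1
        by (rule exI[of _ a], simp) (rule exI[of _ k1], simp)
      have "\<forall>b\<in>Basis. \<exists>k::int. x \<bullet> b = k * (h \<bullet> b)"
        unfolding q(1) s_def prod.case scaled_point_def h_def k using ex by (simp add: ball_Basis_Pair)
      thus ?thesis using b by blast
    qed
    show "x \<in> G" if nz: "H x \<noteq> 0" and grid: "\<And>b. b \<in> Basis \<Longrightarrow> \<exists>k::int. x \<bullet> b = k * (h \<bullet> b)" for x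
    proof -
      obtain u1 u2 y1 y2 y3 where x: "x = (u1, u2, y1, y2, y3)" by (cases x)
      note sp = supp[OF nz[unfolded x]]
      have "\<forall>b\<in>Basis. \<exists>k::int. x \<bullet> b = k * (h \<bullet> b)" using grid by blast
      hence "(\<exists>k::int. u1 = k / B) \<and> (\<exists>k::int. u2 = k / B) \<and> (\<exists>k::int. y1 = k * (e / B)) \<and>
          (\<exists>k::int. y2 = k * (e / B)) \<and> (\<exists>k::int. y3 = k * (e / B))"
        unfolding x h_def by (simp add: ball_Basis_Pair)
      then obtain k1 k2 k3 k4 k5 :: int where k: "u1 = k1 / B" "u2 = k2 / B" "y1 = k3 * (e / B)" "y2 = k4 * (e / B)" "y3 = k5 * (e / B)"
        by blast
      have u: "\<bar>k\<bar> \<le> N" if "\<bar>real_of_int k / B\<bar> \<le> R" for k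
      proof -
        have "\<bar>real_of_int k\<bar> \<le> R * B" using that B by (simp add: pos_divide_le_eq)
        thus ?thesis using N by linarith
      qed
      have v: "c * B \<le> \<bar>real_of_int (k * int e)\<bar> \<and> \<bar>real_of_int (k * int e)\<bar> \<le> R * B" if "\<bar>k * (e / B)\<bar> \<le> R" "c \<le> \<bar>k * (e / B)\<bar>" for k :: int
        using that B by (simp add: abs_mult pos_divide_le_eq pos_le_divide_eq)
      have uk: "\<bar>k1\<bar> \<le> N" "\<bar>k2\<bar> \<le> N" using sp u unfolding k by blast+
      have "(k1, k2) \<in> X" unfolding X_def using uk by (simp add: abs_le_iff)
      moreover have "(k3 * int e, k4 * int e, k5 * int e) \<in> Y"
        unfolding Y_def box3_def using sp v[of k3] v[of k4] v[of k5] unfolding k by simp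
      ultimately have "s ((k3 * int e, k4 * int e, k5 * int e), (k1, k2)) \<in> G" unfolding G_def by blast
      thus ?thesis unfolding s_def scaled_point_def x k by simp
    qed
  qed
  also have "\<dots> \<le> K * (5 * e / B) * (4 * R) ^ 5"
  proof -
    have "(2 + 3 * real e) / B \<le> 5 * e / B" using e B by (intro divide_right_mono) simp_all
    moreover have "(2 * R + 2 * R) ^ DIM(real5) = (4 * R) ^ 5"
    proof -
      have "DIM(real5) = 5" "2 * R + 2 * R = 4 * R" by simp_all
      thus ?thesis by (simp only:)
    qed
    moreover have "0 \<le> (4 * R) ^ 5" using R by simp
    ultimately show ?thesis unfolding sm by (metis K mult_left_mono mult_right_mono)
  qed
  finally have "\<bar>(real e ^ 3 / B ^ 5) * (\<Sum>x\<in>G. H x) - (LINT z|lborel. H z)\<bar> \<le> K * (5 * e / B) * (4 * R) ^ 5" unfolding pd .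
  moreover have "(\<Sum>x\<in>G. H x) = (\<Sum>y\<in>Y. \<Sum>p\<in>X. H (scaled_point B y p))"
  proof -
    have "(\<Sum>x\<in>G. H x) = (\<Sum>q\<in>Y \<times> X. H (s q))" unfolding G_def using sum.reindex[OF inj, of H] by simp
    also have "\<dots> = (\<Sum>(y, p)\<in>Y \<times> X. H (scaled_point B y p))" unfolding s_def by (rule sum.cong[OF refl]) (simp split: prod.splits)
    also have "\<dots> = (\<Sum>y\<in>Y. \<Sum>p\<in>X. H (scaled_point B y p))" by (rule sum.cartesian_product[symmetric])
    finally show ?thesis .
  qed
  ultimately show ?thesis unfolding Y_def X_def by simp
qed

text \<open>The range of summation is the same for all \<open>d\<close>, so that the sums over
  \<open>e\<close> and over \<open>y\<close> can be exchanged.\<close>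

lemma square_eq_sum_jordan2:
  assumes "1 \<le> d" "d \<le> M"
  shows "(real d)\<^sup>2 = (\<Sum>e=1..M. if e dvd d then real (jordan2 e) else 0)"
proof -
  have "{e. e dvd d} = {e \<in> {1..M}. e dvd d}"
    using assms by (auto dest: dvd_imp_le intro: Nat.gr0I simp: Suc_le_eq)
  hence "(\<Sum>e | e dvd d. jordan2 e) = (\<Sum>e=1..M. if e dvd d then jordan2 e else 0)"
    by (simp only: sum.inter_filter[OF finite_atLeastAtMost])
  hence "d\<^sup>2 = (\<Sum>e=1..M. if e dvd d then jordan2 e else 0)" using sum_jordan2_divisors[OF assms(1)] by simp
  hence "real (d\<^sup>2) = real (\<Sum>e=1..M. if e dvd d then jordan2 e else 0)" by simp
  also have "\<dots> = (\<Sum>e=1..M. if e dvd d then real (jordan2 e) else 0)"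
    unfolding of_nat_sum by (rule sum.cong) simp_all
  finally show ?thesis by simp
qed

text \<open>Expanding the squared gcd and exchanging sums leaves Riemann sums over the
  \<open>y\<close> divisible by \<open>e\<close>. Each contributes an error
  \<open>jordan2 e / B^2 * B^5 / e^3\<close> times \<open>O(e / B)\<close>, that is
  \<open>O(B^2)\<close> because \<open>jordan2 e <= e^2\<close>, and there are at most
  \<open>R * B\<close> values of \<open>e\<close>.\<close>

lemma main_term_asymp:
  fixes H :: "real5 \<Rightarrow> real" and c R K B :: real and N :: int
  assumes c: "0 < c" and R: "1 \<le> R" and K: "0 \<le> K" and B: "1 \<le> B" and N: "R * B \<le> N"
    and lip: "\<And>p q. \<bar>H p - H q\<bar> \<le> K * dist p q" and int: "integrable lborel H"
    and supp: "\<And>u1 u2 y1 y2 y3. H (u1, u2, y1, y2, y3) \<noteq> 0 \<Longrightarrow>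
      \<bar>u1\<bar> \<le> R \<and> \<bar>u2\<bar> \<le> R \<and> \<bar>y1\<bar> \<le> R \<and> \<bar>y2\<bar> \<le> R \<and> \<bar>y3\<bar> \<le> R \<and> c \<le> \<bar>y1\<bar> \<and> c \<le> \<bar>y2\<bar> \<and> c \<le> \<bar>y3\<bar>"
  shows "\<bar>(\<Sum>(y1, y2, y3)\<in>box3 (c * B) (R * B). (real_of_int (gcd y1 (gcd y2 y3)))\<^sup>2 *
      (\<Sum>p\<in>{-N..N} \<times> {-N..N}. H (scaled_point B (y1, y2, y3) p) / B\<^sup>2))
      - (LINT z|lborel. H z) * B ^ 3 * jordan2_sum (nat \<lfloor>R * B\<rfloor>)\<bar> \<le> 5 * K * (4 * R) ^ 5 * R * B ^ 3"
proof -
  define M where "M = nat \<lfloor>R * B\<rfloor>"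
  define Y where "Y = box3 (c * B) (R * B)"
  define X where "X = {-N..N} \<times> {-N..N}"
  define I where "I = (LINT z|lborel. H z)"
  define A where "A = (\<lambda>y. \<Sum>p\<in>X. H (scaled_point B y p))"
  define dv where "dv = (\<lambda>(e::nat) (y1, y2, y3). int e dvd y1 \<and> int e dvd y2 \<and> int e dvd y3)"
  define S where "S = (\<lambda>e. \<Sum>y\<in>{y \<in> Y. dv e y}. A y)"
  have finY: "finite Y" unfolding Y_def by (rule card_box3(1)) (use c R B in simp_all)
  have RB: "0 \<le> R * B" using R B by simp
  have MRB: "real M \<le> R * B" unfolding M_def using RB by linarith
  have pt: "(case y of (y1, y2, y3) \<Rightarrow> (real_of_int (gcd y1 (gcd y2 y3)))\<^sup>2 * (\<Sum>p\<in>X. H (scaled_point B (y1, y2, y3) p) / B\<^sup>2)) =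
      (\<Sum>e=1..M. real (jordan2 e) / B\<^sup>2 * (if dv e y then A y else 0))" if y: "y \<in> Y" for y
  proof -
    obtain y1 y2 y3 where yy: "y = (y1, y2, y3)" by (cases y)
    have b: "c * B \<le> \<bar>real_of_int y1\<bar>" "\<bar>real_of_int y1\<bar> \<le> R * B" using y unfolding yy Y_def box3_def by simp_all
    have "0 < c * B" using c B by simp
    hence nz: "y1 \<noteq> 0" using b(1) by (cases "y1 = 0") simp_all
    define g where "g = gcd y1 (gcd y2 y3)"
    have g0: "g > 0" unfolding g_def using nz by (simp add: gcd_pos_int)
    define d where "d = nat g"
    have gd: "g = int d" unfolding d_def using g0 by simp
    have "g \<le> \<bar>y1\<bar>" using dvd_imp_le_int[OF nz, of g] g0 by (simp add: g_def)
    hence "real_of_int g \<le> R * B" using b(2) by linarith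
    hence d: "1 \<le> d" "d \<le> M" unfolding d_def M_def using g0 by (simp_all add: nat_mono le_floor_iff)
    have dvd: "e dvd d \<longleftrightarrow> dv e y" for e
    proof -
      have "e dvd d \<longleftrightarrow> int e dvd g" unfolding gd by (rule int_dvd_int_iff[symmetric])
      thus ?thesis unfolding g_def dv_def yy by simp
    qed
    have "(real_of_int g)\<^sup>2 = (\<Sum>e=1..M. if dv e y then real (jordan2 e) else 0)"
      unfolding dvd[symmetric] gd using square_eq_sum_jordan2[OF d] by simp
    hence "(real_of_int g)\<^sup>2 * (A y / B\<^sup>2) = (\<Sum>e=1..M. (if dv e y then real (jordan2 e) else 0) * (A y / B\<^sup>2))"
      by (simp only: sum_distrib_right)
    also have "\<dots> = (\<Sum>e=1..M. real (jordan2 e) / B\<^sup>2 * (if dv e y then A y else 0))"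
      by (rule sum.cong[OF refl]) simp
    also have "A y / B\<^sup>2 = (\<Sum>p\<in>X. H (scaled_point B (y1, y2, y3) p) / B\<^sup>2)" unfolding A_def yy by (rule sum_divide_distrib)
    finally show ?thesis unfolding yy prod.case g_def .
  qed
  have "(\<Sum>(y1, y2, y3)\<in>Y. (real_of_int (gcd y1 (gcd y2 y3)))\<^sup>2 * (\<Sum>p\<in>X. H (scaled_point B (y1, y2, y3) p) / B\<^sup>2)) =
      (\<Sum>y\<in>Y. \<Sum>e=1..M. real (jordan2 e) / B\<^sup>2 * (if dv e y then A y else 0))"
    by (rule sum.cong[OF refl pt])
  also have "\<dots> = (\<Sum>e=1..M. \<Sum>y\<in>Y. real (jordan2 e) / B\<^sup>2 * (if dv e y then A y else 0))" by (rule sum.swap)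
  also have "\<dots> = (\<Sum>e=1..M. real (jordan2 e) / B\<^sup>2 * S e)"
    unfolding S_def by (intro sum.cong refl) (simp only: sum_distrib_left[symmetric] sum.inter_filter[OF finY])
  finally have main: "(\<Sum>(y1, y2, y3)\<in>Y. (real_of_int (gcd y1 (gcd y2 y3)))\<^sup>2 * (\<Sum>p\<in>X. H (scaled_point B (y1, y2, y3) p) / B\<^sup>2)) =
    (\<Sum>e=1..M. real (jordan2 e) / B\<^sup>2 * S e)" .
  have J: "I * B ^ 3 * jordan2_sum M = (\<Sum>e=1..M. real (jordan2 e) / B\<^sup>2 * (B ^ 5 / real e ^ 3 * I))"
    unfolding jordan2_sum_def sum_distrib_left by (rule sum.cong[OF refl]) (use B in \<open>simp add: field_simps eval_nat_numeral\<close>)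
  define k where "k = 5 * K * (4 * R) ^ 5"
  have k0: "0 \<le> k" unfolding k_def using K R by simp
  have single: "\<bar>real (jordan2 e) / B\<^sup>2 * S e - real (jordan2 e) / B\<^sup>2 * (B ^ 5 / real e ^ 3 * I)\<bar> \<le> k * B\<^sup>2" if e: "e \<in> {1..M}" for e
  proof -
    have e1: "1 \<le> e" "real e \<le> R * B" using e MRB by simp_all
    have Se: "S e = (\<Sum>y\<in>{(y1, y2, y3) \<in> box3 (c * B) (R * B). int e dvd y1 \<and> int e dvd y2 \<and> int e dvd y3}.
      \<Sum>p\<in>{-N..N} \<times> {-N..N}. H (scaled_point B y p))"
      unfolding S_def A_def X_def Y_def dv_def by (rule sum.cong) auto
    have r: "\<bar>(real e ^ 3 / B ^ 5) * S e - I\<bar> \<le> K * (5 * e / B) * (4 * R) ^ 5"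
      unfolding Se I_def by (rule leray_density_riemann_sum[OF c R K B N e1 lip int supp])
    define a where "a = real (jordan2 e) / B\<^sup>2 * (B ^ 5 / real e ^ 3)"
    have a0: "0 \<le> a" unfolding a_def using B by simp
    have "real (jordan2 e) / B\<^sup>2 * S e - real (jordan2 e) / B\<^sup>2 * (B ^ 5 / real e ^ 3 * I) = a * ((real e ^ 3 / B ^ 5) * S e - I)"
    proof -
      have alg: "x * s - x * (q / p * t) = (x * (q / p)) * ((p / q) * s - t)" if "p \<noteq> 0" "q \<noteq> 0" for x s t p q :: real
        using that by (simp add: right_diff_distrib)
      show ?thesis unfolding a_def by (rule alg) (use e1 B in simp_all)
    qed
    also have "\<bar>\<dots>\<bar> = a * \<bar>(real e ^ 3 / B ^ 5) * S e - I\<bar>" using a0 by (simp add: abs_mult)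
    also have "\<dots> \<le> a * (K * (5 * e / B) * (4 * R) ^ 5)" by (rule mult_left_mono[OF r a0])
    also have "\<dots> = (real (jordan2 e) / (real e)\<^sup>2) * (k * B\<^sup>2)"
      unfolding a_def k_def using e1 B by (simp add: field_simps eval_nat_numeral)
    also have "\<dots> \<le> 1 * (k * B\<^sup>2)"
    proof (rule mult_right_mono)
      have "real (jordan2 e) \<le> real (e\<^sup>2)" using jordan2_le by (rule of_nat_mono)
      thus "real (jordan2 e) / (real e)\<^sup>2 \<le> 1" using e1 by simp
      show "0 \<le> k * B\<^sup>2" using k0 by simp
    qed
    finally show ?thesis by simp
  qed
  have "\<bar>(\<Sum>e=1..M. real (jordan2 e) / B\<^sup>2 * S e) - I * B ^ 3 * jordan2_sum M\<bar> =
      \<bar>\<Sum>e=1..M. real (jordan2 e) / B\<^sup>2 * S e - real (jordan2 e) / B\<^sup>2 * (B ^ 5 / real e ^ 3 * I)\<bar>"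
    unfolding J by (simp only: sum_subtractf)
  also have "\<dots> \<le> (\<Sum>e=1..M. k * B\<^sup>2)" by (rule order.trans[OF sum_abs]) (rule sum_mono[OF single])
  also have "\<dots> = real M * (k * B\<^sup>2)" by simp
  also have "\<dots> \<le> (R * B) * (k * B\<^sup>2)" by (rule mult_right_mono[OF MRB]) (use k0 in simp)
  also have "\<dots> = 5 * K * (4 * R) ^ 5 * R * B ^ 3" unfolding k_def by (simp add: eval_nat_numeral)
  finally show ?thesis unfolding main[symmetric] unfolding Y_def X_def I_def M_def .
qed

text \<open>\<open>C1\<close> collects the lattice approximation, \<open>C2\<close> the Riemann
  sums, \<open>C3\<close> the passage from \<open>jordan2_sum\<close> at about \<open>R * B\<close>
  to \<open>ln B / zeta 3\<close>. In \<open>C1\<close> both parts of the error are of order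
  \<open>B^3\<close>: the number of \<open>y\<close>, and \<open>N\<close> times the
  \<open>O(B^2)\<close> of the reciprocal minima.\<close>

lemma counting_function_estimate:
  fixes W :: "(real ^ 3) \<times> (real ^ 3) \<Rightarrow> real"
  assumes "smooth W" and "compactly_supported_on W {(x, y). y $ 1 * y $ 2 * y $ 3 \<noteq> 0}"
  shows "(density_approx W \<longlongrightarrow> real_density W) (at_right 0)"
    "\<exists>C. \<forall>B\<ge>1. \<bar>counting_function W B - real_density W / zeta 3 * B ^ 3 * ln B\<bar> \<le> C * B ^ 3"
proof -
  obtain c R L where c: "0 < c" "c \<le> 1" and R: "1 \<le> R" and L: "0 \<le> L"
    and supp: "\<And>x y i. W (x, y) \<noteq> 0 \<Longrightarrow> \<bar>x $ i\<bar> \<le> R \<and> c \<le> \<bar>y $ i\<bar> \<and> \<bar>y $ i\<bar> \<le> R"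
    and bound: "\<And>p. \<bar>W p\<bar> \<le> L" and lip: "\<And>p q. \<bar>W p - W q\<bar> \<le> L * dist p q"
    using weight_constants[OF assms] by metis
  define H where "H = leray_density W"
  obtain K where K: "K \<ge> 0" "\<And>p. \<bar>H p\<bar> \<le> K" "\<And>p q. \<bar>H p - H q\<bar> \<le> K * dist p q"
    "\<And>u1 u2 y1 y2 y3. H (u1, u2, y1, y2, y3) \<noteq> 0 \<Longrightarrow>
      \<bar>u1\<bar> \<le> R \<and> \<bar>u2\<bar> \<le> R \<and> \<bar>y1\<bar> \<le> R \<and> \<bar>y2\<bar> \<le> R \<and> \<bar>y3\<bar> \<le> R \<and> c \<le> \<bar>y1\<bar> \<and> c \<le> \<bar>y2\<bar> \<and> c \<le> \<bar>y3\<bar>"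
    by (rule leray_density_lipschitz[OF c R L supp bound lip, folded H_def]) (assumption, blast)
  have intH: "integrable lborel H"
  proof (rule integrable_bounded_support)
    show "H \<in> borel_measurable borel" by (rule borel_measurable_continuous_onI[OF continuous_on_if_lipschitz[OF K(3) K(1)]])
    show "\<bar>H x\<bar> \<le> K" for x by (rule K(2))
    show "x \<in> cbox (- R, - R, - R, - R, - R) (R, R, R, R, R)" if "H x \<noteq> 0" for x
    proof -
      obtain u1 u2 y1 y2 y3 where x: "x = (u1, u2, y1, y2, y3)" by (cases x)
      show ?thesis using K(4)[OF that[unfolded x]] unfolding x cbox_Pair_eq by (simp add: abs_le_iff)
    qed
  qed
  define I where "I = (LINT p|lborel. H p)"
  have est: "\<bar>density_approx W \<epsilon> - I\<bar> \<le> (L / c ^ 4 * (2 * R) ^ 5) * \<epsilon>" if "\<epsilon> > 0" for \<epsilon>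
    unfolding I_def H_def by (rule density_approx_estimate[OF c R L supp bound lip intH[unfolded H_def] that])
  have rd: "real_density W = I" by (rule real_density_eq_integral(2)[OF est])
  show "(density_approx W \<longlongrightarrow> real_density W) (at_right 0)"
    unfolding rd by (rule real_density_eq_integral(1)[OF est])
  have cR: "c \<le> R" using c R by linarith
  obtain K1 where K1: "K1 \<ge> 0" "\<And>B. 1 \<le> B \<Longrightarrow> (\<Sum>y\<in>box3 (c * B) (R * B). 1 / real (primitive_min y)) \<le> K1 * B\<^sup>2"
    by (rule sum_inverse_primitive_min[OF c(1) cR R]) blast
  obtain K2 where K2: "\<And>E. E \<ge> 1 \<Longrightarrow> \<bar>jordan2_sum E - ln (real E) / zeta 3\<bar> \<le> K2" by (rule jordan2_sum_asymp) blast
  define E where "E = 38 * L + 4000 * (L * (1 + (R / c)\<^sup>2) * (R + 1))"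
  have E0: "0 \<le> E" unfolding E_def using L R by simp
  define C1 where "C1 = E * (8 * R ^ 3 + (R + 1) * K1)"
  define C2 where "C2 = 5 * K * (4 * R) ^ 5 * R"
  define C3 where "C3 = \<bar>I\<bar> * (K2 + (ln R + 1) / \<bar>zeta 3\<bar>)"
  have "\<bar>counting_function W B - I / zeta 3 * B ^ 3 * ln B\<bar> \<le> (C1 + C2 + C3) * B ^ 3" if B: "1 \<le> B" for B
  proof -
    have B0: "0 < B" using B by simp
    have RB: "1 \<le> R * B" using R B mult_mono[of 1 R 1 B] by simp
    define N where "N = \<lceil>R * B\<rceil>"
    have N: "R * B \<le> N" "N \<le> R * B + 1" unfolding N_def by linarith+
    define Y where "Y = box3 (c * B) (R * B)"
    have finY: "finite Y" and cY: "real (card Y) \<le> 8 * (R * B) ^ 3"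
      unfolding Y_def using card_box3[of "c * B" "R * B"] c R B by simp_all
    define X where "X = {-N..N} \<times> {-N..N}"
    define lat where "lat = (\<lambda>y. \<Sum>p\<in>{(a, b) \<in> X. is_lattice_vector (fst y) (fst (snd y)) (snd (snd y)) a b}. weight_on_lattice W B y p)"
    define mn where "mn = (\<lambda>(y1, y2, y3). (real_of_int (gcd y1 (gcd y2 y3)))\<^sup>2 * (\<Sum>p\<in>X. H (scaled_point B (y1, y2, y3) p) / B\<^sup>2))"
    have cf: "counting_function W B = (\<Sum>y\<in>Y. lat y)"
      unfolding Y_def lat_def X_def by (rule counting_function_eq_sum[OF c(1) B0 N(1) _ supp]) (use R in simp)
    have err: "\<bar>lat y - mn y\<bar> \<le> E * (1 + N * (1 / primitive_min y))" if y: "y \<in> Y" for y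
    proof -
      obtain y1 y2 y3 where yy: "y = (y1, y2, y3)" by (cases y)
      \<comment> \<open>Scaling \<open>y3\<close> to \<open>y3 / B\<close> in the Leray density
        accounts for the factor \<open>1 / B^2\<close> in \<open>mn\<close>.\<close>
      have HW: "weight_on_lattice W B (y1, y2, y3) p / (real_of_int y3)\<^sup>2 = H (scaled_point B (y1, y2, y3) p) / B\<^sup>2" for p
      proof -
        obtain a b where p: "p = (a, b)" by (cases p)
        show ?thesis unfolding H_def leray_density_def weight_on_lattice_def p scaled_point_def using B0 by (simp add: power_divide)
      qed
      show ?thesis
        using weight_on_lattice_approx[OF c R L B N supp bound lip y[unfolded yy Y_def]]
        unfolding yy lat_def mn_def X_def E_def[symmetric] HW by simp
    qed
    have "\<bar>(\<Sum>y\<in>Y. lat y) - (\<Sum>y\<in>Y. mn y)\<bar> \<le> (\<Sum>y\<in>Y. \<bar>lat y - mn y\<bar>)"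
      unfolding sum_subtractf[symmetric] by (rule sum_abs)
    also have "\<dots> \<le> (\<Sum>y\<in>Y. E * (1 + N * (1 / primitive_min y)))" by (rule sum_mono[OF err])
    also have "\<dots> = E * (real (card Y) + N * (\<Sum>y\<in>Y. 1 / primitive_min y))"
      by (simp only: sum_distrib_left[symmetric] sum.distrib sum_constant mult_1_right)
    also have "\<dots> \<le> E * (8 * (R * B) ^ 3 + ((R + 1) * B) * (K1 * B\<^sup>2))"
    proof (intro mult_left_mono add_mono cY mult_mono E0)
      show "real_of_int N \<le> (R + 1) * B" using N(2) B by (simp add: distrib_right)
      show "(\<Sum>y\<in>Y. 1 / real (primitive_min y)) \<le> K1 * B\<^sup>2" unfolding Y_def by (rule K1(2)[OF B])
      show "0 \<le> (R + 1) * B" using R B by simp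
      show "0 \<le> (\<Sum>y\<in>Y. 1 / real (primitive_min y))" by (intro sum_nonneg) simp
    qed
    also have "\<dots> = C1 * B ^ 3" unfolding C1_def by (simp add: power_mult_distrib distrib_left distrib_right eval_nat_numeral mult_ac)
    finally have 1: "\<bar>counting_function W B - (\<Sum>y\<in>Y. mn y)\<bar> \<le> C1 * B ^ 3" unfolding cf .
    define M where "M = nat \<lfloor>R * B\<rfloor>"
    have 2: "\<bar>(\<Sum>y\<in>Y. mn y) - I * B ^ 3 * jordan2_sum M\<bar> \<le> C2 * B ^ 3"
      using main_term_asymp[OF c(1) R K(1) B N(1) K(3) intH K(4)] unfolding Y_def mn_def X_def I_def M_def C2_def .
    \<comment> \<open>\<open>M\<close> lies between \<open>R * B / 2\<close> and
      \<open>R * B\<close>, so \<open>ln M\<close> and \<open>ln B\<close> differ by a bounded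
      amount.\<close>
    have M: "1 \<le> M" "real M \<le> R * B" "R * B \<le> 2 * real M"
    proof -
      have "1 \<le> \<lfloor>R * B\<rfloor>" using RB by simp
      from nat_mono[OF this] show "1 \<le> M" unfolding M_def nat_1 One_nat_def .
      have m: "real M = of_int \<lfloor>R * B\<rfloor>" unfolding M_def using \<open>1 \<le> \<lfloor>R * B\<rfloor>\<close> by simp
      show "real M \<le> R * B" unfolding m by (rule of_int_floor_le)
      have "R * B < real M + 1" unfolding m by linarith
      moreover have "1 \<le> real M" using \<open>1 \<le> M\<close> by simp
      ultimately show "R * B \<le> 2 * real M" by linarith
    qed
    have lnM: "\<bar>ln (real M) - ln B\<bar> \<le> ln R + 1"
    proof -
      have M0: "real M > 0" using M(1) by simp
      have "ln (real M) \<le> ln (R * B)" using M0 M(2) by simp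
      also have "\<dots> = ln R + ln B" using R B0 by (simp add: ln_mult)
      finally have a: "ln (real M) \<le> ln R + ln B" .
      have "1 * B \<le> R * B" using R B0 by (intro mult_right_mono) simp_all
      hence "B \<le> 2 * real M" using M(3) by linarith
      hence "ln B \<le> ln (2 * real M)" using B0 M0 by simp
      also have "\<dots> = ln 2 + ln (real M)" using M0 by (simp add: ln_mult)
      also have "ln 2 \<le> (1::real)" using ln_le_minus_one[of "2::real"] by simp
      finally have b: "ln B \<le> 1 + ln (real M)" by simp
      have "0 \<le> ln R" using R by simp
      thus ?thesis using a b by linarith
    qed
    have 3: "\<bar>I * B ^ 3 * jordan2_sum M - I / zeta 3 * B ^ 3 * ln B\<bar> \<le> C3 * B ^ 3"
    proof -
      have "I * B ^ 3 * jordan2_sum M - I / zeta 3 * B ^ 3 * ln B =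
          I * B ^ 3 * ((jordan2_sum M - ln (real M) / zeta 3) + (ln (real M) - ln B) / zeta 3)"
        by (simp add: diff_divide_distrib algebra_simps)
      also have "\<bar>\<dots>\<bar> = \<bar>I\<bar> * B ^ 3 * \<bar>(jordan2_sum M - ln (real M) / zeta 3) + (ln (real M) - ln B) / zeta 3\<bar>"
        using B0 by (simp add: abs_mult)
      also have "\<dots> \<le> \<bar>I\<bar> * B ^ 3 * (K2 + (ln R + 1) / \<bar>zeta 3\<bar>)"
      proof (rule mult_left_mono)
        have "\<bar>(ln (real M) - ln B) / zeta 3\<bar> \<le> (ln R + 1) / \<bar>zeta 3\<bar>"
          unfolding abs_divide by (rule divide_right_mono[OF lnM]) simp
        thus "\<bar>(jordan2_sum M - ln (real M) / zeta 3) + (ln (real M) - ln B) / zeta 3\<bar> \<le> K2 + (ln R + 1) / \<bar>zeta 3\<bar>"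
          using K2[OF M(1)] by linarith
        show "0 \<le> \<bar>I\<bar> * B ^ 3" using B0 by simp
      qed
      finally show ?thesis unfolding C3_def by (simp add: mult_ac)
    qed
    show ?thesis using 1 2 3 unfolding distrib_right by linarith
  qed
  thus "\<exists>C. \<forall>B\<ge>1. \<bar>counting_function W B - real_density W / zeta 3 * B ^ 3 * ln B\<bar> \<le> C * B ^ 3"
    unfolding rd by blast
qed

theorem theorem1p1:
  fixes \<epsilon> :: real and W :: "(real ^ 3) \<times> (real ^ 3) \<Rightarrow> real"
  assumes "\<epsilon> > 0"
    and "\<And>p. W p \<ge> 0"
    and "smooth W"
    and "compactly_supported_on W {(x, y). y $ 1 * y $ 2 * y $ 3 \<noteq> 0}"
  shows "(density_approx W \<longlongrightarrow> real_density W) (at_right 0) \<and>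
    (\<lambda>B. counting_function W B - real_density W / zeta 3 * B ^ 3 * ln B)
      \<in> O[at_top](\<lambda>B. B ^ 3 * (ln B) powr \<epsilon>)"
proof
  show "(density_approx W \<longlongrightarrow> real_density W) (at_right 0)" by (rule counting_function_estimate(1)[OF assms(3,4)])
  obtain C where C: "\<And>B. 1 \<le> B \<Longrightarrow> \<bar>counting_function W B - real_density W / zeta 3 * B ^ 3 * ln B\<bar> \<le> C * B ^ 3"
    using counting_function_estimate(2)[OF assms(3,4)] by blast
  show "(\<lambda>B. counting_function W B - real_density W / zeta 3 * B ^ 3 * ln B) \<in> O[at_top](\<lambda>B. B ^ 3 * (ln B) powr \<epsilon>)"
  proof (rule bigoI)
    show "\<forall>\<^sub>F B in at_top. norm (counting_function W B - real_density W / zeta 3 * B ^ 3 * ln B) \<le> \<bar>C\<bar> * norm (B ^ 3 * ln B powr \<epsilon>)"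
      \<comment> \<open>From \<open>exp 1\<close> on, \<open>ln B\<close> is at least 1, hence so is
        \<open>ln B powr \<epsilon>\<close>.\<close>
      using eventually_ge_at_top[of "exp 1 :: real"]
    proof eventually_elim
      case (elim B)
      have e1: "(1::real) \<le> exp 1" by simp
      have B: "1 \<le> B" using e1 elim by linarith
      have "1 \<le> ln B" using elim B by (simp add: ln_ge_iff)
      hence ln1: "1 \<le> ln B powr \<epsilon>" using assms(1) by (intro ge_one_powr_ge_zero) simp_all
      have "norm (counting_function W B - real_density W / zeta 3 * B ^ 3 * ln B) \<le> C * B ^ 3" using C[OF B] by simp
      also have "\<dots> \<le> \<bar>C\<bar> * (B ^ 3 * 1)" using B by (simp add: mult_right_mono)
      also have "\<dots> \<le> \<bar>C\<bar> * (B ^ 3 * ln B powr \<epsilon>)" using B by (intro mult_left_mono ln1) simp_all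
      also have "\<dots> = \<bar>C\<bar> * norm (B ^ 3 * ln B powr \<epsilon>)" using B by simp
      finally show ?case .
    qed
  qed
qed

end
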